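(* Let $N\ge 1$, $0<\theta\le 2$ and $p>1$, and set $p_\theta:=1+\theta/N$. Let $u$ be a solution of $\partial_t u+(-\Delta)^{\theta/2}u=u^p$ in $\mathbf{R}^N\times(0,T)$ (in the sense of the context), where $0<T<\infty$. Then there exists a unique Radon measure $\mu$ in $\mathbf{R}^N$ such that $$\operatorname*{ess\,lim}_{t\to+0}\int_{\mathbf{R}^N}u(y,t)\phi(y)\,dy=\int_{\mathbf{R}^N}\phi(y)\,d\mu(y)$$ for all $\phi\in C_0(\mathbf{R}^N)$. Furthermore, there exists $\gamma_1>0$ depending only on $N$, $\theta$ and $p$ such that (1) $\displaystyle\sup_{x\in\mathbf{R}^N}\mu(B(x,T^{1/\theta}))\le\gamma_1 T^{\frac{N}{\theta}-\frac{1}{p-1}}$ if $1<p<p_\theta$; (2) $\displaystyle\sup_{x\in\mathbf{R}^N}\mu(B(x,\sigma))\le\gamma_1\left[\log\left(e+\frac{T^{1/\theta}}{\sigma}\right)\right]^{-\frac{N}{\theta}}$ for all $0<\sigma<T^{1/\theta}$ if $p=p_\theta$; (3) $\displaystyle\sup_{x\in\mathbf{R}^N}\mu(B(x,\sigma))\le\gamma_1\sigma^{N-\frac{\theta}{p-1}}$ for all $0<\sigma<T^{1/\theta}$ if $p>p_\theta$.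
   Context: $B(x,r)=\{y\in\mathbf{R}^N:|x-y|<r\}$. $C_0(\mathbf{R}^N)$ denotes the continuous functions with compact support. Radon measures are nonnegative. $\operatorname{ess\,lim}_{t\to+0}$ is the limit as $t\to+0$ after discarding a set of times $t$ of Lebesgue measure zero. $G=G(x,t)$ denotes the fundamental solution of $\partial_t u+(-\Delta)^{\theta/2}u=0$ in $\mathbf{R}^N\times(0,\infty)$, i.e. the positive smooth kernel with $\int_{\mathbf{R}^N}G(x,t)e^{-i\xi\cdot x}\,dx=e^{-t|\xi|^\theta}$ (the Gauss kernel $(4\pi t)^{-N/2}e^{-|x|^2/4t}$ when $\theta=2$). A nonnegative measurable function $u$ in $\mathbf{R}^N\times(0,T)$, $0<T\le\infty$, is a solution of $\partial_t u+(-\Delta)^{\theta/2}u=u^p$ in $\mathbf{R}^N\times(0,T)$ if $$\infty>u(x,t)=\int_{\mathbf{R}^N}G(x-y,t-\tau)u(y,\tau)\,dy+\int_\tau^t\int_{\mathbf{R}^N}G(x-y,t-s)u(y,s)^p\,dy\,ds$$ for almost all $x\in\mathbf{R}^N$ and $0<\tau<t<T$. *)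

theory Defs
  imports "HOL-Analysis.Analysis"
begin

fun Ck_on :: "nat \<Rightarrow> 'a::euclidean_space set \<Rightarrow> ('a \<Rightarrow> real) \<Rightarrow> bool" where
  "Ck_on 0 S f \<longleftrightarrow> continuous_on S f"
| "Ck_on (Suc k) S f \<longleftrightarrow>
     (\<exists>f'. (\<forall>z\<in>S. (f has_derivative f' z) (at z)) \<and> (\<forall>b\<in>Basis. Ck_on k S (\<lambda>z. f' z b)))"

text \<open>Intended for open sets only.\<close>
definition smooth_on :: "'a::euclidean_space set \<Rightarrow> ('a \<Rightarrow> real) \<Rightarrow> bool" where
  "smooth_on S f \<longleftrightarrow> (\<forall>k. Ck_on k S f)"

text \<open>The fundamental solution of \<open>\<partial>\<^sub>t u + (- \<Delta>) ^ (\<theta>/2) u = 0\<close>: the positive smooth kernel on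
  space times \<open>(0, \<infinity>)\<close> whose spatial Fourier transform is \<open>exp (- t |\<xi>| ^ \<theta>)\<close>. By Fourier
  uniqueness these conditions determine \<open>G x t\<close> for all \<open>t > 0\<close>; values at \<open>t \<le> 0\<close> are never used.\<close>
definition fundamental_solution :: "real \<Rightarrow> (real ^ 'n \<Rightarrow> real \<Rightarrow> real) \<Rightarrow> bool" where
  "fundamental_solution \<theta> G \<longleftrightarrow>
     (\<forall>x. \<forall>t>0. 0 < G x t) \<and>
     smooth_on (UNIV \<times> {0<..}) (\<lambda>(x, t). G x t) \<and>
     (\<forall>t>0. \<forall>\<xi>. has_bochner_integral lborel
        (\<lambda>x. complex_of_real (G x t) * exp (- (\<i> * complex_of_real (\<xi> \<bullet> x))))
        (complex_of_real (exp (- (t * norm \<xi> powr \<theta>)))))"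

definition ennreal_powr :: "ennreal \<Rightarrow> real \<Rightarrow> ennreal" where
  "ennreal_powr a p = (if a = \<infinity> then \<infinity> else ennreal (enn2real a powr p))"

text \<open>A solution on space times \<open>(0, T)\<close> is a function with values in \<open>[0, \<infinity>]\<close>. It is Lebesgue
  measurable, and finiteness and the integral equation are required for almost every triple
  \<open>(x, \<tau>, t)\<close> with \<open>0 < \<tau> < t < T\<close>.\<close>
definition is_solution ::
  "(real ^ 'n \<Rightarrow> real \<Rightarrow> real) \<Rightarrow> real \<Rightarrow> real \<Rightarrow> (real ^ 'n \<Rightarrow> real \<Rightarrow> ennreal) \<Rightarrow> bool" where
  "is_solution G p T u \<longleftrightarrow>
     (\<lambda>(x, t). u x t) \<in> borel_measurable (lebesgue_on (UNIV \<times> {0<..<T})) \<and>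
     (AE (x, \<tau>, t) in lebesgue. 0 < \<tau> \<and> \<tau> < t \<and> t < T \<longrightarrow>
        u x t < \<infinity> \<and>
        u x t = (\<integral>\<^sup>+y. ennreal (G (x - y) (t - \<tau>)) * u y \<tau> \<partial>lebesgue)
              + (\<integral>\<^sup>+s\<in>{\<tau><..<t}.
                   (\<integral>\<^sup>+y. ennreal (G (x - y) (t - s)) * ennreal_powr (u y s) p \<partial>lebesgue) \<partial>lebesgue))"

definition radon_measure :: "'a::t2_space measure \<Rightarrow> bool" where
  "radon_measure \<mu> \<longleftrightarrow>
     sets \<mu> = sets borel \<and>
     (\<forall>K. compact K \<longrightarrow> emeasure \<mu> K < \<infinity>) \<and>
     (\<forall>A\<in>sets borel. emeasure \<mu> A = (SUP K\<in>{K. compact K \<and> K \<subseteq> A}. emeasure \<mu> K))"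

definition ess_lim_at_0 :: "(real \<Rightarrow> real) \<Rightarrow> real \<Rightarrow> bool" where
  "ess_lim_at_0 f L \<longleftrightarrow>
     (\<exists>Z\<in>null_sets lebesgue. (f \<longlongrightarrow> L) (at 0 within ({0<..} - Z)))"

text \<open>The Bochner integral of a non-integrable function is \<open>0\<close> by convention, so integrability at
  almost every time is stated separately. The detour through \<open>enn2real\<close> is harmless because a
  solution is finite almost everywhere.\<close>
definition initial_trace ::
  "real \<Rightarrow> (real ^ 'n \<Rightarrow> real \<Rightarrow> ennreal) \<Rightarrow> (real ^ 'n) measure \<Rightarrow> bool" where
  "initial_trace T u \<mu> \<longleftrightarrow>
     (\<forall>\<phi> :: real ^ 'n \<Rightarrow> real. continuous_on UNIV \<phi> \<and> compact (closure {x. \<phi> x \<noteq> 0}) \<longrightarrow>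
        (AE t in lebesgue. 0 < t \<and> t < T \<longrightarrow> integrable lebesgue (\<lambda>y. enn2real (u y t) * \<phi> y)) \<and>
        ess_lim_at_0 (\<lambda>t. \<integral>y. enn2real (u y t) * \<phi> y \<partial>lebesgue) (\<integral>y. \<phi> y \<partial>\<mu>))"

end

theory Submission
  imports Defs "HOL-Probability.Characteristic_Functions"
begin

text \<open>Write \<open>k(R, t)\<close> for the mass of \<open>u(t)\<close> in a ball of radius \<open>R\<close>. By scaling, a fixed part of
  the kernel mass emitted from any point of the ball during a time at most \<open>R\<^sup>\<theta>\<close> stays in the
  ball, so the integral equation and Jensen's inequality give
  \<open>k(R, t) \<ge> c k(R, \<tau>) + c \<integral>\<^bsub>\<tau>\<^esub>\<^bsup>t\<^esup> |B\<^bsub>R\<^esub>|\<^bsup>1-p\<^esup> k(R, s)\<^bsup>p\<^esup> ds\<close> for \<open>t - \<tau> \<le> R\<^sup>\<theta>\<close>. As \<open>k\<close> is finite up to \<open>T\<close>, a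
  doubling argument bounds \<open>k(R, \<tau>)\<close>, hence the trace on balls with \<open>R\<^sup>\<theta> \<le> T\<close>. In the critical case
  the same argument is run with the growing radius \<open>R = t powr (1/\<theta>)\<close>: then \<open>|B\<^bsub>R\<^esub>|\<^bsup>1-p\<^esup>\<close> is a multiple
  of \<open>1/t\<close>, and blow-up in the time scale \<open>ln t\<close> yields the logarithm.

  The trace exists because \<open>\<integral> u(t) \<phi>\<close> is almost increasing near \<open>t = 0\<close> for \<open>\<phi> \<ge> 0\<close>: it dominates
  \<open>\<integral> u(\<tau>) (G(t - \<tau>) * \<phi>)\<close>, and \<open>G(t - \<tau>) * \<phi>\<close> is uniformly almost as large as \<open>\<phi>\<close>. The limits form
  a positive functional, represented by a Radon measure.\<close>

section \<open>Uniqueness of the Fourier transform\<close>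

text \<open>The kernel is given only through its Fourier transform, and no explicit formula is
  available for general \<theta>. Two facts take its place: uniqueness of the Fourier transform
  makes \<open>G\<close> unique and self-similar, and \<open>G x 1\<close> is positive and
  continuous with integral 1. So all constants depend on N, \<theta> and p alone. Ball masses need a
  lower bound of the kernel near the origin, and the trace needs its mass to concentrate there;
  tails are never estimated.

  The equation holds only for almost every triple, so no prescribed time is available, whereas a
  doubling argument compares values at chosen times. It is therefore run on the time integral of the
  nonlinear term, which is monotone and defined at every time; ball masses need not be monotone,
  since only a fraction c is known to stay.

  Bounds (1) and (3) are one estimate on (0, T'), with T' = T and T' = \<sigma>^\<theta>. At p =
  p_\<theta> that estimate is a mere constant, and the logarithmic one degenerates as \<sigma>
  approaches T^(1/\<theta>), so the two are combined.\<close>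

definition gauss_density :: "'a::euclidean_space \<Rightarrow> real" where
  "gauss_density \<xi> = (\<Prod>b\<in>Basis. std_normal_density (\<xi> \<bullet> b))"

lemma gauss_density_nonneg [simp]: "0 \<le> gauss_density \<xi>"
  unfolding gauss_density_def by (intro prod_nonneg) auto

lemma borel_measurable_gauss_density [measurable]: "gauss_density \<in> borel_measurable borel"
  unfolding gauss_density_def by measurable

lemma std_normal_fourier:
  "has_bochner_integral lborel
     (\<lambda>x. complex_of_real (std_normal_density x) * exp (\<i> * complex_of_real (x * t)))
     (complex_of_real (exp (- t\<^sup>2 / 2)))"
proof -
  have int: "integrable lborel
     (\<lambda>x. complex_of_real (std_normal_density x) * exp (\<i> * complex_of_real (x * t)))"
  proof (rule Bochner_Integration.integrable_bound[of _ std_normal_density])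
    show "AE x in lborel. norm (complex_of_real (std_normal_density x) *
      exp (\<i> * complex_of_real (x * t))) \<le> norm (std_normal_density x)"
      by (simp add: norm_mult)
  qed (auto simp: integrable_normal_density)
  have "complex_of_real (exp (- t\<^sup>2 / 2)) = char std_normal_distribution t"
    by (simp add: char_std_normal_distribution)
  also have "\<dots> = (\<integral>x. std_normal_density x *\<^sub>R iexp (t * x) \<partial>lborel)"
    unfolding char_def by (subst integral_density) auto
  also have "\<dots> = (\<integral>x. complex_of_real (std_normal_density x) * exp (\<i> * complex_of_real (x * t)) \<partial>lborel)"
    by (simp add: scaleR_conv_of_real mult.commute)
  finally show ?thesis
    using int by (simp add: has_bochner_integral_iff)
qed

text \<open>Density and exponential both factor over the coordinates, and by
  \<open>lborel_eq\<close> Lebesgue measure is the image of a product of one-dimensional ones. The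
  integral is therefore a product of values of the characteristic function of the standard normal
  law.\<close>

lemma gauss_density_fourier:
  fixes w :: "'a::euclidean_space"
  shows "has_bochner_integral lborel
     (\<lambda>\<xi>. complex_of_real (gauss_density \<xi>) * exp (\<i> * complex_of_real (\<xi> \<bullet> w)))
     (complex_of_real (exp (- (norm w)\<^sup>2 / 2)))"
proof -
  interpret product_sigma_finite "\<lambda>_::'a. lborel :: real measure" ..
  define h where "h b x = complex_of_real (std_normal_density x) * exp (\<i> * complex_of_real (x * (w \<bullet> b)))"
    for b :: 'a and x :: real
  have [measurable]: "h b \<in> borel_measurable borel" for b
    unfolding h_def by measurable
  have hb: "has_bochner_integral lborel (h b) (complex_of_real (exp (- (w \<bullet> b)\<^sup>2 / 2)))" for b
    using std_normal_fourier[of "w \<bullet> b"] by (simp add: h_def[abs_def])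
  let ?s = "\<lambda>f. \<Sum>b\<in>Basis. f b *\<^sub>R (b::'a)"
  have prod_eq: "complex_of_real (gauss_density \<xi>) * exp (\<i> * complex_of_real (\<xi> \<bullet> w)) = (\<Prod>b\<in>Basis. h b (\<xi> \<bullet> b))"
    for \<xi> :: 'a
  proof -
    have "\<xi> \<bullet> w = (\<Sum>b\<in>Basis. (\<xi> \<bullet> b) * (w \<bullet> b))"
      by (rule euclidean_inner)
    then have "exp (\<i> * complex_of_real (\<xi> \<bullet> w)) = (\<Prod>b\<in>Basis. exp (\<i> * complex_of_real ((\<xi> \<bullet> b) * (w \<bullet> b))))"
      by (simp add: sum_distrib_left exp_sum)
    then show ?thesis
      by (simp add: gauss_density_def h_def prod.distrib)
  qed
  have coord: "(\<Prod>b\<in>Basis. h b (?s f \<bullet> b)) = (\<Prod>b\<in>Basis. h b (f b))" for f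
    by (intro prod.cong refl) (simp add: inner_sum_left inner_Basis if_distrib if_distribR cong: if_cong)
  have m: "?s \<in> (\<Pi>\<^sub>M b\<in>Basis. lborel) \<rightarrow>\<^sub>M borel"
    by measurable
  have m2: "(\<lambda>\<xi>. \<Prod>b\<in>Basis. h b (\<xi> \<bullet> b)) \<in> borel_measurable (borel :: 'a measure)"
    by measurable
  have i1: "integrable (\<Pi>\<^sub>M b\<in>Basis. lborel) (\<lambda>f. \<Prod>b\<in>Basis. h b (f b))"
    using hb by (intro product_integrable_prod) (auto simp: has_bochner_integral_iff)
  have i2: "integral\<^sup>L (\<Pi>\<^sub>M b\<in>Basis. lborel) (\<lambda>f. \<Prod>b\<in>Basis. h b (f b))
      = (\<Prod>b\<in>Basis. complex_of_real (exp (- (w \<bullet> b)\<^sup>2 / 2)))"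
    using hb by (subst product_integral_prod) (auto simp: has_bochner_integral_iff)
  have "(norm w)\<^sup>2 = (\<Sum>b\<in>Basis. (w \<bullet> b)\<^sup>2)"
    unfolding power2_norm_eq_inner by (subst euclidean_inner) (simp add: power2_eq_square)
  then have ex: "exp (- (norm w)\<^sup>2 / 2) = (\<Prod>b\<in>Basis. exp (- (w \<bullet> b)\<^sup>2 / 2))"
    by (simp add: exp_sum[symmetric] sum_negf sum_divide_distrib)
  have "(\<Prod>b\<in>Basis. complex_of_real (exp (- (w \<bullet> b)\<^sup>2 / 2))) = complex_of_real (exp (- (norm w)\<^sup>2 / 2))"
    unfolding ex by simp
  note i2 = i2[unfolded this]
  show ?thesis
    unfolding prod_eq
    apply (subst lborel_eq)
    unfolding has_bochner_integral_iff
    using i1 i2 m m2 by (simp add: integrable_distr_eq integral_distr coord)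
qed

text \<open>A Gaussian is itself a Fourier transform. Inserting that formula and exchanging the
  integrals leaves, for each frequency \<xi>, the transform of \<open>f\<close> at \<xi>/e as a
  factor of the inner integral, and it vanishes. The width \<open>e\<close> is free, so
  \<open>f\<close> can be probed at every scale around \<open>x\<close>.\<close>

lemma fourier_zero_gauss_zero:
  fixes f :: "'a::euclidean_space \<Rightarrow> real"
  assumes f: "integrable lborel f"
    and zero: "\<And>\<xi>. (\<integral>y. complex_of_real (f y) * exp (- (\<i> * complex_of_real (\<xi> \<bullet> y))) \<partial>lborel) = 0"
    and "e \<noteq> 0"
  shows "(\<integral>y. f y * exp (- (norm ((1 / e) *\<^sub>R (x - y)))\<^sup>2 / 2) \<partial>lborel) = 0"
proof -
  have [measurable]: "f \<in> borel_measurable borel"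
    using f by auto
  define H where "H = (\<lambda>(y, \<xi>). complex_of_real (f y) *
    (complex_of_real (gauss_density \<xi>) * exp (\<i> * complex_of_real (\<xi> \<bullet> ((1 / e) *\<^sub>R (x - y))))))"
  have gd: "integrable lborel (gauss_density :: 'a \<Rightarrow> real)"
    using gauss_density_fourier[of "0::'a"] by (simp add: has_bochner_integral_iff complex_of_real_integrable_eq)
  have [measurable]: "H \<in> borel_measurable (lborel \<Otimes>\<^sub>M lborel)"
    unfolding H_def by measurable
  have "integrable (lborel \<Otimes>\<^sub>M lborel) H"
  proof (rule Bochner_Integration.integrable_bound)
    show "integrable (lborel \<Otimes>\<^sub>M lborel) (\<lambda>(y, \<xi> :: 'a). f y * gauss_density \<xi>)"
      by (intro lborel_pair.Fubini_integrable)
        (use f gd in \<open>auto simp: abs_mult\<close>)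
  qed (auto simp: H_def norm_mult)
  then have fub: "(\<integral>\<xi>. (\<integral>y. H (y, \<xi>) \<partial>lborel) \<partial>lborel) = (\<integral>y. (\<integral>\<xi>. H (y, \<xi>) \<partial>lborel) \<partial>lborel)"
    by (intro lborel_pair.Fubini_integral) simp
  have inner0: "(\<integral>y. H (y, \<xi>) \<partial>lborel) = 0" for \<xi>
  proof -
    have "H (y, \<xi>) = complex_of_real (gauss_density \<xi>) * exp (\<i> * complex_of_real (\<xi> \<bullet> x / e)) *
       (complex_of_real (f y) * exp (- (\<i> * complex_of_real (((1 / e) *\<^sub>R \<xi>) \<bullet> y))))" for y
      by (simp add: H_def inner_diff_right diff_divide_distrib right_diff_distrib exp_diff exp_minus field_simps)
    then show ?thesis
      using zero[of "(1 / e) *\<^sub>R \<xi>"] by simp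
  qed
  have "complex_of_real (\<integral>y. f y * exp (- (norm ((1 / e) *\<^sub>R (x - y)))\<^sup>2 / 2) \<partial>lborel)
      = (\<integral>y. (\<integral>\<xi>. H (y, \<xi>) \<partial>lborel) \<partial>lborel)"
    unfolding H_def prod.case integral_mult_right_zero
      has_bochner_integral_integral_eq[OF gauss_density_fourier]
    unfolding of_real_mult[symmetric] by (rule integral_complex_of_real[symmetric])
  also have "\<dots> = 0"
    unfolding fub[symmetric] inner0 by simp
  finally show ?thesis by simp
qed

text \<open>Pairing \<open>f\<close> with Gaussians of width \<open>e\<close> around
  \<open>x\<close> gives 0. If \<open>f x\<close> were positive, the part near \<open>x\<close>
  would contribute at least a multiple of \<open>e ^ n\<close>, while everything at distance
  \<delta> or more contributes at most \<open>I * exp (- (\<delta> / e)\<^sup>2 / 2)\<close>, which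
  is smaller for small \<open>e\<close>. The one-sided form is later applied to both differences of
  two functions.\<close>

lemma fourier_zero_nonpos:
  fixes f :: "'a::euclidean_space \<Rightarrow> real"
  assumes f: "integrable lborel f" and cont: "isCont f x"
    and zero: "\<And>\<xi>. (\<integral>y. complex_of_real (f y) * exp (- (\<i> * complex_of_real (\<xi> \<bullet> y))) \<partial>lborel) = 0"
  shows "f x \<le> 0"
proof (rule ccontr)
  assume "\<not> f x \<le> 0"
  then have pos: "f x > 0" by simp
  obtain \<delta> where \<delta>: "\<delta> > 0" "\<And>y. dist y x < \<delta> \<Longrightarrow> dist (f y) (f x) < f x / 2"
    using cont pos unfolding continuous_at_eps_delta by (metis half_gt_zero)
  have lowf: "f y \<ge> f x / 2" if "dist y x < \<delta>" for y
    using \<delta>(2)[OF that] by (auto simp: dist_real_def abs_if split: if_splits)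
  define n where "n = DIM('a)"
  define V where "V = unit_ball_vol (real n)"
  have V: "V > 0" by (simp add: V_def unit_ball_vol_pos)
  define I where "I = (\<integral>y. \<bar>f y\<bar> \<partial>lborel)"
  have main: "f x / 2 * exp (- 1 / 2) * (V * e ^ n) \<le> I * exp (- (\<delta> / e)\<^sup>2 / 2)"
    if e: "0 < e" "e < \<delta>" for e
  proof -
    let ?g = "\<lambda>y. exp (- (norm ((1 / e) *\<^sub>R (x - y)))\<^sup>2 / 2)"
    \<comment> \<open>A minorant in three zones: within \<open>e\<close> of \<open>x\<close> the
      Gaussian is at least exp(-1/2); between \<open>e\<close> and \<delta> the integrand is still
      positive and is dropped; beyond \<delta> the Gaussian is at most its value at distance
      \<delta>.\<close>
    let ?l = "\<lambda>y. f x / 2 * exp (- 1 / 2) * indicator (ball x e) y - \<bar>f y\<bar> * exp (- (\<delta> / e)\<^sup>2 / 2)"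
    have [measurable]: "f \<in> borel_measurable borel"
      using f by auto
    have ib: "integrable lborel (indicator (ball x e) :: 'a \<Rightarrow> real)"
      by (intro integrable_real_indicator) (use e in \<open>auto simp: emeasure_ball\<close>)
    have le: "?l y \<le> f y * ?g y" for y
    proof -
      have nrm: "norm ((1 / e) *\<^sub>R (x - y)) = dist x y / e"
        using e by (simp add: dist_norm)
      show ?thesis
      proof (cases "dist x y < \<delta>")
        case True
        then have fy: "f y \<ge> f x / 2" by (intro lowf) (simp add: dist_commute)
        have "f x / 2 * exp (- 1 / 2) * indicator (ball x e) y \<le> f y * ?g y"
        proof (cases "dist x y < e")
          case True
          have "(dist x y / e)\<^sup>2 \<le> 1"
            using True e by (simp add: power_le_one_iff abs_square_le_1)
          then have "exp (- 1 / 2) \<le> ?g y" unfolding nrm by simp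
          then have "f x / 2 * exp (- 1 / 2) \<le> f y * ?g y"
            using fy pos by (intro mult_mono) auto
          then show ?thesis using True by (simp add: indicator_def)
        qed (use fy pos in \<open>simp add: indicator_def\<close>)
        then show ?thesis by (smt (verit) exp_ge_zero mult_nonneg_nonneg abs_ge_zero)
      next
        case False
        then have "\<delta> / e \<le> dist x y / e" using e by (intro divide_right_mono) auto
        then have "(\<delta> / e)\<^sup>2 \<le> (dist x y / e)\<^sup>2"
          using e \<delta>(1) by (intro power_mono) auto
        then have "?g y \<le> exp (- (\<delta> / e)\<^sup>2 / 2)" unfolding nrm by simp
        then have "\<bar>f y\<bar> * ?g y \<le> \<bar>f y\<bar> * exp (- (\<delta> / e)\<^sup>2 / 2)"
          by (intro mult_left_mono) auto
        moreover have "- (\<bar>f y\<bar> * ?g y) \<le> f y * ?g y"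
          by (smt (verit, ccfv_SIG) exp_ge_zero mult_minus_left mult_right_mono)
        moreover have "indicator (ball x e) y = (0::real)"
          using False e by (simp add: indicator_def)
        ultimately show ?thesis by simp
      qed
    qed
    have intg: "integrable lborel (\<lambda>y. f y * ?g y)"
      by (rule Bochner_Integration.integrable_bound[OF f]) (auto simp: abs_mult mult_left_le)
    have "(\<integral>y. ?l y \<partial>lborel) \<le> (\<integral>y. f y * ?g y \<partial>lborel)"
      using f ib intg le by (intro integral_mono) auto
    also have "\<dots> = 0"
      using fourier_zero_gauss_zero[OF f zero, of e x] e by simp
    finally have "(\<integral>y. ?l y \<partial>lborel) \<le> 0" .
    moreover have "(\<integral>y. ?l y \<partial>lborel) = f x / 2 * exp (- 1 / 2) * (V * e ^ n) - I * exp (- (\<delta> / e)\<^sup>2 / 2)"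
      using f ib e by (simp add: I_def content_ball V_def n_def)
    ultimately show ?thesis by simp
  qed
  define c where "c = f x / 2 * exp (- 1 / 2) * V"
  have c: "c > 0" using pos V by (simp add: c_def)
  define d where "d = \<delta>\<^sup>2 / 2"
  have d: "d > 0" using \<delta> by (simp add: d_def)
  \<comment> \<open>The parameter is s = (\<delta>/e)^2 / 2, so e^2 = d/s, and letting e tend to 0
    means letting s tend to infinity.\<close>
  have bound: "c * d ^ n \<le> I * (s ^ n / exp s)" if s: "s \<ge> max 1 (4 * d) * max 1 (1 / d)" for s
  proof -
    have s1: "s \<ge> 1" "s \<ge> 4 * d"
      using s by (smt (verit, best) max.cobounded1 max.cobounded2 mult_le_cancel_left1 mult_le_cancel_left2)+
    have s2: "d / s \<le> 1"
      using s1 d by (simp add: field_simps)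
    have "s > 0" using s1 by simp
    define e where "e = sqrt (d / s)"
    have e: "e > 0" "e\<^sup>2 = d / s" using \<open>s > 0\<close> d by (auto simp: e_def)
    have "e\<^sup>2 < \<delta>\<^sup>2"
    proof -
      have "d / s \<le> d" using s1 d by (simp add: field_simps)
      moreover have "d < \<delta>\<^sup>2" using \<delta>(1) by (simp add: d_def)
      ultimately show ?thesis using e(2) by linarith
    qed
    then have "e < \<delta>" using \<delta>(1) by (simp add: power2_less_imp_less)
    have e1: "e \<le> 1" using e s2 by (simp add: e_def)
    from main[OF \<open>e > 0\<close> \<open>e < \<delta>\<close>]
    have "c * e ^ n \<le> I * exp (- (\<delta> / e)\<^sup>2 / 2)" by (simp add: c_def algebra_simps)
    also have "(\<delta> / e)\<^sup>2 / 2 = s"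
      using e d \<open>s > 0\<close> by (simp add: power_divide d_def field_simps)
    then have "exp (- (\<delta> / e)\<^sup>2 / 2) = 1 / exp s" by (simp add: exp_minus field_simps)
    finally have 1: "c * e ^ n \<le> I * (1 / exp s)" .
    \<comment> \<open>Since e \<le> 1, \<open>e ^ n\<close> may be lowered to its square, which is
      the integer power \<open>(d / s) ^ n\<close>; the loss is negligible against
      \<open>exp s\<close>.\<close>
    have "(d / s) ^ n = e ^ n * e ^ n" by (simp add: e(2)[symmetric] power2_eq_square power_mult_distrib)
    also have "\<dots> \<le> e ^ n * 1" using e e1 by (intro mult_left_mono power_le_one) auto
    finally have "c * (d / s) ^ n \<le> c * e ^ n" using c by simp
    with 1 have "c * (d / s) ^ n \<le> I * (1 / exp s)" by simp
    then have "c * (d / s) ^ n * s ^ n \<le> I * (1 / exp s) * s ^ n"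
      using \<open>s > 0\<close> by (intro mult_right_mono) auto
    then show ?thesis using \<open>s > 0\<close> by (simp add: power_divide)
  qed
  have "((\<lambda>s. I * (s ^ n / exp s)) \<longlongrightarrow> I * 0) at_top"
    by (intro tendsto_intros tendsto_power_div_exp_0)
  then have "c * d ^ n \<le> I * 0"
    by (rule tendsto_lowerbound) (use bound in \<open>auto intro: eventually_mono[OF eventually_ge_at_top]\<close>)
  moreover have "c * d ^ n > 0" using c d by simp
  ultimately show False by simp
qed

lemma fourier_unique:
  fixes f g :: "'a::euclidean_space \<Rightarrow> real"
  assumes f: "\<And>\<xi>. has_bochner_integral lborel
      (\<lambda>y. complex_of_real (f y) * exp (- (\<i> * complex_of_real (\<xi> \<bullet> y)))) (F \<xi>)"
    and g: "\<And>\<xi>. has_bochner_integral lborel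
      (\<lambda>y. complex_of_real (g y) * exp (- (\<i> * complex_of_real (\<xi> \<bullet> y)))) (F \<xi>)"
    and cont: "continuous_on UNIV f" "continuous_on UNIV g"
  shows "f = g"
proof
  fix x
  have int: "integrable lborel f" "integrable lborel g"
    using f[of 0] g[of 0] by (simp_all add: has_bochner_integral_iff complex_of_real_integrable_eq)
  have c: "isCont f x" "isCont g x"
    using cont by (auto simp: continuous_on_eq_continuous_at)
  have d: "has_bochner_integral lborel
      (\<lambda>y. complex_of_real (f y - g y) * exp (- (\<i> * complex_of_real (\<xi> \<bullet> y)))) 0"
      "has_bochner_integral lborel
      (\<lambda>y. complex_of_real (g y - f y) * exp (- (\<i> * complex_of_real (\<xi> \<bullet> y)))) 0" for \<xi>
    using has_bochner_integral_diff[OF f[of \<xi>] g[of \<xi>]] has_bochner_integral_diff[OF g[of \<xi>] f[of \<xi>]]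
    by (simp_all add: algebra_simps)
  have "f x - g x \<le> 0"
    by (rule fourier_zero_nonpos[of "\<lambda>x. f x - g x"])
      (use int c d in \<open>auto simp: has_bochner_integral_iff\<close>)
  moreover have "g x - f x \<le> 0"
    by (rule fourier_zero_nonpos[of "\<lambda>x. g x - f x"])
      (use int c d in \<open>auto simp: has_bochner_integral_iff\<close>)
  ultimately show "f x = g x" by simp
qed

section \<open>The fundamental solution\<close>

lemma has_bochner_integral_lborel_scale:
  fixes f :: "'a::euclidean_space \<Rightarrow> 'b::{banach, second_countable_topology}"
  assumes c: "0 < c" and [measurable]: "f \<in> borel_measurable borel"
    and f: "has_bochner_integral lborel (\<lambda>x. f (c *\<^sub>R x)) i"
  shows "has_bochner_integral lborel f (c ^ DIM('a) *\<^sub>R i)"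
proof -
  have eq: "(lborel :: 'a measure) = density (distr lborel borel (\<lambda>x. c *\<^sub>R x)) (\<lambda>_. ennreal (c ^ DIM('a)))"
    using lborel_affine[of c "0::'a"] c by (simp add: ennreal_power)
  have "has_bochner_integral (density (distr lborel borel (\<lambda>x. c *\<^sub>R x)) (\<lambda>_. ennreal (c ^ DIM('a)))) f
    (c ^ DIM('a) *\<^sub>R i)"
    using c f by (intro has_bochner_integral_density)
      (auto simp: has_bochner_integral_iff integrable_distr_eq integral_distr)
  then show ?thesis
    using eq by simp
qed

lemma nn_integral_lborel_affine:
  fixes f :: "'a::euclidean_space \<Rightarrow> ennreal"
  assumes c: "0 < c" and [measurable]: "f \<in> borel_measurable borel"
  shows "(\<integral>\<^sup>+x. f x \<partial>lborel) = ennreal (c ^ DIM('a)) * (\<integral>\<^sup>+x. f (a + c *\<^sub>R x) \<partial>lborel)"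
proof -
  have "(\<integral>\<^sup>+x. f x \<partial>lborel) = (\<integral>\<^sup>+x. f x \<partial>density (distr lborel borel (\<lambda>x. a + c *\<^sub>R x)) (\<lambda>_. ennreal (c ^ DIM('a))))"
    using lborel_affine[of c a] c by (simp add: ennreal_power)
  also have "\<dots> = ennreal (c ^ DIM('a)) * (\<integral>\<^sup>+x. f (a + c *\<^sub>R x) \<partial>lborel)"
    by (simp add: nn_integral_density nn_integral_distr nn_integral_cmult)
  finally show ?thesis .
qed

context
  fixes \<theta> :: real and G :: "real ^ 'n \<Rightarrow> real \<Rightarrow> real"
  assumes G: "fundamental_solution \<theta> G" and \<theta>: "0 < \<theta>"
begin

lemma kernel_pos: "0 < t \<Longrightarrow> 0 < G x t"
  using G by (simp add: fundamental_solution_def)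

lemma continuous_on_kernel: "continuous_on (UNIV \<times> {0<..}) (\<lambda>(x, t). G x t)"
proof -
  have "Ck_on 0 (UNIV \<times> {0<..}) (\<lambda>(x, t). G x t)"
    using G unfolding fundamental_solution_def smooth_on_def by blast
  then show ?thesis by simp
qed

lemma continuous_on_kernel_slice: "0 < t \<Longrightarrow> continuous_on UNIV (\<lambda>x. G x t)"
  using continuous_on_compose2[OF continuous_on_kernel, of UNIV "\<lambda>x. (x, t)"]
  by (force intro: continuous_on_Pair continuous_on_id continuous_on_const)

lemma borel_measurable_kernel_slice: "0 < t \<Longrightarrow> (\<lambda>x. G x t) \<in> borel_measurable borel"
  by (intro borel_measurable_continuous_onI continuous_on_kernel_slice)

lemma kernel_fourier:
  "0 < t \<Longrightarrow> has_bochner_integral lborel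
     (\<lambda>x. complex_of_real (G x t) * exp (- (\<i> * complex_of_real (\<xi> \<bullet> x))))
     (complex_of_real (exp (- (t * norm \<xi> powr \<theta>))))"
  using G by (simp add: fundamental_solution_def)

text \<open>The symbol is homogeneous: for \<rho> = t^(1/\<theta>) the norm of \<rho>\<xi> to the
  power \<theta> is t times that of \<xi>. So the rescaled profile \<open>H\<close> and
  \<open>G\<close> at time t have the same Fourier transform, and continuity of both upgrades this
  to equality at every point.\<close>

lemma kernel_scaling:
  assumes t: "0 < t"
  shows "G x t = t powr (- (real CARD('n) / \<theta>)) * G ((t powr (- (1 / \<theta>))) *\<^sub>R x) 1"
proof -
  define \<rho> where "\<rho> = t powr (1 / \<theta>)"
  have \<rho>: "\<rho> > 0" using t by (simp add: \<rho>_def)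
  have \<rho>i: "t powr (- (1 / \<theta>)) = 1 / \<rho>" by (simp add: \<rho>_def powr_minus_divide)
  have \<rho>n: "t powr (- (real CARD('n) / \<theta>)) = 1 / \<rho> ^ CARD('n)"
    using t by (simp add: \<rho>_def powr_minus_divide powr_realpow[symmetric] powr_powr)
  have \<rho>\<theta>: "\<rho> powr \<theta> = t"
    using t \<theta> by (simp add: \<rho>_def powr_powr)
  define H where "H = (\<lambda>x. 1 / \<rho> ^ CARD('n) * G ((1 / \<rho>) *\<^sub>R x) 1)"
  have contH: "continuous_on UNIV H"
    unfolding H_def
    by (intro continuous_intros continuous_on_compose2[OF continuous_on_kernel_slice[of 1]]) auto
  have [measurable]: "H \<in> borel_measurable borel"
    by (intro borel_measurable_continuous_onI contH)
  let ?I = "\<lambda>\<xi>. complex_of_real (1 / \<rho> ^ CARD('n)) * complex_of_real (exp (- (1 * norm (\<rho> *\<^sub>R \<xi>) powr \<theta>)))"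
  have "has_bochner_integral lborel
      (\<lambda>x. complex_of_real (H x) * exp (- (\<i> * complex_of_real (\<xi> \<bullet> x))))
      (\<rho> ^ DIM(real^'n) *\<^sub>R (?I \<xi>))" for \<xi>
  proof (rule has_bochner_integral_lborel_scale[OF \<rho>])
    have "has_bochner_integral lborel
      (\<lambda>x. complex_of_real (1 / \<rho> ^ CARD('n)) * (complex_of_real (G x 1) * exp (- (\<i> * complex_of_real ((\<rho> *\<^sub>R \<xi>) \<bullet> x)))))
      (?I \<xi>)"
      by (intro has_bochner_integral_mult_right kernel_fourier) auto
    then show "has_bochner_integral lborel
      (\<lambda>x. complex_of_real (H (\<rho> *\<^sub>R x)) * exp (- (\<i> * complex_of_real (\<xi> \<bullet> (\<rho> *\<^sub>R x)))))
      (?I \<xi>)"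
      using \<rho> by (simp add: H_def mult.assoc)
  qed measurable
  moreover have "norm (\<rho> *\<^sub>R \<xi>) powr \<theta> = t * norm \<xi> powr \<theta>" for \<xi> :: "real^'n"
    using \<rho> by (simp add: powr_mult \<rho>\<theta>)
  then have "\<rho> ^ DIM(real^'n) *\<^sub>R (?I \<xi>)
     = complex_of_real (exp (- (t * norm \<xi> powr \<theta>)))" for \<xi> :: "real^'n"
    using \<rho> by (simp add: scaleR_conv_of_real[where 'a = complex])
  ultimately have "(\<lambda>x. G x t) = H"
    using kernel_fourier[OF t] continuous_on_kernel_slice[OF t] contH
    by (intro fourier_unique) auto
  then show ?thesis
    unfolding \<rho>i \<rho>n H_def by (rule fun_cong)
qed

lemma nn_integral_kernel:
  assumes t: "0 < t"
  shows "(\<integral>\<^sup>+x. ennreal (G x t) \<partial>lborel) = 1"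
proof -
  have "has_bochner_integral lborel (\<lambda>x. complex_of_real (G x t)) (complex_of_real 1)"
    using kernel_fourier[OF t, of 0] by simp
  then have i: "integrable lborel (\<lambda>x. G x t)" and e: "(\<integral>x. G x t \<partial>lborel) = 1"
    by (simp_all add: has_bochner_integral_iff complex_of_real_integrable_eq)
  show ?thesis
    using nn_integral_eq_integral[OF i] kernel_pos[OF t] e by (simp add: less_imp_le)
qed

text \<open>By monotone convergence over growing balls, some ball carries more than 1 - \<epsilon>
  of the mass of \<open>G x 1\<close>. At time r scaling shrinks that ball by the factor
  r^(1/\<theta>), hence into the ball of radius \<delta> once r is small.\<close>

lemma kernel_concentration:
  assumes \<delta>: "0 < \<delta>" and \<epsilon>: "0 < \<epsilon>"
  obtains r0 where "0 < r0"
    "\<And>r. 0 < r \<Longrightarrow> r < r0 \<Longrightarrow> ennreal (1 - \<epsilon>) \<le> (\<integral>\<^sup>+z\<in>ball 0 \<delta>. ennreal (G z r) \<partial>lborel)"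
proof -
  note [measurable] = borel_measurable_kernel_slice[of 1, simplified]
  have [measurable]: "ball a s \<in> sets borel" for a :: "real^'n" and s
    by simp
  let ?f = "\<lambda>n x. ennreal (G x 1) * indicator (ball 0 (real n)) x"
  have inc: "incseq (?f)"
    by (auto simp: incseq_def le_fun_def split: split_indicator)
  have "(SUP n. \<integral>\<^sup>+x. ?f n x \<partial>lborel)
      = (\<integral>\<^sup>+x. (SUP n. ?f n x) \<partial>lborel)"
    by (rule nn_integral_monotone_convergence_SUP[symmetric, OF inc]) measurable
  also have "\<dots> = (\<integral>\<^sup>+x. ennreal (G x 1) \<partial>lborel)"
  proof (intro nn_integral_cong antisym)
    fix x :: "real^'n"
    obtain n where "norm x < real n" using reals_Archimedean2 by blast
    then show "ennreal (G x 1) \<le> (SUP n. ?f n x)"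
      by (intro SUP_upper2[of n]) auto
    show "(SUP n. ?f n x) \<le> ennreal (G x 1)"
      by (intro SUP_least) (auto split: split_indicator)
  qed
  finally have sup: "(SUP n. \<integral>\<^sup>+x. ?f n x \<partial>lborel) = 1"
    using nn_integral_kernel[of 1] by simp
  have "ennreal (1 - \<epsilon>) < 1"
    using \<epsilon> by (simp add: ennreal_less_one_iff)
  then have "ennreal (1 - \<epsilon>) < (SUP n. \<integral>\<^sup>+x. ?f n x \<partial>lborel)"
    by (simp add: sup)
  then obtain n where n: "ennreal (1 - \<epsilon>) < (\<integral>\<^sup>+x. ?f n x \<partial>lborel)"
    by (auto simp: less_SUP_iff)
  \<comment> \<open>The summand 1 keeps \<open>m\<close> positive when \<open>n\<close> is
    0.\<close>
  define m where "m = real n + 1"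
  have m: "m > 0" by (simp add: m_def)
  show thesis
  proof (rule that)
    show "0 < (\<delta> / m) powr \<theta>" using \<delta> m by simp
    fix r assume r: "0 < r" "r < (\<delta> / m) powr \<theta>"
    define \<rho> where "\<rho> = r powr (1 / \<theta>)"
    have \<rho>: "\<rho> > 0" using r by (simp add: \<rho>_def)
    have "\<rho> < ((\<delta> / m) powr \<theta>) powr (1 / \<theta>)"
      unfolding \<rho>_def using r \<theta> by (intro powr_less_mono2) auto
    then have "\<rho> < \<delta> / m" using \<delta> m \<theta> by (simp add: powr_powr)
    then have \<rho>m: "m * \<rho> < \<delta>" using m by (simp add: field_simps)
    have sc: "G (\<rho> *\<^sub>R z) r * \<rho> ^ CARD('n) = G z 1" for z
    proof -
      have "r powr (- (1 / \<theta>)) = 1 / \<rho>" by (simp add: \<rho>_def powr_minus_divide)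
      moreover have "r powr (- (real CARD('n) / \<theta>)) = 1 / \<rho> ^ CARD('n)"
        using r by (simp add: \<rho>_def powr_minus_divide powr_realpow[symmetric] powr_powr)
      ultimately show ?thesis
        using kernel_scaling[OF r(1), of "\<rho> *\<^sub>R z"] \<rho> by simp
    qed
    have [measurable]: "(\<lambda>x. G x r) \<in> borel_measurable borel"
      by (rule borel_measurable_kernel_slice[OF r(1)])
    have "(\<integral>\<^sup>+z\<in>ball 0 \<delta>. ennreal (G z r) \<partial>lborel)
      = ennreal (\<rho> ^ DIM(real^'n)) * (\<integral>\<^sup>+z. ennreal (G (0 + \<rho> *\<^sub>R z) r) * indicator (ball 0 \<delta>) (0 + \<rho> *\<^sub>R z) \<partial>lborel)"
      by (rule nn_integral_lborel_affine[OF \<rho>]) measurable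
    also have "\<dots> = (\<integral>\<^sup>+z. ennreal (\<rho> ^ CARD('n)) * (ennreal (G (\<rho> *\<^sub>R z) r) * indicator (ball 0 \<delta>) (\<rho> *\<^sub>R z)) \<partial>lborel)"
      by (subst nn_integral_cmult) auto
    also have "\<dots> = (\<integral>\<^sup>+z. ennreal (G z 1) * indicator (ball 0 \<delta>) (\<rho> *\<^sub>R z) \<partial>lborel)"
      using \<rho> kernel_pos[OF r(1)] by (intro nn_integral_cong)
        (simp add: mult.assoc[symmetric] ennreal_mult[symmetric] sc[symmetric] mult.commute less_imp_le)
    also have "\<dots> \<ge> (\<integral>\<^sup>+x. ?f n x \<partial>lborel)"
    proof (intro nn_integral_mono mult_left_mono)
      fix x :: "real^'n"
      show "indicator (ball 0 (real n)) x \<le> (indicator (ball 0 \<delta>) (\<rho> *\<^sub>R x) :: ennreal)"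
      proof (cases "norm x < real n")
        case True
        then have "\<rho> * norm x \<le> \<rho> * m" using \<rho> by (simp add: m_def)
        then have "\<rho> * norm x < \<delta>" using \<rho>m by (simp add: mult.commute)
        then show ?thesis using \<rho> by (simp add: indicator_def)
      qed (simp add: indicator_def)
    qed simp
    finally show "ennreal (1 - \<epsilon>) \<le> (\<integral>\<^sup>+z\<in>ball 0 \<delta>. ennreal (G z r) \<partial>lborel)"
      using n by order
  qed
qed

end

text \<open>The constant does not depend on \<open>G\<close>, since \<open>G\<close> is determined by its Fourier transform.\<close>

lemma kernel_lower_bound:
  assumes \<theta>: "0 < \<theta>"
  obtains c where "0 < c"
    "\<And>(G :: real ^ 'n \<Rightarrow> real \<Rightarrow> real) r z. fundamental_solution \<theta> G \<Longrightarrow> 0 < r \<Longrightarrow> norm z \<le> r powr (1 / \<theta>) \<Longrightarrow>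
      c * r powr (- (real CARD('n) / \<theta>)) \<le> G z r"
proof (cases "\<exists>G :: real ^ 'n \<Rightarrow> real \<Rightarrow> real. fundamental_solution \<theta> G")
  case True
  then obtain H :: "real ^ 'n \<Rightarrow> real \<Rightarrow> real" where H: "fundamental_solution \<theta> H" by blast
  have "continuous_on (cball 0 1) (\<lambda>x. H x 1)"
    using continuous_on_kernel_slice[OF H \<theta>, of 1] by (auto intro: continuous_on_subset)
  then obtain x where x: "\<And>y. y \<in> cball 0 1 \<Longrightarrow> H x 1 \<le> H y 1"
    using continuous_attains_inf[of "cball 0 1" "\<lambda>x. H x 1"] compact_cball cball_eq_empty
    by (metis not_one_less_zero)
  show ?thesis
  proof (rule that)
    show "0 < H x 1" using kernel_pos[OF H \<theta>] by simp
    fix G :: "real ^ 'n \<Rightarrow> real \<Rightarrow> real" and r :: real and z :: "real ^ 'n"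
    assume G: "fundamental_solution \<theta> G" and r: "0 < r" and z: "norm z \<le> r powr (1 / \<theta>)"
    have "(\<lambda>x. H x 1) = (\<lambda>x. G x 1)"
      using kernel_fourier[OF H \<theta>, of 1] kernel_fourier[OF G \<theta>, of 1]
        continuous_on_kernel_slice[OF H \<theta>, of 1] continuous_on_kernel_slice[OF G \<theta>, of 1]
      by (intro fourier_unique) auto
    then have HG: "G y 1 = H y 1" for y :: "real ^ 'n" by (simp add: fun_eq_iff)
    have "norm ((r powr (- (1 / \<theta>))) *\<^sub>R z) \<le> 1"
      using z r by (simp add: powr_minus field_simps)
    then have "H x 1 \<le> G ((r powr (- (1 / \<theta>))) *\<^sub>R z) 1"
      using x by (simp add: HG)
    then show "H x 1 * r powr (- (real CARD('n) / \<theta>)) \<le> G z r"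
      unfolding kernel_scaling[OF G \<theta> r, of z] mult.commute[of "H x 1"] by (intro mult_left_mono) auto
  qed
\<comment> \<open>If there is no fundamental solution, the bound is vacuous and any positive
  constant serves.\<close>
qed (use that[of 1] in auto)

text \<open>With \<rho> = r^(1/\<theta>) \<le> R, the kernel is at least c \<rho>^(-N) within
  distance \<rho> of \<open>y\<close>. The part of that region lying in \<open>ball x0 R\<close>
  contains a ball of radius \<rho>/2 even when \<open>y\<close> is near the boundary, so the scale
  cancels against the volume and the constant is free of r and R.\<close>

lemma kernel_ball_mass:
  assumes \<theta>: "0 < \<theta>"
  obtains c where "0 < c"
    "\<And>(G :: real ^ 'n \<Rightarrow> real \<Rightarrow> real) r R x0 y. fundamental_solution \<theta> G \<Longrightarrow> 0 < r \<Longrightarrow> r powr (1 / \<theta>) \<le> R \<Longrightarrow>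
      y \<in> ball x0 R \<Longrightarrow> ennreal c \<le> (\<integral>\<^sup>+x\<in>ball x0 R. ennreal (G (x - y) r) \<partial>lborel)"
proof -
  let ?n = "CARD('n)"
  obtain c where c: "0 < c"
    "\<And>(G :: real ^ 'n \<Rightarrow> real \<Rightarrow> real) r z. fundamental_solution \<theta> G \<Longrightarrow> 0 < r \<Longrightarrow> norm z \<le> r powr (1 / \<theta>) \<Longrightarrow>
      c * r powr (- (real ?n / \<theta>)) \<le> G z r"
    using kernel_lower_bound[OF \<theta>, where 'n = 'n] by blast
  define V where "V = unit_ball_vol (real ?n)"
  have V: "V > 0" by (simp add: V_def)
  show thesis
  proof (rule that)
    show "0 < c * (V / 2 ^ ?n)" using c V by simp
    fix G :: "real ^ 'n \<Rightarrow> real \<Rightarrow> real" and r R :: real and x0 y :: "real^'n"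
    assume G: "fundamental_solution \<theta> G" and r: "0 < r" and rR: "r powr (1 / \<theta>) \<le> R" and y: "y \<in> ball x0 R"
    define \<rho> where "\<rho> = r powr (1 / \<theta>)"
    have \<rho>: "\<rho> > 0" using r by (simp add: \<rho>_def)
    have \<rho>n: "r powr (- (real CARD('n) / \<theta>)) = 1 / \<rho> ^ CARD('n)"
      using r by (simp add: \<rho>_def powr_minus_divide powr_realpow[symmetric] powr_powr)
    define d where "d = dist x0 y"
    have d: "0 \<le> d" "d < R" using y by (auto simp: d_def)
    \<comment> \<open>Moving from \<open>y\<close> towards the centre by \<open>\<rho>/2\<close> keeps a ball of radius \<open>\<rho>/2\<close> inside \<open>ball x0 R\<close>.\<close>
    obtain q where q: "dist q y \<le> \<rho> / 2" "dist q x0 \<le> R - \<rho> / 2"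
    proof (cases "d \<le> \<rho> / 2")
      case True
      then show ?thesis
        using that[of x0] rR \<rho> by (auto simp: \<rho>_def[symmetric] d_def)
    next
      case False
      define q where "q = y + (\<rho> / 2 / d) *\<^sub>R (x0 - y)"
      have dpos: "d > 0" using False \<rho> by linarith
      have "dist q y = \<rho> / 2"
        using dpos \<rho> by (simp add: q_def dist_norm d_def)
      moreover have "q - x0 = (1 - \<rho> / 2 / d) *\<^sub>R (y - x0)"
        by (simp add: q_def algebra_simps)
      then have "dist q x0 = \<bar>1 - \<rho> / 2 / d\<bar> * d"
        by (simp add: dist_norm d_def norm_minus_commute)
      moreover have "0 \<le> 1 - \<rho> / 2 / d" using False dpos by (simp add: field_simps)
      ultimately have "dist q x0 = d - \<rho> / 2" using dpos by (simp add: field_simps)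
      with \<open>dist q y = \<rho> / 2\<close> show ?thesis using that[of q] d by simp
    qed
    have sub: "x \<in> ball x0 R \<and> norm (x - y) \<le> r powr (1 / \<theta>)" if "x \<in> ball q (\<rho> / 2)" for x
    proof -
      have "dist x0 x \<le> dist q x0 + dist q x" "dist x y \<le> dist q x + dist q y"
        by (metis dist_commute dist_triangle2, metis dist_commute dist_triangle2)
      then show ?thesis
        using that q \<rho> by (auto simp: \<rho>_def[symmetric] dist_norm)
    qed
    have "ennreal (c * (V / 2 ^ ?n)) = ennreal (c * r powr (- (real ?n / \<theta>))) * emeasure lborel (ball q (\<rho> / 2))"
      using \<rho> c V by (simp add: emeasure_ball \<rho>n ennreal_mult[symmetric] V_def power_divide)
    also have "\<dots> = (\<integral>\<^sup>+x. ennreal (c * r powr (- (real ?n / \<theta>))) * indicator (ball q (\<rho> / 2)) x \<partial>lborel)"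
      by (subst nn_integral_cmult_indicator) auto
    also have "\<dots> \<le> (\<integral>\<^sup>+x\<in>ball x0 R. ennreal (G (x - y) r) \<partial>lborel)"
      using sub c(2)[OF G r] by (intro nn_integral_mono) (auto split: split_indicator intro!: ennreal_leI)
    finally show "ennreal (c * (V / 2 ^ ?n)) \<le> (\<integral>\<^sup>+x\<in>ball x0 R. ennreal (G (x - y) r) \<partial>lborel)" .
  qed
qed

section \<open>Riesz representation on Euclidean spaces\<close>

text \<open>The limits at time 0 are first obtained for nonnegative test functions, because almost
  monotonicity needs a sign. The functional therefore lives on this cone, and signed test functions
  are split into two of its members only when the trace is assembled.\<close>

definition cc_nonneg :: "('a::euclidean_space \<Rightarrow> real) \<Rightarrow> bool" where
  "cc_nonneg \<phi> \<longleftrightarrow> continuous_on UNIV \<phi> \<and> (\<forall>x. 0 \<le> \<phi> x) \<and> (\<exists>K. compact K \<and> (\<forall>x. x \<notin> K \<longrightarrow> \<phi> x = 0))"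

lemma cc_nonnegI:
  "continuous_on UNIV \<phi> \<Longrightarrow> (\<And>x. 0 \<le> \<phi> x) \<Longrightarrow> compact K \<Longrightarrow> (\<And>x. x \<notin> K \<Longrightarrow> \<phi> x = 0) \<Longrightarrow> cc_nonneg \<phi>"
  unfolding cc_nonneg_def by blast

lemma cc_nonneg_continuous: "cc_nonneg \<phi> \<Longrightarrow> continuous_on UNIV \<phi>"
  and cc_nonneg_nonneg: "cc_nonneg \<phi> \<Longrightarrow> 0 \<le> \<phi> x"
  unfolding cc_nonneg_def by auto

lemma cc_nonneg_support:
  assumes "cc_nonneg \<phi>" obtains K where "compact K" "\<And>x. x \<notin> K \<Longrightarrow> \<phi> x = 0"
  using assms unfolding cc_nonneg_def by blast

lemma cc_nonneg_dominated:
  assumes "cc_nonneg \<phi>" "continuous_on UNIV \<psi>" "\<And>x. 0 \<le> \<psi> x" "\<And>x. \<phi> x = 0 \<Longrightarrow> \<psi> x = 0"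
  shows "cc_nonneg \<psi>"
  using assms unfolding cc_nonneg_def by blast

lemma cc_nonneg_add: "cc_nonneg \<phi> \<Longrightarrow> cc_nonneg \<psi> \<Longrightarrow> cc_nonneg (\<lambda>x. \<phi> x + \<psi> x)"
proof -
  assume a: "cc_nonneg \<phi>" "cc_nonneg \<psi>"
  then obtain K K' where "compact K" "\<And>x. x \<notin> K \<Longrightarrow> \<phi> x = 0" "compact K'" "\<And>x. x \<notin> K' \<Longrightarrow> \<psi> x = 0"
    by (metis cc_nonneg_support)
  with a show ?thesis
    by (intro cc_nonnegI[of _ "K \<union> K'"]) (auto simp: cc_nonneg_def intro!: continuous_intros)
qed

lemma cc_nonneg_scale: "cc_nonneg \<phi> \<Longrightarrow> 0 \<le> c \<Longrightarrow> cc_nonneg (\<lambda>x. c * \<phi> x)"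
  by (rule cc_nonneg_dominated[of \<phi>]) (auto simp: cc_nonneg_def intro!: continuous_intros)

lemma cc_nonneg_bounded:
  assumes "cc_nonneg \<phi>" obtains B where "\<And>x. \<phi> x \<le> B" "0 < B"
proof -
  obtain K where K: "compact K" "\<And>x. x \<notin> K \<Longrightarrow> \<phi> x = 0"
    using assms by (metis cc_nonneg_support)
  have "bounded (\<phi> ` K)"
    using K assms by (intro compact_imp_bounded compact_continuous_image)
      (auto simp: cc_nonneg_def intro: continuous_on_subset)
  then obtain B where "\<And>x. x \<in> K \<Longrightarrow> \<bar>\<phi> x\<bar> \<le> B" by (auto simp: bounded_iff)
  then have "\<phi> x \<le> max B 1" for x
    using K(2)[of x] by (cases "x \<in> K") force+
  then show ?thesis by (intro that[of "max B 1"]) auto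
qed

lemma cc_nonneg_cutoff:
  fixes K :: "'a::euclidean_space set"
  assumes "compact K"
  obtains \<eta> where "cc_nonneg \<eta>" "\<And>x. \<eta> x \<le> 1" "\<And>x. x \<in> K \<Longrightarrow> \<eta> x = 1"
proof -
  obtain R where R: "\<And>x. x \<in> K \<Longrightarrow> norm x \<le> R"
    using assms compact_imp_bounded bounded_iff by metis
  show ?thesis
  proof (rule that[of "\<lambda>x. max 0 (min 1 (R + 1 - norm x))"])
    show "cc_nonneg (\<lambda>x::'a. max 0 (min 1 (R + 1 - norm x)))"
      by (rule cc_nonnegI[of _ "cball (0::'a) (R + 1)"]) (auto intro!: continuous_intros)
  qed (use R in force)+
qed

lemma integrable_cc_nonneg:
  assumes \<mu>: "sets \<mu> = sets borel" "\<And>K. compact K \<Longrightarrow> emeasure \<mu> K < \<infinity>" and \<phi>: "cc_nonneg \<phi>"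
  shows "integrable \<mu> \<phi>"
proof -
  obtain K where K: "compact K" "\<And>x. x \<notin> K \<Longrightarrow> \<phi> x = 0"
    using \<phi> by (metis cc_nonneg_support)
  obtain B where "\<And>x. \<phi> x \<le> B" using \<phi> by (metis cc_nonneg_bounded)
  moreover have "\<phi> \<in> borel_measurable \<mu>"
    using \<mu>(1) cc_nonneg_continuous[OF \<phi>] borel_measurable_continuous_onI measurable_cong_sets by blast
  ultimately show ?thesis
    using K \<mu> \<phi> cc_nonneg_nonneg[OF \<phi>]
    by (intro integrableI_bounded_set[where A = K and B = B]) (auto simp: borel_compact)
qed

text \<open>The relation usually written \<phi> \<prec> U in the construction of the Riesz
  measure.\<close>

definition bump :: "'a::euclidean_space set \<Rightarrow> ('a \<Rightarrow> real) \<Rightarrow> bool" where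
  "bump U \<phi> \<longleftrightarrow> continuous_on UNIV \<phi> \<and> (\<forall>x. 0 \<le> \<phi> x \<and> \<phi> x \<le> 1) \<and>
     (\<exists>K. compact K \<and> K \<subseteq> U \<and> (\<forall>x. x \<notin> K \<longrightarrow> \<phi> x = 0))"

lemma bump_cc_nonneg: "bump U \<phi> \<Longrightarrow> cc_nonneg \<phi>"
  unfolding bump_def cc_nonneg_def by blast

locale positive_functional =
  fixes L :: "('a::euclidean_space \<Rightarrow> real) \<Rightarrow> real"
  assumes nonneg: "cc_nonneg \<phi> \<Longrightarrow> 0 \<le> L \<phi>"
    and add: "cc_nonneg \<phi> \<Longrightarrow> cc_nonneg \<psi> \<Longrightarrow> L (\<lambda>x. \<phi> x + \<psi> x) = L \<phi> + L \<psi>"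
    and scale: "cc_nonneg \<phi> \<Longrightarrow> 0 < c \<Longrightarrow> L (\<lambda>x. c * \<phi> x) = c * L \<phi>"
begin

lemma zero: "L (\<lambda>x. 0) = 0"
proof -
  have "cc_nonneg (\<lambda>x::'a. 0)"
    by (rule cc_nonnegI[of _ "{}"]) auto
  from add[OF this this] show ?thesis by simp
qed

lemma mono:
  assumes \<phi>: "cc_nonneg \<phi>" and \<psi>: "cc_nonneg \<psi>" and le: "\<And>x. \<phi> x \<le> \<psi> x"
  shows "L \<phi> \<le> L \<psi>"
proof -
  have d: "cc_nonneg (\<lambda>x. \<psi> x - \<phi> x)"
  proof (rule cc_nonneg_dominated[OF \<psi>])
    show "\<psi> x - \<phi> x = 0" if "\<psi> x = 0" for x
      using le[of x] cc_nonneg_nonneg[OF \<phi>, of x] that by simp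
  qed (use \<phi> \<psi> le in \<open>auto simp: cc_nonneg_def intro!: continuous_intros\<close>)
  show ?thesis
    using add[OF \<phi> d] nonneg[OF d] by simp
qed

section \<open>The outer measure induced by a positive functional\<close>

definition open_content :: "'a set \<Rightarrow> ennreal" where
  "open_content U = (SUP \<phi>\<in>{\<phi>. bump U \<phi>}. ennreal (L \<phi>))"

definition outer :: "'a set \<Rightarrow> ennreal" where
  "outer A = (INF U\<in>{U. open U \<and> A \<subseteq> U}. open_content U)"

lemma open_content_mono: "U \<subseteq> V \<Longrightarrow> open_content U \<le> open_content V"
  unfolding open_content_def bump_def by (intro SUP_subset_mono) (auto intro: order_trans)

lemma open_content_upper: "bump U \<phi> \<Longrightarrow> ennreal (L \<phi>) \<le> open_content U"
  unfolding open_content_def by (intro SUP_upper) auto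

lemma outer_open: "open U \<Longrightarrow> outer U = open_content U"
  unfolding outer_def by (intro antisym INF_greatest INF_lower) (auto intro: open_content_mono)

lemma outer_mono: "A \<subseteq> B \<Longrightarrow> outer A \<le> outer B"
  unfolding outer_def by (intro INF_superset_mono) auto

lemma outer_empty: "outer {} = 0"
proof -
  have "L \<phi> = 0" if "bump {} \<phi>" for \<phi> :: "'a \<Rightarrow> real"
  proof -
    have "\<phi> = (\<lambda>x. 0)" using that by (auto simp: bump_def)
    then show ?thesis using zero by simp
  qed
  then have "open_content {} \<le> 0"
    unfolding open_content_def by (intro SUP_least) simp
  then show ?thesis by (simp add: outer_open)
qed

text \<open>The truncation \<open>(\<phi> - \<epsilon>)\<^sup>+\<close> has compact support inside \<open>U\<close>, even if the support of \<open>\<phi>\<close> does not.\<close>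

lemma le_open_content:
  assumes \<phi>: "cc_nonneg \<phi>" and le1: "\<And>x. \<phi> x \<le> 1" and off: "\<And>x. x \<notin> U \<Longrightarrow> \<phi> x = 0"
  shows "ennreal (L \<phi>) \<le> open_content U"
proof (rule ennreal_le_epsilon)
  fix e :: real assume e: "0 < e"
  obtain K where K: "compact K" "\<And>x. x \<notin> K \<Longrightarrow> \<phi> x = 0"
    using \<phi> by (metis cc_nonneg_support)
  obtain \<eta> where \<eta>: "cc_nonneg \<eta>" "\<And>x. \<eta> x \<le> 1" "\<And>x. x \<in> K \<Longrightarrow> \<eta> x = 1"
    using cc_nonneg_cutoff[OF K(1)] by blast
  define d where "d = e / (L \<eta> + 1)"
  have d: "0 < d" "d * L \<eta> \<le> e"
    using e nonneg[OF \<eta>(1)] by (auto simp: d_def field_simps)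
  define \<psi> where "\<psi> x = max 0 (\<phi> x - d)" for x
  have cont: "continuous_on UNIV \<psi>"
    unfolding \<psi>_def by (intro continuous_intros cc_nonneg_continuous[OF \<phi>])
  have b: "bump U \<psi>"
    unfolding bump_def
  proof (intro conjI exI[of _ "K \<inter> {x. d \<le> \<phi> x}"])
    have "closed {x. d \<le> \<phi> x}"
      by (intro closed_Collect_le continuous_intros cc_nonneg_continuous[OF \<phi>])
    then show "compact (K \<inter> {x. d \<le> \<phi> x})"
      using K(1) by (rule compact_Int_closed[rotated])
    show "\<forall>x. 0 \<le> \<psi> x \<and> \<psi> x \<le> 1"
    proof
      fix x show "0 \<le> \<psi> x \<and> \<psi> x \<le> 1" using le1[of x] d(1) by (simp add: \<psi>_def)
    qed
    show "K \<inter> {x. d \<le> \<phi> x} \<subseteq> U"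
      using off d(1) by fastforce
    show "\<forall>x. x \<notin> K \<inter> {x. d \<le> \<phi> x} \<longrightarrow> \<psi> x = 0"
      using K(2) d(1) by (auto simp: \<psi>_def)
  qed (rule cont)
  have \<psi>: "cc_nonneg \<psi>" using b by (rule bump_cc_nonneg)
  have "\<phi> x \<le> \<psi> x + d * \<eta> x" for x
    using K(2)[of x] \<eta>(3)[of x] cc_nonneg_nonneg[OF \<eta>(1), of x] d
    by (cases "x \<in> K") (auto simp: \<psi>_def)
  then have "L \<phi> \<le> L (\<lambda>x. \<psi> x + d * \<eta> x)"
    by (intro mono \<phi> cc_nonneg_add \<psi> cc_nonneg_scale \<eta>) (use d in auto)
  also have "\<dots> = L \<psi> + d * L \<eta>"
    using add[OF \<psi> cc_nonneg_scale[OF \<eta>(1)], of d] scale[OF \<eta>(1), of d] d by simp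
  also have "\<dots> \<le> L \<psi> + e" using d by simp
  finally have "ennreal (L \<phi>) \<le> ennreal (L \<psi>) + ennreal e"
    using nonneg[OF \<psi>] e by (simp add: ennreal_plus[symmetric] del: ennreal_plus)
  also have "\<dots> \<le> open_content U + ennreal e"
    by (intro add_right_mono open_content_upper b)
  finally show "ennreal (L \<phi>) \<le> open_content U + ennreal e" .
qed

text \<open>A function supported in the union is split by the weights
  \<open>d U / (d U + d V)\<close> and \<open>d V / (d U + d V)\<close>, where \<open>d\<close> is
  the distance to the complement. The pieces vanish off \<open>U\<close> and \<open>V\<close>, but
  their supports may touch the boundaries of these sets, so they are measured by
  \<open>le_open_content\<close> and not directly as bumps.\<close>

lemma open_content_Un:
  assumes U: "open U" and V: "open V"
  shows "open_content (U \<union> V) \<le> open_content U + open_content V"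
  unfolding open_content_def[of "U \<union> V"]
proof (intro SUP_least, clarsimp)
  fix \<phi> assume b: "bump (U \<union> V) \<phi>"
  then obtain K where K: "compact K" "K \<subseteq> U \<union> V" "\<And>x. x \<notin> K \<Longrightarrow> \<phi> x = 0"
    unfolding bump_def by auto
  have \<phi>: "cc_nonneg \<phi>" "\<And>x. \<phi> x \<le> 1" using b bump_cc_nonneg by (auto simp: bump_def)
  \<comment> \<open>\<open>infdist\<close> to the empty set is 0 by convention, so
    \<open>W = UNIV\<close> gets a positive value by hand.\<close>
  define d :: "'a set \<Rightarrow> 'a \<Rightarrow> real" where "d W x = (if W = UNIV then 1 else infdist x (- W))" for W x
  have d0: "d W x \<ge> 0" for W x by (simp add: d_def infdist_nonneg)
  have dpos: "d W x > 0 \<longleftrightarrow> x \<in> W" if "open W" for W x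
  proof (cases "W = UNIV")
    case False
    then have "infdist x (- W) = 0 \<longleftrightarrow> x \<in> - W"
      using that by (intro in_closed_iff_infdist_zero[symmetric]) (auto simp: closed_Compl)
    then show ?thesis using False infdist_nonneg[of x "- W"] by (auto simp: d_def)
  qed (simp add: d_def)
  have dc: "continuous_on S (d W)" for W S
    unfolding d_def by (cases "W = UNIV") (auto intro!: continuous_intros)
  let ?q = "\<lambda>W x. \<phi> x * (d W x / (d U x + d V x))"
  have main: "cc_nonneg (?q W)" if W: "W = U \<or> W = V" for W
  proof (rule cc_nonneg_dominated[OF \<phi>(1)])
    \<comment> \<open>The quotient is continuous where its denominator is positive, and it is 0 off
      \<open>K\<close>; these two open sets cover the space.\<close>
    have "continuous_on (U \<union> V) (?q W)"
    proof (intro continuous_intros dc)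
      show "continuous_on (U \<union> V) \<phi>"
        using cc_nonneg_continuous[OF \<phi>(1)] by (rule continuous_on_subset) simp
      show "\<forall>x\<in>U \<union> V. d U x + d V x \<noteq> 0"
        using dpos[OF U] dpos[OF V] d0[of U] d0[of V] by (smt (verit) Un_iff)
    qed
    moreover have "continuous_on (- K) (?q W)"
      by (rule continuous_on_eq[of _ "\<lambda>_. 0"]) (use K in auto)
    ultimately have "continuous_on ((U \<union> V) \<union> - K) (?q W)"
      by (rule continuous_on_open_Un[OF open_Un[OF U V] open_Compl[OF compact_imp_closed[OF K(1)]]])
    moreover have "(U \<union> V) \<union> - K = UNIV" using K(2) by auto
    ultimately show "continuous_on UNIV (?q W)" by simp
  qed (use d0 cc_nonneg_nonneg[OF \<phi>(1)] in auto)
  have bound: "ennreal (L (?q W)) \<le> open_content W" if W: "W = U \<or> W = V" for W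
  proof (rule le_open_content[OF main[OF W]])
    fix x
    have "d W x / (d U x + d V x) \<le> 1"
      using W d0[of U x] d0[of V x] by (auto simp: divide_le_eq_1)
    then show "?q W x \<le> 1"
      using \<phi>(2)[of x] cc_nonneg_nonneg[OF \<phi>(1), of x] d0[of W x] d0[of U x] d0[of V x]
      by (intro mult_le_one) auto
    show "?q W x = 0" if "x \<notin> W"
      using that W dpos[OF U, of x] dpos[OF V, of x] d0[of W x] by (auto simp: not_less)
  qed
  have "\<phi> = (\<lambda>x. ?q U x + ?q V x)"
  proof
    fix x
    show "\<phi> x = ?q U x + ?q V x"
    proof (cases "x \<in> K")
      case True
      then have "d U x + d V x \<noteq> 0"
        using K(2) dpos[OF U, of x] dpos[OF V, of x] d0[of U x] d0[of V x] by force
      then show ?thesis by (simp add: distrib_left[symmetric] add_divide_distrib[symmetric])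
    qed (simp add: K(3))
  qed
  then have "L \<phi> = L (?q U) + L (?q V)"
    using add[OF main[of U] main[of V]] by simp
  then show "ennreal (L \<phi>) \<le> open_content U + open_content V"
    using nonneg[OF main[of U]] nonneg[OF main[of V]] bound[of U] bound[of V]
    by (simp add: add_mono)
qed

text \<open>A bump has compact support, so finitely many of the \<open>U i\<close> already contain
  it, and the countable bound reduces to repeated use of the one for two sets.\<close>

lemma open_content_UN:
  fixes U :: "nat \<Rightarrow> 'a set"
  assumes U: "\<And>i. open (U i)"
  shows "open_content (\<Union>i. U i) \<le> (\<Sum>i. open_content (U i))"
  unfolding open_content_def[of "\<Union>i. U i"]
proof (intro SUP_least, clarsimp)
  fix \<phi> assume b: "bump (\<Union>i. U i) \<phi>"
  then obtain K where K: "compact K" "K \<subseteq> (\<Union>i. U i)" "\<And>x. x \<notin> K \<Longrightarrow> \<phi> x = 0"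
    unfolding bump_def by auto
  obtain I where I: "I \<subseteq> UNIV" "finite I" "K \<subseteq> (\<Union>i\<in>I. U i)"
    by (rule compactE_image[OF K(1), of UNIV U]) (use U K(2) in auto)
  have fin: "open_content (\<Union>i\<in>I. U i) \<le> (\<Sum>i\<in>I. open_content (U i))"
    using I(2)
  proof (induction I rule: finite_induct)
    case empty
    then show ?case using outer_empty outer_open[of "{}"] by simp
  next
    case (insert i I)
    have "open_content (U i \<union> (\<Union>i\<in>I. U i)) \<le> open_content (U i) + open_content (\<Union>i\<in>I. U i)"
      by (intro open_content_Un U open_UN ballI)
    also have "\<dots> \<le> open_content (U i) + (\<Sum>i\<in>I. open_content (U i))"
      by (intro add_left_mono insert)
    finally show ?case using insert by simp
  qed
  have "bump (\<Union>i\<in>I. U i) \<phi>"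
    using b K(1,3) I(3) unfolding bump_def by (intro conjI exI[of _ K]) auto
  then have "ennreal (L \<phi>) \<le> open_content (\<Union>i\<in>I. U i)"
    by (rule open_content_upper)
  also note fin
  also have "(\<Sum>i\<in>I. open_content (U i)) \<le> (\<Sum>i. open_content (U i))"
    by (intro sum_le_suminf I) auto
  finally show "ennreal (L \<phi>) \<le> (\<Sum>i. open_content (U i))" .
qed

lemma outer_measure_space_outer: "outer_measure_space (Pow UNIV) outer"
  unfolding outer_measure_space_def
proof (intro conjI)
  show "positive (Pow UNIV) outer" by (simp add: positive_def outer_empty)
  show "increasing (Pow UNIV) outer" by (simp add: increasing_def outer_mono)
  show "countably_subadditive (Pow UNIV) outer"
    unfolding countably_subadditive_def
  proof safe
    fix A :: "nat \<Rightarrow> 'a set"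
    show "outer (\<Union>i. A i) \<le> (\<Sum>i. outer (A i))"
    proof (rule ennreal_le_epsilon)
      fix e :: real assume e: "0 < e" and fin: "(\<Sum>n. outer (A n)) < top"
      then have *: "\<And>n. outer (A n) < outer (A n) + e * (1/2)^Suc n"
        by (auto simp add: less_top dest!: ennreal_suminf_lessD)
      have "\<exists>U. open U \<and> A n \<subseteq> U \<and> open_content U \<le> outer (A n) + e * (1/2)^Suc n" for n
        using *[of n] unfolding outer_def[of "A n"] INF_less_iff by (auto intro: less_imp_le)
      then obtain U where U: "\<And>n. open (U n)" "\<And>n. A n \<subseteq> U n"
        "\<And>n. open_content (U n) \<le> outer (A n) + e * (1/2)^Suc n"
        by metis
      have "outer (\<Union>i. A i) \<le> outer (\<Union>i. U i)"
        using U(2) by (intro outer_mono) blast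
      also have "\<dots> = open_content (\<Union>i. U i)" using U(1) by (intro outer_open) auto
      also have "\<dots> \<le> (\<Sum>i. open_content (U i))" by (rule open_content_UN[OF U(1)])
      also have "\<dots> \<le> (\<Sum>n. outer (A n) + e * (1/2) ^ Suc n)"
        by (intro suminf_le U(3)) auto
      also have "\<dots> = (\<Sum>n. outer (A n)) + (\<Sum>n. ennreal e * ennreal ((1/2) ^ Suc n))"
        using e by (subst suminf_add[symmetric])
                         (auto simp del: ennreal_suminf_cmult simp add: ennreal_mult[symmetric])
      also have "\<dots> = (\<Sum>n. outer (A n)) + e"
        unfolding ennreal_suminf_cmult
        by (subst suminf_ennreal_eq[OF zero_le_power power_half_series]) auto
      finally show "outer (\<Union>i. A i) \<le> (\<Sum>n. outer (A n)) + e" .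
    qed
  qed
qed

text \<open>Caratheodory's criterion is tested on open supersets \<open>U\<close> of
  \<open>A\<close>. A bump in \<open>U - C\<close> with support in \<open>K\<close> and a bump in
  \<open>U - K\<close> are never nonzero at the same point, so their sum is again a bump in
  \<open>U\<close>. As \<open>U - K\<close> still contains \<open>C \<inter> A\<close>, suprema over
  the second bump and then over the first give the inequality.\<close>

lemma closed_in_lambda_system:
  assumes C: "closed C"
  shows "C \<in> lambda_system UNIV (Pow UNIV) outer"
  unfolding lambda_system_def
proof (clarsimp, intro antisym)
  fix A :: "'a set"
  have "subadditive (Pow UNIV) outer"
    using outer_measure_space_outer
    by (intro ring_of_sets.countably_subadditive_subadditive[OF ring_of_sets_Pow])
      (auto simp: outer_measure_space_def)
  then have "outer ((C \<inter> A) \<union> ((UNIV - C) \<inter> A)) \<le> outer (C \<inter> A) + outer ((UNIV - C) \<inter> A)"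
    by (rule subadditiveD) auto
  moreover have "(C \<inter> A) \<union> ((UNIV - C) \<inter> A) = A" by auto
  ultimately show "outer A \<le> outer (C \<inter> A) + outer ((UNIV - C) \<inter> A)" by simp
  have key: "outer (C \<inter> A) + outer ((UNIV - C) \<inter> A) \<le> open_content U" if U: "open U" "A \<subseteq> U" for U
  proof -
    have step: "outer (C \<inter> A) + ennreal (L \<phi>) \<le> open_content U" if b: "bump (U - C) \<phi>" for \<phi>
    proof -
      obtain K where K: "compact K" "K \<subseteq> U - C" "\<And>x. x \<notin> K \<Longrightarrow> \<phi> x = 0"
        using b unfolding bump_def by auto
      have op: "open (U - K)" using U K(1) by (simp add: open_Diff compact_imp_closed)
      have "outer (C \<inter> A) \<le> outer (U - K)" using U K by (intro outer_mono) auto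
      also have "\<dots> = open_content (U - K)" by (rule outer_open[OF op])
      finally have 1: "outer (C \<inter> A) \<le> open_content (U - K)" .
      have "open_content (U - K) + ennreal (L \<phi>) = (SUP \<psi>\<in>{\<psi>. bump (U - K) \<psi>}. ennreal (L \<psi>) + ennreal (L \<phi>))"
        unfolding open_content_def
      proof (rule ennreal_SUP_add_left[symmetric])
        have "bump (U - K) (\<lambda>x. 0)" unfolding bump_def by (auto intro!: exI[of _ "{}"])
        then show "{\<psi>. bump (U - K) \<psi>} \<noteq> {}" by auto
      qed
      also have "\<dots> \<le> open_content U"
      proof (intro SUP_least, clarsimp)
        fix \<psi> assume b': "bump (U - K) \<psi>"
        then obtain K' where K': "compact K'" "K' \<subseteq> U - K" "\<And>x. x \<notin> K' \<Longrightarrow> \<psi> x = 0"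
          unfolding bump_def by auto
        have "0 \<le> \<psi> x" "\<psi> x \<le> 1" "0 \<le> \<phi> x" "\<phi> x \<le> 1" "\<psi> x = 0 \<or> \<phi> x = 0" for x
          using b b' K(3)[of x] K'(2) K'(3)[of x] unfolding bump_def by auto
        then have "\<psi> x + \<phi> x \<le> 1" "0 \<le> \<psi> x + \<phi> x" for x
          by (metis add.left_neutral add.right_neutral, simp)
        then have "bump U (\<lambda>x. \<psi> x + \<phi> x)"
          unfolding bump_def using b b' K K'
          by (intro conjI exI[of _ "K \<union> K'"]) (auto simp: bump_def intro!: continuous_intros)
        then have "ennreal (L (\<lambda>x. \<psi> x + \<phi> x)) \<le> open_content U" by (rule open_content_upper)
        then show "ennreal (L \<psi>) + ennreal (L \<phi>) \<le> open_content U"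
          using add[OF bump_cc_nonneg[OF b'] bump_cc_nonneg[OF b]]
            nonneg[OF bump_cc_nonneg[OF b']] nonneg[OF bump_cc_nonneg[OF b]] by simp
      qed
      finally show ?thesis using 1 by (meson add_right_mono order_trans)
    qed
    have "outer (C \<inter> A) + outer ((UNIV - C) \<inter> A) \<le> outer (C \<inter> A) + outer (U - C)"
      using U by (intro add_left_mono outer_mono) auto
    also have "\<dots> = outer (C \<inter> A) + open_content (U - C)"
      using U C by (simp add: outer_open open_Diff)
    also have "\<dots> = (SUP \<phi>\<in>{\<phi>. bump (U - C) \<phi>}. outer (C \<inter> A) + ennreal (L \<phi>))"
      unfolding open_content_def
    proof (rule ennreal_SUP_add_right)
      have "bump (U - C) (\<lambda>x. 0)" unfolding bump_def by (auto intro!: exI[of _ "{}"])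
      then show "{\<psi>. bump (U - C) \<psi>} \<noteq> {}" by auto
    qed
    also have "\<dots> \<le> open_content U"
      using step by (intro SUP_least) auto
    finally show ?thesis .
  qed
  show "outer (C \<inter> A) + outer ((UNIV - C) \<inter> A) \<le> outer A"
    unfolding outer_def[of A] using key by (intro INF_greatest) auto
qed

definition riesz_measure :: "'a measure" where
  "riesz_measure = measure_of UNIV (sets borel) outer"

lemma sets_riesz_measure [simp]: "sets riesz_measure = sets borel"
  and space_riesz_measure [simp]: "space riesz_measure = UNIV"
  unfolding riesz_measure_def
  using sets.sigma_sets_eq[of "borel :: 'a measure"] by simp_all

end

text \<open>Inner regularity is known for finite Borel measures. Cutting \<open>\<mu>\<close> off to
  the balls \<open>B n\<close> makes it finite, and the cut-offs increase to \<open>\<mu>\<close>.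
  On a Euclidean space every locally finite Borel measure is therefore Radon.\<close>

lemma inner_regular_locally_finite:
  fixes \<mu> :: "'a::euclidean_space measure"
  assumes sets: "sets \<mu> = sets borel" and fin: "\<And>K. compact K \<Longrightarrow> emeasure \<mu> K < \<infinity>"
    and A: "A \<in> sets borel"
  shows "emeasure \<mu> A = (SUP K\<in>{K. compact K \<and> K \<subseteq> A}. emeasure \<mu> K)"
proof (rule antisym)
  let ?S = "SUP K\<in>{K. compact K \<and> K \<subseteq> A}. emeasure \<mu> K"
  define B where "B n = cball (0::'a) (real n)" for n
  have Bs: "B n \<in> sets \<mu>" for n by (simp add: B_def sets)
  have "range (\<lambda>n. A \<inter> B n) \<subseteq> sets \<mu>" using A Bs sets by auto
  moreover have "incseq (\<lambda>n. A \<inter> B n)"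
    unfolding incseq_def B_def by (metis Int_mono order_refl subset_cball of_nat_mono)
  moreover have "(\<Union>n. A \<inter> B n) = A"
    unfolding B_def by (auto simp: real_arch_simple)
  ultimately have eq: "emeasure \<mu> A = (SUP n. emeasure \<mu> (A \<inter> B n))"
    by (simp add: SUP_emeasure_incseq)
  show "emeasure \<mu> A \<le> ?S"
    unfolding eq
  proof (rule SUP_least)
    fix n
    define \<nu> where "\<nu> = density \<mu> (indicator (B n))"
    have \<nu>: "emeasure \<nu> C = emeasure \<mu> (C \<inter> B n)" if "C \<in> sets borel" for C
      using that Bs[of n] sets by (simp add: \<nu>_def emeasure_density nn_integral_indicator
          indicator_inter_arith[symmetric] Int_commute)
    have s\<nu>: "sets \<nu> = sets borel" by (simp add: \<nu>_def sets)
    have "emeasure \<nu> A = (SUP K\<in>{K. K \<subseteq> A \<and> compact K}. emeasure \<nu> K)"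
    proof (rule inner_regular[OF s\<nu> _ A])
      have "space \<nu> = UNIV" using sets_eq_imp_space_eq[OF s\<nu>] by simp
      then show "emeasure \<nu> (space \<nu>) \<noteq> \<infinity>"
        using \<nu>[of UNIV] fin[of "B n"] by (simp add: B_def)
    qed
    also have "\<dots> \<le> ?S"
    proof (rule SUP_mono)
      fix K assume K: "K \<in> {K. K \<subseteq> A \<and> compact K}"
      then have "emeasure \<nu> K \<le> emeasure \<mu> K"
        using \<nu>[of K] sets by (auto simp: borel_compact intro!: emeasure_mono)
      then show "\<exists>m\<in>{K. compact K \<and> K \<subseteq> A}. emeasure \<nu> K \<le> emeasure \<mu> m" using K by blast
    qed
    finally show "emeasure \<mu> (A \<inter> B n) \<le> ?S"
      using \<nu>[OF A] by simp
  qed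
  show "?S \<le> emeasure \<mu> A"
    using A sets by (intro SUP_least emeasure_mono) auto
qed

lemma radon_measureI:
  fixes \<mu> :: "'a::euclidean_space measure"
  assumes "sets \<mu> = sets borel" "\<And>K. compact K \<Longrightarrow> emeasure \<mu> K < \<infinity>"
  shows "radon_measure \<mu>"
  unfolding radon_measure_def using assms inner_regular_locally_finite[OF assms] by auto

text \<open>A tent function that is 1 on \<open>K\<close> and 0 off its closed neighbourhood
  \<open>U n\<close> lies between the two indicators, and the neighbourhoods decrease to
  \<open>K\<close>. The empty set is treated apart because \<open>infdist\<close> to it is 0, which
  would make every \<open>U n\<close> the whole space.\<close>

lemma radon_measure_compact_le:
  fixes \<mu> \<nu> :: "'a::euclidean_space measure"
  assumes \<mu>: "radon_measure \<mu>" and \<nu>: "radon_measure \<nu>"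
    and eq: "\<And>\<phi>. cc_nonneg \<phi> \<Longrightarrow> (\<integral>x. \<phi> x \<partial>\<mu>) = (\<integral>x. \<phi> x \<partial>\<nu>)"
    and K: "compact K" "K \<noteq> {}"
  shows "emeasure \<mu> K \<le> emeasure \<nu> K"
proof -
  have s: "sets \<mu> = sets borel" "sets \<nu> = sets borel"
    and fin: "\<And>K. compact K \<Longrightarrow> emeasure \<mu> K < \<infinity>" "\<And>K. compact K \<Longrightarrow> emeasure \<nu> K < \<infinity>"
    using \<mu> \<nu> by (auto simp: radon_measure_def)
  define U where "U n = {x. infdist x K \<le> 1 / real (Suc n)}" for n
  have U: "compact (U n)" for n
    unfolding U_def by (rule compact_infdist_le[OF K(2,1)]) auto
  have Us: "U n \<in> sets borel" for n using U by (rule borel_compact)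
  have le: "emeasure \<mu> K \<le> emeasure \<nu> (U n)" for n
  proof -
    define \<phi> where "\<phi> x = max 0 (1 - real (Suc n) * infdist x K)" for x
    have \<phi>: "cc_nonneg \<phi>"
    proof (rule cc_nonnegI[OF _ _ U[of n]])
      show "continuous_on UNIV \<phi>" unfolding \<phi>_def by (intro continuous_intros)
      show "\<phi> x = 0" if "x \<notin> U n" for x
        using that by (simp add: \<phi>_def U_def field_simps)
    qed (simp add: \<phi>_def)
    have i: "integrable \<mu> \<phi>" "integrable \<nu> \<phi>"
      using s fin \<phi> by (auto intro: integrable_cc_nonneg)
    have "emeasure \<mu> K = (\<integral>\<^sup>+x. indicator K x \<partial>\<mu>)"
      using s K by (simp add: borel_compact)
    also have "\<dots> \<le> (\<integral>\<^sup>+x. ennreal (\<phi> x) \<partial>\<mu>)"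
    proof (rule nn_integral_mono)
      fix x
      show "indicator K x \<le> ennreal (\<phi> x)"
        by (cases "x \<in> K") (auto simp: \<phi>_def)
    qed
    also have "\<dots> = ennreal (\<integral>x. \<phi> x \<partial>\<mu>)"
      by (rule nn_integral_eq_integral[OF i(1)]) (simp add: \<phi>_def)
    also have "\<dots> = ennreal (\<integral>x. \<phi> x \<partial>\<nu>)" using eq[OF \<phi>] by simp
    also have "\<dots> = (\<integral>\<^sup>+x. ennreal (\<phi> x) \<partial>\<nu>)"
      by (rule nn_integral_eq_integral[OF i(2), symmetric]) (simp add: \<phi>_def)
    also have "\<dots> \<le> (\<integral>\<^sup>+x. indicator (U n) x \<partial>\<nu>)"
    proof (rule nn_integral_mono)
      fix x
      have "\<phi> x \<le> 1" using infdist_nonneg[of x K] by (simp add: \<phi>_def)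
      moreover have "\<phi> x = 0" if "x \<notin> U n"
        using that by (simp add: \<phi>_def U_def field_simps)
      ultimately show "ennreal (\<phi> x) \<le> indicator (U n) x"
        by (auto split: split_indicator simp: ennreal_le_1)
    qed
    also have "\<dots> = emeasure \<nu> (U n)" using Us s by simp
    finally show ?thesis .
  qed
  have "(\<Inter>n. U n) = K"
  proof (intro equalityI subsetI)
    fix x assume "x \<in> (\<Inter>n. U n)"
    then have *: "infdist x K \<le> 1 / real (Suc n)" for n by (auto simp: U_def)
    have "infdist x K \<le> 0"
    proof (rule field_le_epsilon)
      fix e :: real assume "0 < e"
      then obtain n where "1 / real (Suc n) < e" using nat_approx_posE by blast
      then show "infdist x K \<le> 0 + e" using *[of n] by simp
    qed
    then have "infdist x K = 0" using infdist_nonneg[of x K] by simp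
    then show "x \<in> K"
      using in_closed_iff_infdist_zero[OF compact_imp_closed[OF K(1)] K(2)] by simp
  qed (auto simp: U_def)
  moreover have "(INF n. emeasure \<nu> (U n)) = emeasure \<nu> (\<Inter>n. U n)"
  proof (rule INF_emeasure_decseq)
    show "decseq U"
      unfolding decseq_def U_def by (auto elim!: order_trans simp: frac_le)
  qed (use Us s fin(2)[OF U] in \<open>auto simp: less_top\<close>)
  ultimately show ?thesis
    using le by (metis INF_greatest)
qed

lemma radon_measure_eqI:
  fixes \<mu> \<nu> :: "'a::euclidean_space measure"
  assumes \<mu>: "radon_measure \<mu>" and \<nu>: "radon_measure \<nu>"
    and eq: "\<And>\<phi>. cc_nonneg \<phi> \<Longrightarrow> (\<integral>x. \<phi> x \<partial>\<mu>) = (\<integral>x. \<phi> x \<partial>\<nu>)"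
  shows "\<mu> = \<nu>"
proof (rule measure_eqI)
  show "sets \<mu> = sets \<nu>" using \<mu> \<nu> by (simp add: radon_measure_def)
  have K: "emeasure \<mu> K = emeasure \<nu> K" if "compact K" for K
  proof (cases "K = {}")
    case False
    then show ?thesis
      using radon_measure_compact_le[OF \<mu> \<nu> eq that] radon_measure_compact_le[OF \<nu> \<mu> eq[symmetric] that]
      by (simp add: antisym)
  qed simp
  fix A assume "A \<in> sets \<mu>"
  then have "A \<in> sets borel" using \<mu> by (simp add: radon_measure_def)
  then have "emeasure \<mu> A = (SUP K\<in>{K. compact K \<and> K \<subseteq> A}. emeasure \<mu> K)"
    "emeasure \<nu> A = (SUP K\<in>{K. compact K \<and> K \<subseteq> A}. emeasure \<nu> K)"
    using \<mu> \<nu> by (auto simp: radon_measure_def)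
  then show "emeasure \<mu> A = emeasure \<nu> A"
    using K by (auto intro!: SUP_cong)
qed

text \<open>Peeling off the layers \<open>min \<phi> \<epsilon>\<close> one at a time, all but the bottom one are compared through
  the measure of a level set.\<close>

lemma positive_functional_le:
  fixes \<mu> :: "'a::euclidean_space measure"
  assumes L: "positive_functional L" and J: "positive_functional J"
    and sets: "sets \<mu> = sets borel" and fin: "\<And>K. compact K \<Longrightarrow> emeasure \<mu> K < \<infinity>"
    and up: "\<And>\<psi> U. cc_nonneg \<psi> \<Longrightarrow> open U \<Longrightarrow> (\<And>x. \<psi> x \<le> 1) \<Longrightarrow> (\<And>x. x \<notin> U \<Longrightarrow> \<psi> x = 0) \<Longrightarrow>
      ennreal (L \<psi>) \<le> emeasure \<mu> U"
    and low: "\<And>\<psi> A. cc_nonneg \<psi> \<Longrightarrow> A \<in> sets borel \<Longrightarrow> (\<And>x. x \<in> A \<Longrightarrow> 1 \<le> \<psi> x) \<Longrightarrow>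
      emeasure \<mu> A \<le> ennreal (J \<psi>)"
    and \<phi>: "cc_nonneg \<phi>"
  shows "L \<phi> \<le> J \<phi>"
proof -
  interpret L: positive_functional L by (rule L)
  interpret J: positive_functional J by (rule J)
  have op: "open {x. c < \<psi> x}" if "cc_nonneg \<psi>" for c and \<psi> :: "'a \<Rightarrow> real"
    by (intro open_Collect_less continuous_intros cc_nonneg_continuous[OF that])
  have fin0: "emeasure \<mu> {x. 0 < \<psi> x} < \<infinity>" if \<psi>: "cc_nonneg \<psi>" for \<psi>
  proof -
    obtain K where K: "compact K" "\<And>x. x \<notin> K \<Longrightarrow> \<psi> x = 0" using \<psi> by (metis cc_nonneg_support)
    have "emeasure \<mu> {x. 0 < \<psi> x} \<le> emeasure \<mu> K"
      by (intro emeasure_mono) (use K sets in \<open>auto simp: borel_compact\<close>, metis less_irrefl)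
    then show ?thesis using fin[OF K(1)] by (rule le_less_trans)
  qed
  have upm: "L \<psi> \<le> measure \<mu> U" if "cc_nonneg \<psi>" "open U" "\<And>x. \<psi> x \<le> 1" "\<And>x. x \<notin> U \<Longrightarrow> \<psi> x = 0"
    "emeasure \<mu> U < \<infinity>" for \<psi> U
    using up[OF that(1-4)] that(5) by (simp add: emeasure_eq_ennreal_measure L.nonneg less_top)
  have layers: "L \<psi> \<le> J \<psi> + e * measure \<mu> {x. 0 < \<psi> x}"
    if \<psi>: "cc_nonneg \<psi>" "\<And>x. \<psi> x \<le> real N * e" and e: "0 < e" for N e \<psi>
    using \<psi>
  proof (induction N arbitrary: \<psi>)
    case 0
    then have "\<psi> = (\<lambda>x. 0)" using cc_nonneg_nonneg[of \<psi>] by (intro ext antisym) auto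
    then show ?case by (simp add: L.zero J.zero)
  next
    case (Suc N)
    define \<psi>1 where "\<psi>1 x = max 0 (\<psi> x - e)" for x
    define \<psi>2 where "\<psi>2 x = min (\<psi> x / e) 1" for x
    note nn = cc_nonneg_nonneg[OF Suc.prems(1)] and cont = cc_nonneg_continuous[OF Suc.prems(1)]
    have 1: "cc_nonneg \<psi>1"
      by (rule cc_nonneg_dominated[OF Suc.prems(1)]) (use e cont in \<open>auto simp: \<psi>1_def intro!: continuous_intros\<close>)
    have 2: "cc_nonneg \<psi>2"
      by (rule cc_nonneg_dominated[OF Suc.prems(1)]) (use e cont nn in \<open>auto simp: \<psi>2_def intro!: continuous_intros\<close>)
    have split: "\<psi> = (\<lambda>x. \<psi>1 x + e * \<psi>2 x)"
      using e nn by (auto simp: \<psi>1_def \<psi>2_def fun_eq_iff min_def max_def field_simps)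
    have sL: "L \<psi> = L \<psi>1 + e * L \<psi>2"
      unfolding split using L.add[OF 1 cc_nonneg_scale[OF 2, of e]] L.scale[OF 2 e] e by simp
    have sJ: "J \<psi> = J \<psi>1 + e * J \<psi>2"
      unfolding split using J.add[OF 1 cc_nonneg_scale[OF 2, of e]] J.scale[OF 2 e] e by simp
    have "\<psi>1 x \<le> real N * e" for x
      using Suc.prems(2)[of x] e by (auto simp: \<psi>1_def algebra_simps)
    then have "L \<psi>1 \<le> J \<psi>1 + e * measure \<mu> {x. 0 < \<psi>1 x}"
      by (intro Suc.IH 1)
    \<comment> \<open>\<open>\<psi>2\<close> is 1 wherever \<open>\<psi>1\<close> is positive, so
      \<open>J \<psi>2\<close> pays for the error term of the induction hypothesis. However many
      layers are peeled off, only one error \<open>e * measure \<mu> {x. 0 < \<psi> x}\<close>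
      survives.\<close>
    also have "measure \<mu> {x. 0 < \<psi>1 x} \<le> J \<psi>2"
    proof -
      have "emeasure \<mu> {x. 0 < \<psi>1 x} \<le> ennreal (J \<psi>2)"
        by (rule low[OF 2]) (use op[OF 1, of 0] e in \<open>auto simp: \<psi>1_def \<psi>2_def\<close>)
      then show ?thesis using J.nonneg[OF 2] by (simp add: measure_def enn2real_leI)
    qed
    finally have "L \<psi>1 \<le> J \<psi>" using e by (simp add: sJ)
    moreover have "L \<psi>2 \<le> measure \<mu> {x. 0 < \<psi> x}"
    proof (rule upm[OF 2 op[OF Suc.prems(1)]])
      show "\<psi>2 x = 0" if "x \<notin> {x. 0 < \<psi> x}" for x
        using that nn[of x] by (simp add: \<psi>2_def)
    qed (use fin0[OF Suc.prems(1)] in \<open>auto simp: \<psi>2_def\<close>)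
    ultimately show ?case
      using e by (simp add: sL add_mono mult_left_mono)
  qed
  show ?thesis
  proof (rule field_le_epsilon)
    fix \<epsilon> :: real assume \<epsilon>: "0 < \<epsilon>"
    define m where "m = measure \<mu> {x. 0 < \<phi> x}"
    have m: "0 \<le> m" by (simp add: m_def)
    define e where "e = \<epsilon> / (m + 1)"
    have e: "0 < e" "e * m \<le> \<epsilon>"
      using \<epsilon> m by (auto simp: e_def field_simps)
    obtain B where B: "\<And>x. \<phi> x \<le> B" using \<phi> by (metis cc_nonneg_bounded)
    obtain N where "B \<le> real N * e"
      using e(1) by (metis less_imp_le pos_divide_less_eq reals_Archimedean2)
    then have "\<phi> x \<le> real N * e" for x using B[of x] by linarith
    from layers[OF \<phi> this e(1)] e(2)[unfolded m_def] show "L \<phi> \<le> J \<phi> + \<epsilon>" by simp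
  qed
qed

section \<open>Identification of a positive functional with an integral\<close>

lemma positive_functional_integral:
  fixes \<mu> :: "'a::euclidean_space measure"
  assumes "sets \<mu> = sets borel" "\<And>K. compact K \<Longrightarrow> emeasure \<mu> K < \<infinity>"
  shows "positive_functional (\<lambda>\<phi>. \<integral>x. \<phi> x \<partial>\<mu>)"
  using integrable_cc_nonneg[OF assms] by unfold_locales (auto simp: cc_nonneg_nonneg)

context positive_functional
begin

lemma emeasure_riesz_measure:
  assumes "A \<in> sets borel"
  shows "emeasure riesz_measure A = outer A"
proof (rule emeasure_measure_of[OF riesz_measure_def])
  let ?\<Lambda> = "lambda_system UNIV (Pow UNIV) outer"
  have ms: "measure_space UNIV ?\<Lambda> outer"
    using sigma_algebra.caratheodory_lemma[OF sigma_algebra_Pow outer_measure_space_outer] .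
  then have sa: "sigma_algebra UNIV ?\<Lambda>" by (simp add: measure_space_def)
  have "sets borel = sigma_sets (UNIV :: 'a set) {S. closed S}"
    by (simp add: borel_eq_closed)
  also have "\<dots> \<subseteq> ?\<Lambda>"
    by (rule sigma_algebra.sigma_sets_subset[OF sa]) (blast intro: closed_in_lambda_system)
  finally have sub: "sets borel \<subseteq> ?\<Lambda>" .
  have "measure_space UNIV (sets borel) outer"
    by (rule measure_down[OF ms _ sub]) (metis sets.sigma_algebra_axioms space_borel)
  then show "positive (sets riesz_measure) outer" "countably_additive (sets riesz_measure) outer"
    by (simp_all add: measure_space_def)
qed (use assms in auto)

lemma riesz_measure_upper:
  assumes "cc_nonneg \<phi>" "open U" "\<And>x. \<phi> x \<le> 1" "\<And>x. x \<notin> U \<Longrightarrow> \<phi> x = 0"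
  shows "ennreal (L \<phi>) \<le> emeasure riesz_measure U"
  using le_open_content[OF assms(1,3,4)] assms(2) by (simp add: emeasure_riesz_measure outer_open)

text \<open>The bound \<open>1 \<le> \<phi> x\<close> is given on \<open>A\<close> only, while
  \<open>outer\<close> looks at open supersets. For c > 1 the set where \<phi> exceeds 1/c is such a
  superset, and c \<phi> dominates every bump in it; then c decreases to 1.\<close>

lemma riesz_measure_lower:
  assumes \<phi>: "cc_nonneg \<phi>" and A: "A \<in> sets borel" and ge: "\<And>x. x \<in> A \<Longrightarrow> 1 \<le> \<phi> x"
  shows "emeasure riesz_measure A \<le> ennreal (L \<phi>)"
proof -
  have *: "outer A \<le> ennreal (c * L \<phi>)" if c: "1 < c" for c
  proof -
    define U where "U = {x. 1 / c < \<phi> x}"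
    have oU: "open U"
      unfolding U_def by (intro open_Collect_less continuous_intros cc_nonneg_continuous[OF \<phi>])
    have "A \<subseteq> U"
    proof
      fix x assume "x \<in> A"
      have "1 / c < 1" using c by simp
      also have "1 \<le> \<phi> x" using \<open>x \<in> A\<close> by (rule ge)
      finally show "x \<in> U" by (simp add: U_def)
    qed
    then have "outer A \<le> outer U" by (rule outer_mono)
    also have "\<dots> = open_content U" using oU by (rule outer_open)
    also have "\<dots> \<le> ennreal (c * L \<phi>)"
      unfolding open_content_def
    proof (intro SUP_least, clarsimp)
      fix \<psi> assume b: "bump U \<psi>"
      have "L \<psi> \<le> L (\<lambda>x. c * \<phi> x)"
      proof (rule mono[OF bump_cc_nonneg[OF b] cc_nonneg_scale[OF \<phi>]])
        fix x
        show "\<psi> x \<le> c * \<phi> x"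
        proof (cases "x \<in> U")
          case True
          then have "1 \<le> c * \<phi> x" using c by (simp add: U_def field_simps)
          then show ?thesis using b unfolding bump_def by (meson order_trans)
        next
          case False
          then have "\<psi> x = 0" using b by (auto simp: bump_def)
          then show ?thesis using c cc_nonneg_nonneg[OF \<phi>, of x] by simp
        qed
      qed (use c in simp)
      then show "ennreal (L \<psi>) \<le> ennreal (c * L \<phi>)"
        using scale[OF \<phi>, of c] c by (intro ennreal_leI) simp
    qed
    finally show ?thesis .
  qed
  have "outer A \<le> ennreal (L \<phi>)"
  proof (rule ennreal_le_epsilon)
    fix e :: real assume e: "0 < e"
    define c where "c = 1 + e / (L \<phi> + 1)"
    have L0: "0 \<le> L \<phi>" by (rule nonneg[OF \<phi>])
    have "1 < c" using e L0 by (simp add: c_def add_nonneg_pos)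
    moreover have "c * L \<phi> \<le> L \<phi> + e"
      using e L0 by (simp add: c_def field_simps)
    ultimately show "outer A \<le> ennreal (L \<phi>) + ennreal e"
      using *[of c] L0 e by (metis ennreal_leI ennreal_plus less_imp_le order_trans)
  qed
  then show ?thesis using A by (simp add: emeasure_riesz_measure)
qed

lemma riesz_measure_compact: "compact K \<Longrightarrow> emeasure riesz_measure K < \<infinity>"
proof -
  assume K: "compact K"
  obtain \<eta> where \<eta>: "cc_nonneg \<eta>" "\<And>x. x \<in> K \<Longrightarrow> \<eta> x = 1"
    using cc_nonneg_cutoff[OF K] by metis
  have "emeasure riesz_measure K \<le> ennreal (L \<eta>)"
    by (rule riesz_measure_lower[OF \<eta>(1)]) (use \<eta>(2) K in \<open>auto simp: borel_compact\<close>)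
  then show ?thesis by (rule le_less_trans) simp
qed

theorem riesz_representation:
  "radon_measure riesz_measure" "cc_nonneg \<phi> \<Longrightarrow> L \<phi> = (\<integral>x. \<phi> x \<partial>riesz_measure)"
proof -
  show "radon_measure riesz_measure"
    by (intro radon_measureI riesz_measure_compact) auto
  assume \<phi>: "cc_nonneg \<phi>"
  let ?I = "\<lambda>\<phi>. \<integral>x. \<phi> x \<partial>riesz_measure"
  have pI: "positive_functional ?I"
    by (intro positive_functional_integral riesz_measure_compact) auto
  have int: "integrable riesz_measure \<psi>" if "cc_nonneg \<psi>" for \<psi>
    using that by (intro integrable_cc_nonneg riesz_measure_compact) auto
  have nn: "ennreal (?I \<psi>) = (\<integral>\<^sup>+x. ennreal (\<psi> x) \<partial>riesz_measure)" if "cc_nonneg \<psi>" for \<psi>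
    using nn_integral_eq_integral[OF int[OF that]] cc_nonneg_nonneg[OF that] by simp
  show "L \<phi> = ?I \<phi>"
  \<comment> \<open>Both inequalities come from the same layer comparison, with \<open>L\<close> and
    the integral exchanging roles.\<close>
  proof (rule antisym)
    show "L \<phi> \<le> ?I \<phi>"
    proof (rule positive_functional_le[OF positive_functional_axioms pI _ riesz_measure_compact riesz_measure_upper _ \<phi>])
      fix \<psi> :: "'a \<Rightarrow> real" and A
      assume \<psi>: "cc_nonneg \<psi>" and A: "A \<in> sets borel" and ge: "\<And>x. x \<in> A \<Longrightarrow> 1 \<le> \<psi> x"
      have "emeasure riesz_measure A = (\<integral>\<^sup>+x. indicator A x \<partial>riesz_measure)" using A by simp
      also have "\<dots> \<le> (\<integral>\<^sup>+x. ennreal (\<psi> x) \<partial>riesz_measure)"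
        using ge by (intro nn_integral_mono) (auto split: split_indicator)
      finally show "emeasure riesz_measure A \<le> ennreal (?I \<psi>)" using nn[OF \<psi>] by simp
    qed auto
    show "?I \<phi> \<le> L \<phi>"
    proof (rule positive_functional_le[OF pI positive_functional_axioms _ riesz_measure_compact _ riesz_measure_lower \<phi>])
      fix \<psi> :: "'a \<Rightarrow> real" and U :: "'a set"
      assume \<psi>: "cc_nonneg \<psi>" and U: "open U" and le: "\<And>x. \<psi> x \<le> 1" "\<And>x. x \<notin> U \<Longrightarrow> \<psi> x = 0"
      have "ennreal (?I \<psi>) = (\<integral>\<^sup>+x. ennreal (\<psi> x) \<partial>riesz_measure)" by (rule nn[OF \<psi>])
      also have "\<dots> \<le> (\<integral>\<^sup>+x. indicator U x \<partial>riesz_measure)"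
        using le by (intro nn_integral_mono) (auto split: split_indicator simp: ennreal_le_1)
      also have "\<dots> = emeasure riesz_measure U" using U by simp
      finally show "ennreal (?I \<psi>) \<le> emeasure riesz_measure U" .
    qed auto
  qed
qed

end

section \<open>Solutions tested against functions of space\<close>

lemma AE_lborel_pair:
  fixes P :: "'a::euclidean_space \<times> 'b::euclidean_space \<Rightarrow> bool"
  assumes "AE z in lborel. P z"
  shows "AE x in lborel. AE y in lborel. P (x, y)"
proof -
  have "AE z in lborel \<Otimes>\<^sub>M lborel. P z" using assms by (subst lborel_prod)
  then show ?thesis by (rule lborel_pair.AE_pair)
qed

text \<open>\<open>P\<close> may be nonmeasurable, so the two quantifiers are exchanged not for
  \<open>P\<close> but for membership in a Borel null set that covers the exceptional
  points.\<close>

lemma AE_lborel_pair_swap: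
  fixes P :: "'a::euclidean_space \<times> 'b::euclidean_space \<Rightarrow> bool"
  assumes "AE z in lborel. P z"
  shows "AE y in lborel. AE x in lborel. P (x, y)"
proof -
  obtain N where N: "N \<in> null_sets lborel" "{z\<in>space lborel. \<not> P z} \<subseteq> N"
    using assms unfolding eventually_ae_filter by auto
  have Nm [measurable]: "N \<in> sets (borel \<Otimes>\<^sub>M borel)"
    using N(1) by (subst borel_prod) (auto simp: null_sets_def)
  have "AE z in lborel. z \<notin> N" by (rule AE_not_in[OF N(1)])
  then have "AE x in lborel. AE y in lborel. (x, y) \<notin> N" by (rule AE_lborel_pair)
  then have "AE y in lborel. AE x in lborel. (x, y) \<notin> N"
    by (subst (asm) lborel_pair.AE_commute) measurable
  then show ?thesis
    using N(2) by (auto elim!: eventually_mono)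
qed

lemma AE_lborel_ex_between:
  fixes a b :: real
  assumes "AE t in lborel. P t" "a < b"
  obtains t where "a < t" "t < b" "P t"
proof -
  have "\<not> (AE t in lborel. t \<notin> {a<..<b})"
    using AE_iff_null_sets[of "{a<..<b}" lborel] assms(2) by (auto simp: null_sets_def)
  then have "\<not> (\<forall>t\<in>{a<..<b}. \<not> P t)"
    using assms(1) by (metis (mono_tags, lifting) eventually_mono)
  then show ?thesis using that by auto
qed

lemma AE_lborel_ex:
  fixes P :: "'a::euclidean_space \<Rightarrow> bool"
  assumes "AE x in lborel. P x"
  obtains x where "P x"
proof -
  have "\<not> (AE x in (lborel :: 'a measure). False)"
    using AE_iff_null_sets[of UNIV "lborel :: 'a measure"] by (simp add: null_sets_def)
  then show ?thesis using assms that by (metis (mono_tags, lifting) eventually_mono)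
qed

section \<open>Passage to a Borel version and the tested integral inequality\<close>

lemma borel_measurable_ennreal_powr [measurable]:
  "(\<lambda>a. ennreal_powr a p) \<in> borel_measurable borel"
  unfolding ennreal_powr_def by measurable

text \<open>Both the estimates and the trace rest on lower bounds of the solution by its history, so
  the equation is kept as an inequality. The two times are parameters and only the space variable is
  quantified almost everywhere: this is what slicing a null set of triples leaves.\<close>

definition supersolution_at ::
    "(real ^ 'n \<Rightarrow> real \<Rightarrow> real) \<Rightarrow> real \<Rightarrow> ((real ^ 'n) \<times> real \<Rightarrow> ennreal) \<Rightarrow> real \<Rightarrow> real \<Rightarrow> bool" where
  "supersolution_at G p v \<tau> t \<longleftrightarrow>
     (AE x in lborel. v (x, t) < \<infinity> \<and>
        (\<integral>\<^sup>+y. ennreal (G (x - y) (t - \<tau>)) * v (y, \<tau>) \<partial>lborel)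
        + (\<integral>\<^sup>+s\<in>{\<tau><..<t}. (\<integral>\<^sup>+y. ennreal (G (x - y) (t - s)) * ennreal_powr (v (y, s)) p \<partial>lborel) \<partial>lborel)
        \<le> v (x, t))"

text \<open>A Borel version makes Tonelli's theorem applicable on products of Borel spaces. The null
  set of triples is sliced in both orders of the times because both are used: the blow-up argument
  fixes the early time \<tau> and lets t run, almost monotonicity of the pairings fixes t and lets
  \<tau> tend to 0.\<close>

lemma is_solution_borel_version:
  fixes G :: "real ^ 'n \<Rightarrow> real \<Rightarrow> real"
  assumes sol: "is_solution G p T u"
  obtains v :: "(real ^ 'n) \<times> real \<Rightarrow> ennreal" where
    "v \<in> borel_measurable borel"
    "AE t in lborel. 0 < t \<and> t < T \<longrightarrow> (AE y in lborel. u y t = v (y, t))"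
    "AE \<tau> in lborel. AE t in lborel. 0 < \<tau> \<longrightarrow> \<tau> < t \<longrightarrow> t < T \<longrightarrow> supersolution_at G p v \<tau> t"
    "AE t in lborel. AE \<tau> in lborel. 0 < \<tau> \<longrightarrow> \<tau> < t \<longrightarrow> t < T \<longrightarrow> supersolution_at G p v \<tau> t"
proof -
  let ?S = "UNIV \<times> {0<..<T} :: ((real ^ 'n) \<times> real) set"
  have S: "?S \<in> sets borel" by (simp add: borel_prod[symmetric])
  let ?E = "\<lambda>x \<tau> t. u x t < \<infinity> \<and>
        u x t = (\<integral>\<^sup>+y. ennreal (G (x - y) (t - \<tau>)) * u y \<tau> \<partial>lebesgue)
              + (\<integral>\<^sup>+s\<in>{\<tau><..<t}.
                   (\<integral>\<^sup>+y. ennreal (G (x - y) (t - s)) * ennreal_powr (u y s) p \<partial>lebesgue) \<partial>lebesgue)"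
  have meas: "(\<lambda>(x, t). u x t) \<in> borel_measurable (lebesgue_on ?S)"
    and eq: "AE (x, \<tau>, t) in lebesgue. 0 < \<tau> \<and> \<tau> < t \<and> t < T \<longrightarrow> ?E x \<tau> t"
    using sol unfolding is_solution_def by auto
  have "(\<lambda>z. (\<lambda>(x, t). u x t) z * indicator ?S z) \<in> borel_measurable lebesgue"
    using meas S by (subst (asm) borel_measurable_restrict_space_iff_ennreal) auto
  from completion_ex_borel_measurable[OF this]
  obtain v where v: "v \<in> borel_measurable borel"
    "AE z in lborel. (\<lambda>(x, t). u x t) z * indicator ?S z = v z" by auto
  have "AE t in lborel. AE y in lborel. u y t * indicator ?S (y, t) = v (y, t)"
    using AE_lborel_pair_swap[OF v(2)] by simp
  then have uv: "AE t in lborel. 0 < t \<and> t < T \<longrightarrow> (AE y in lborel. u y t = v (y, t))"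
    by (rule eventually_mono) (auto simp: indicator_def)
  have conv: "supersolution_at G p v \<tau> t"
    if "0 < \<tau>" "\<tau> < t" "t < T" and \<tau>: "AE y in lborel. u y \<tau> = v (y, \<tau>)" and t: "AE y in lborel. u y t = v (y, t)"
      and e: "AE x in lborel. ?E x \<tau> t" for \<tau> t
  proof -
    have 1: "(\<integral>\<^sup>+y. ennreal (G (x - y) (t - \<tau>)) * u y \<tau> \<partial>lborel)
        = (\<integral>\<^sup>+y. ennreal (G (x - y) (t - \<tau>)) * v (y, \<tau>) \<partial>lborel)" for x
      by (rule nn_integral_cong_AE) (use \<tau> in \<open>auto elim!: eventually_mono\<close>)
    have 2: "(\<integral>\<^sup>+s\<in>{\<tau><..<t}.
          (\<integral>\<^sup>+y. ennreal (G (x - y) (t - s)) * ennreal_powr (u y s) p \<partial>lborel) \<partial>lborel)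
        = (\<integral>\<^sup>+s\<in>{\<tau><..<t}.
          (\<integral>\<^sup>+y. ennreal (G (x - y) (t - s)) * ennreal_powr (v (y, s)) p \<partial>lborel) \<partial>lborel)" for x
    proof (rule nn_integral_cong_AE, use uv in \<open>rule eventually_mono\<close>)
      fix s assume s: "0 < s \<and> s < T \<longrightarrow> (AE y in lborel. u y s = v (y, s))"
      show "(\<integral>\<^sup>+y. ennreal (G (x - y) (t - s)) * ennreal_powr (u y s) p \<partial>lborel) * indicator {\<tau><..<t} s
          = (\<integral>\<^sup>+y. ennreal (G (x - y) (t - s)) * ennreal_powr (v (y, s)) p \<partial>lborel) * indicator {\<tau><..<t} s"
      proof (cases "s \<in> {\<tau><..<t}")
        case True
        then have "AE y in lborel. u y s = v (y, s)" using s \<open>0 < \<tau>\<close> \<open>t < T\<close> by auto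
        then have "(\<integral>\<^sup>+y. ennreal (G (x - y) (t - s)) * ennreal_powr (u y s) p \<partial>lborel)
          = (\<integral>\<^sup>+y. ennreal (G (x - y) (t - s)) * ennreal_powr (v (y, s)) p \<partial>lborel)"
          by (intro nn_integral_cong_AE) (auto elim!: eventually_mono)
        then show ?thesis by simp
      qed simp
    qed
    show ?thesis
      unfolding supersolution_at_def
      using e t unfolding nn_integral_completion 1 2
      by eventually_elim auto
  qed
  have tr: "AE z in lborel. (\<lambda>(x, \<tau>, t). 0 < \<tau> \<and> \<tau> < t \<and> t < T \<longrightarrow> ?E x \<tau> t) z"
    using eq by (subst (asm) AE_completion_iff)
  note sw = AE_lborel_pair_swap[OF tr]
  show thesis
  proof (rule that[OF v(1) uv])
    have "AE \<tau> in lborel. AE t in lborel. AE x in lborel. 0 < \<tau> \<and> \<tau> < t \<and> t < T \<longrightarrow> ?E x \<tau> t"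
      using AE_lborel_pair[OF sw] by simp
    with uv show "AE \<tau> in lborel. AE t in lborel. 0 < \<tau> \<longrightarrow> \<tau> < t \<longrightarrow> t < T \<longrightarrow> supersolution_at G p v \<tau> t"
    proof eventually_elim
      case (elim \<tau>)
      from elim(2) uv show ?case
        by eventually_elim (use elim(1) conv[of \<tau>] in auto)
    qed
    have "AE t in lborel. AE \<tau> in lborel. AE x in lborel. 0 < \<tau> \<and> \<tau> < t \<and> t < T \<longrightarrow> ?E x \<tau> t"
      using AE_lborel_pair_swap[OF sw] by simp
    with uv show "AE t in lborel. AE \<tau> in lborel. 0 < \<tau> \<longrightarrow> \<tau> < t \<longrightarrow> t < T \<longrightarrow> supersolution_at G p v \<tau> t"
    proof eventually_elim
      case (elim t)
      from elim(2) uv show ?case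
        by eventually_elim (use elim(1) conv[of _ t] in auto)
    qed
  qed
qed

context
  fixes \<theta> p :: real and G :: "real ^ 'n \<Rightarrow> real \<Rightarrow> real" and v :: "(real ^ 'n) \<times> real \<Rightarrow> ennreal"
  assumes G: "fundamental_solution \<theta> G" and \<theta>: "0 < \<theta>"
    and v [measurable]: "v \<in> borel_measurable borel"
begin

text \<open>Integrating against \<open>h\<close> and exchanging the integrals by Tonelli lets the
  kernel act on \<open>h\<close> instead of on the solution. What follows are two choices of
  \<open>h\<close>: the indicator of a ball for the mass estimates, and a test function for the
  trace.\<close>

lemma supersolution_tested:
  fixes h :: "real ^ 'n \<Rightarrow> ennreal"
  assumes sup: "supersolution_at G p v \<tau> t" and \<tau>: "\<tau> < t" and [measurable]: "h \<in> borel_measurable borel"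
  shows "(\<integral>\<^sup>+y. (\<integral>\<^sup>+x. h x * ennreal (G (x - y) (t - \<tau>)) \<partial>lborel) * v (y, \<tau>) \<partial>lborel)
     + (\<integral>\<^sup>+s\<in>{\<tau><..<t}. (\<integral>\<^sup>+y. (\<integral>\<^sup>+x. h x * ennreal (G (x - y) (t - s)) \<partial>lborel)
          * ennreal_powr (v (y, s)) p \<partial>lborel) \<partial>lborel)
     \<le> (\<integral>\<^sup>+x. h x * v (x, t) \<partial>lborel)"
proof -
  \<comment> \<open>\<open>G\<close> is controlled only at positive times, so it is extended by 0 to
    obtain a kernel that is Borel on all of space-time.\<close>
  define K where "K z = indicator (UNIV \<times> {0<..}) z *\<^sub>R (\<lambda>(x, t). G x t) z" for z
  have "K \<in> borel_measurable borel"
    unfolding K_def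
    by (rule borel_measurable_continuous_on_indicator[OF _ continuous_on_kernel[OF G \<theta>]])
      (simp add: borel_prod[symmetric])
  then have [measurable]: "K \<in> borel_measurable (borel \<Otimes>\<^sub>M borel)" by (simp add: borel_prod)
  have [measurable]: "v \<in> borel_measurable (borel \<Otimes>\<^sub>M borel)" using v by (simp add: borel_prod)
  have KG: "K (x, r) = G x r" if "0 < r" for x r using that by (simp add: K_def)
  let ?w = "\<lambda>y s. ennreal_powr (v (y, s)) p * indicator {\<tau><..<t} s"
  have A: "(\<integral>\<^sup>+y. ennreal (G (x - y) (t - \<tau>)) * v (y, \<tau>) \<partial>lborel)
    = (\<integral>\<^sup>+y. ennreal (K (x - y, t - \<tau>)) * v (y, \<tau>) \<partial>lborel)" for x
    using \<tau> by (simp add: KG)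
  have B: "(\<integral>\<^sup>+s\<in>{\<tau><..<t}. (\<integral>\<^sup>+y. ennreal (G (x - y) (t - s)) * ennreal_powr (v (y, s)) p \<partial>lborel) \<partial>lborel)
    = (\<integral>\<^sup>+s. (\<integral>\<^sup>+y. ennreal (K (x - y, t - s)) * ?w y s \<partial>lborel) \<partial>lborel)" for x
    by (intro nn_integral_cong) (auto simp: KG split: split_indicator)
  have "(\<integral>\<^sup>+x. h x * ((\<integral>\<^sup>+y. ennreal (K (x - y, t - \<tau>)) * v (y, \<tau>) \<partial>lborel)
      + (\<integral>\<^sup>+s. (\<integral>\<^sup>+y. ennreal (K (x - y, t - s)) * ?w y s \<partial>lborel) \<partial>lborel)) \<partial>lborel)
    \<le> (\<integral>\<^sup>+x. h x * v (x, t) \<partial>lborel)"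
  proof (rule nn_integral_mono_AE, use sup[unfolded supersolution_at_def A B] in \<open>rule eventually_mono\<close>)
  qed (intro mult_left_mono, simp_all)
  also have "(\<integral>\<^sup>+x. h x * ((\<integral>\<^sup>+y. ennreal (K (x - y, t - \<tau>)) * v (y, \<tau>) \<partial>lborel)
      + (\<integral>\<^sup>+s. (\<integral>\<^sup>+y. ennreal (K (x - y, t - s)) * ?w y s \<partial>lborel) \<partial>lborel)) \<partial>lborel)
    = (\<integral>\<^sup>+x. h x * (\<integral>\<^sup>+y. ennreal (K (x - y, t - \<tau>)) * v (y, \<tau>) \<partial>lborel) \<partial>lborel)
      + (\<integral>\<^sup>+x. h x * (\<integral>\<^sup>+s. (\<integral>\<^sup>+y. ennreal (K (x - y, t - s)) * ?w y s \<partial>lborel) \<partial>lborel) \<partial>lborel)"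
    unfolding distrib_left by (rule nn_integral_add) measurable
  also have "(\<integral>\<^sup>+x. h x * (\<integral>\<^sup>+y. ennreal (K (x - y, t - \<tau>)) * v (y, \<tau>) \<partial>lborel) \<partial>lborel)
    = (\<integral>\<^sup>+x. (\<integral>\<^sup>+y. h x * ennreal (K (x - y, t - \<tau>)) * v (y, \<tau>) \<partial>lborel) \<partial>lborel)"
    by (simp add: nn_integral_cmult[symmetric] mult.assoc)
  also have "\<dots> = (\<integral>\<^sup>+y. (\<integral>\<^sup>+x. h x * ennreal (K (x - y, t - \<tau>)) * v (y, \<tau>) \<partial>lborel) \<partial>lborel)"
    by (rule lborel_pair.Fubini'[symmetric]) measurable
  also have "\<dots> = (\<integral>\<^sup>+y. (\<integral>\<^sup>+x. h x * ennreal (K (x - y, t - \<tau>)) \<partial>lborel) * v (y, \<tau>) \<partial>lborel)"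
    by (simp add: nn_integral_multc)
  also have "\<dots> = (\<integral>\<^sup>+y. (\<integral>\<^sup>+x. h x * ennreal (G (x - y) (t - \<tau>)) \<partial>lborel) * v (y, \<tau>) \<partial>lborel)"
    using \<tau> by (simp add: KG)
  also have "(\<integral>\<^sup>+x. h x * (\<integral>\<^sup>+s. (\<integral>\<^sup>+y. ennreal (K (x - y, t - s)) * ?w y s \<partial>lborel) \<partial>lborel) \<partial>lborel)
    = (\<integral>\<^sup>+x. (\<integral>\<^sup>+s. (\<integral>\<^sup>+y. h x * ennreal (K (x - y, t - s)) * ?w y s \<partial>lborel) \<partial>lborel) \<partial>lborel)"
    by (simp add: nn_integral_cmult[symmetric] mult.assoc)
  also have "\<dots> = (\<integral>\<^sup>+s. (\<integral>\<^sup>+x. (\<integral>\<^sup>+y. h x * ennreal (K (x - y, t - s)) * ?w y s \<partial>lborel) \<partial>lborel) \<partial>lborel)"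
    by (rule lborel_pair.Fubini'[symmetric]) measurable
  also have "\<dots> = (\<integral>\<^sup>+s. (\<integral>\<^sup>+y. (\<integral>\<^sup>+x. h x * ennreal (K (x - y, t - s)) * ?w y s \<partial>lborel) \<partial>lborel) \<partial>lborel)"
    by (intro nn_integral_cong lborel_pair.Fubini'[symmetric]) measurable
  also have "\<dots> = (\<integral>\<^sup>+s. (\<integral>\<^sup>+y. (\<integral>\<^sup>+x. h x * ennreal (K (x - y, t - s)) \<partial>lborel) * ?w y s \<partial>lborel) \<partial>lborel)"
    by (simp add: nn_integral_multc)
  also have "\<dots> = (\<integral>\<^sup>+s\<in>{\<tau><..<t}. (\<integral>\<^sup>+y. (\<integral>\<^sup>+x. h x * ennreal (G (x - y) (t - s)) \<partial>lborel)
          * ennreal_powr (v (y, s)) p \<partial>lborel) \<partial>lborel)"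
    by (intro nn_integral_cong) (auto simp: KG split: split_indicator)
  finally show ?thesis .
qed

text \<open>One point \<open>x\<close> with a finite value at the later time suffices: the positive
  continuous kernel seen from \<open>x\<close> is bounded below on the compact ball, so the mass
  there at time \<tau> is at most a multiple of \<open>v (x, t)\<close>.\<close>

lemma supersolution_locally_finite:
  assumes sup: "supersolution_at G p v \<tau> t" and \<tau>: "\<tau> < t"
  shows "(\<integral>\<^sup>+y\<in>ball x0 R. v (y, \<tau>) \<partial>lborel) < \<infinity>"
proof -
  have [measurable]: "v \<in> borel_measurable (borel \<Otimes>\<^sub>M borel)" using v by (simp add: borel_prod)
  have [measurable]: "ball x0 R \<in> sets borel" by simp
  obtain x where x: "v (x, t) < \<infinity>"
    "(\<integral>\<^sup>+y. ennreal (G (x - y) (t - \<tau>)) * v (y, \<tau>) \<partial>lborel) \<le> v (x, t)"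
    using sup unfolding supersolution_at_def
    by (elim AE_lborel_ex) (meson add_increasing2 le_iff_add order_trans zero_le)
  have cont: "continuous_on (cball x0 R) (\<lambda>y. G (x - y) (t - \<tau>))"
    using \<tau> by (intro continuous_intros continuous_on_compose2[OF continuous_on_kernel_slice[OF G \<theta>, of "t - \<tau>"]]) auto
  obtain c where c: "0 < c" "\<And>y. y \<in> cball x0 R \<Longrightarrow> c \<le> G (x - y) (t - \<tau>)"
  proof (cases "cball x0 R = {}")
    case False
    then obtain y where "y \<in> cball x0 R" "\<And>z. z \<in> cball x0 R \<Longrightarrow> G (x - y) (t - \<tau>) \<le> G (x - z) (t - \<tau>)"
      using continuous_attains_inf[OF compact_cball False cont] by blast
    then show ?thesis using that kernel_pos[OF G \<theta>, of "t - \<tau>"] \<tau> by force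
  qed (use that[of 1] in auto)
  have "ennreal c * (\<integral>\<^sup>+y\<in>ball x0 R. v (y, \<tau>) \<partial>lborel) = (\<integral>\<^sup>+y. ennreal c * (v (y, \<tau>) * indicator (ball x0 R) y) \<partial>lborel)"
    by (subst nn_integral_cmult) auto
  also have "\<dots> \<le> (\<integral>\<^sup>+y. ennreal (G (x - y) (t - \<tau>)) * v (y, \<tau>) \<partial>lborel)"
    using c by (intro nn_integral_mono) (auto split: split_indicator intro!: mult_right_mono ennreal_leI)
  also have "\<dots> < \<infinity>" using x by order
  finally show ?thesis
    using c(1) by (auto simp: ennreal_mult_less_top)
qed

end

section \<open>Blow-up of ball masses\<close>

text \<open>A discrete form of blow-up for \<Phi>' \<ge> \<Phi>^p. A step of length (2^j m)^(1-p) is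
  just long enough to double the value 2^j m, and these lengths form a geometric series with sum
  m^(1-p) / (1 - 2^(1-p)). If B exceeded this sum S, then \<Phi> at S, which lies beyond every step,
  would dominate all 2^j m.\<close>

lemma doubling_bound:
  fixes \<Phi> :: "real \<Rightarrow> real"
  assumes p: "1 < p" and m: "0 < m" "m \<le> \<Phi> 0"
    and step: "\<And>x y. 0 \<le> x \<Longrightarrow> x < y \<Longrightarrow> y < B \<Longrightarrow> \<Phi> x + (y - x) * \<Phi> x powr p \<le> \<Phi> y"
  shows "B \<le> m powr (1 - p) / (1 - 2 powr (1 - p))"
proof (rule ccontr)
  define q where "q = (2::real) powr (1 - p)"
  have q: "0 < q" "q < 1" using p powr_less_mono[of "1 - p" 0 2] by (auto simp: q_def)
  define S where "S = m powr (1 - p) / (1 - q)"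
  assume "\<not> B \<le> m powr (1 - p) / (1 - 2 powr (1 - p))"
  then have SB: "S < B" by (simp add: S_def q_def)
  define x where "x j = m powr (1 - p) * (1 - q ^ j) / (1 - q)" for j :: nat
  have x0: "x 0 = 0" by (simp add: x_def)
  have x_step: "x (Suc j) - x j = (2 ^ j * m) powr (1 - p)" for j
  proof -
    have "x (Suc j) - x j = m powr (1 - p) * ((1 - q ^ Suc j) - (1 - q ^ j)) / (1 - q)"
      unfolding x_def by (simp add: diff_divide_distrib[symmetric] right_diff_distrib[symmetric])
    also have "(1 - q ^ Suc j) - (1 - q ^ j) = q ^ j * (1 - q)" by (simp add: algebra_simps)
    also have "m powr (1 - p) * (q ^ j * (1 - q)) / (1 - q) = m powr (1 - p) * q ^ j"
      using q by simp
    also have "q ^ j = (2 ^ j) powr (1 - p)"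
      using q by (simp add: q_def powr_realpow[symmetric] powr_powr mult.commute)
    also have "m powr (1 - p) * (2 ^ j) powr (1 - p) = (2 ^ j * m) powr (1 - p)"
      using m by (simp add: powr_mult)
    finally show ?thesis .
  qed
  have x_nonneg: "0 \<le> x j" for j
    using q m by (simp add: x_def power_le_one)
  have x_S: "x j < S" for j
    using q m by (simp add: x_def S_def divide_strict_right_mono)
  have x_lt: "x j < x (Suc j)" for j
    using x_step[of j] m by (metis diff_gt_0_iff_gt mult_pos_pos powr_gt_zero zero_less_numeral zero_less_power less_irrefl)
  have grow: "2 ^ j * m \<le> \<Phi> (x j)" for j
  proof (induction j)
    case 0
    then show ?case using m by (simp add: x0)
  next
    case (Suc j)
    have pos: "0 < 2 ^ j * m" using m by simp
    have "2 ^ Suc j * m = 2 ^ j * m + (2 ^ j * m) powr (1 - p) * (2 ^ j * m) powr p"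
      using pos by (simp add: powr_add[symmetric])
    also have "\<dots> \<le> \<Phi> (x j) + (x (Suc j) - x j) * \<Phi> (x j) powr p"
      unfolding x_step using Suc pos p by (intro add_mono mult_left_mono powr_mono2) auto
    also have "\<dots> \<le> \<Phi> (x (Suc j))"
      using x_S[of "Suc j"] SB by (intro step x_nonneg x_lt) simp
    finally show ?case .
  qed
  have "2 ^ j * m \<le> \<Phi> S" for j
  proof -
    have "2 ^ j * m \<le> \<Phi> (x j)" by (rule grow)
    also have "\<dots> \<le> \<Phi> (x j) + (S - x j) * \<Phi> (x j) powr p"
      using x_S[of j] by simp
    also have "\<dots> \<le> \<Phi> S" by (rule step[OF x_nonneg x_S SB])
    finally show ?thesis .
  qed
  then have "2 ^ j \<le> \<Phi> S / m" for j using m by (simp add: field_simps)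
  then show False using real_arch_pow[of 2 "\<Phi> S / m"] by (auto simp: not_less[symmetric])
qed

text \<open>\<open>k\<close> obeys its inequality at almost every time only and need not be
  monotone, so doubling is applied to its nondecreasing minorant \<open>F\<close>. The map
  \<open>\<psi>\<close> is a change of time under which the weight \<open>c * \<omega>\<close>
  accumulates at least at unit speed: affine for constant \<open>\<omega>\<close>, exponential for
  \<open>\<omega>\<close> proportional to 1/s.\<close>

lemma blowup_estimate:
  fixes k g :: "real \<Rightarrow> ennreal" and \<omega> \<psi> :: "real \<Rightarrow> real"
  assumes p: "1 < p" and m: "0 < m"
    and [measurable]: "g \<in> borel_measurable borel"
    and low: "AE t in lborel. a < t \<and> t < b \<longrightarrow>
      ennreal m + ennreal c * (\<integral>\<^sup>+s\<in>{a<..<t}. g s \<partial>lborel) \<le> k t \<and> k t < \<infinity>"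
    and growth: "\<And>s r. a < s \<Longrightarrow> s < b \<Longrightarrow> 0 \<le> r \<Longrightarrow> ennreal r \<le> k s \<Longrightarrow> ennreal (\<omega> s * r powr p) \<le> g s"
    and \<omega>: "\<And>s. a < s \<Longrightarrow> 0 \<le> \<omega> s" and [measurable]: "\<omega> \<in> borel_measurable borel"
    and \<psi>0: "\<psi> 0 = a"
    and \<psi>: "\<And>x y. 0 \<le> x \<Longrightarrow> x < y \<Longrightarrow> y < B \<Longrightarrow> a \<le> \<psi> x \<and> \<psi> x < \<psi> y \<and> \<psi> y < b \<and>
      ennreal (y - x) \<le> ennreal c * (\<integral>\<^sup>+s\<in>{\<psi> x<..<\<psi> y}. ennreal (\<omega> s) \<partial>lborel)"
  shows "B \<le> m powr (1 - p) / (1 - 2 powr (1 - p))"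
proof -
  define F where "F t = ennreal m + ennreal c * (\<integral>\<^sup>+s\<in>{a<..<t}. g s \<partial>lborel)" for t
  have F_mono: "F s \<le> F t" if "s \<le> t" for s t
    unfolding F_def using that
    by (intro add_left_mono mult_left_mono nn_integral_mono) (auto split: split_indicator)
  have lowF: "AE t in lborel. a < t \<and> t < b \<longrightarrow> F t \<le> k t \<and> k t < \<infinity>"
    using low by (simp add: F_def)
  \<comment> \<open>Finiteness at almost every time spreads to every time before b, since
    \<open>F\<close> is monotone and a good later time always exists.\<close>
  have F_fin: "F t < \<infinity>" if "a \<le> t" "t < b" for t
  proof -
    obtain t' where t': "t < t'" "t' < b" "a < t' \<and> t' < b \<longrightarrow> F t' \<le> k t' \<and> k t' < \<infinity>"
      using AE_lborel_ex_between[OF lowF \<open>t < b\<close>] by blast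
    then have "F t \<le> F t'" by (intro F_mono) simp
    also have "\<dots> < \<infinity>" using t' that by (meson le_less_trans)
    finally show ?thesis .
  qed
  define f where "f t = enn2real (F t)" for t
  have Ff: "F t = ennreal (f t)" if "a \<le> t" "t < b" for t
    using F_fin[OF that] by (simp add: f_def less_top)
  have f0: "0 \<le> f t" for t by (simp add: f_def)
  show ?thesis
  proof (rule doubling_bound[where \<Phi> = "\<lambda>x. f (\<psi> x)", OF p m])
    show "m \<le> f (\<psi> 0)"
      using m by (simp add: f_def F_def \<psi>0)
  next
    fix x y assume xy: "0 \<le> x" "x < y" "y < B"
    note \<psi>xy = \<psi>[OF xy]
    then have px: "a \<le> \<psi> x" "\<psi> x < b" "\<psi> x < \<psi> y" and py: "a \<le> \<psi> y" "\<psi> y < b" by auto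
    define r where "r = f (\<psi> x) powr p"
    have r: "0 \<le> r" by (simp add: r_def)
    let ?J = "\<integral>\<^sup>+s. g s * indicator {\<psi> x<..<\<psi> y} s \<partial>lborel"
    have "ennreal ((y - x) * r) = ennreal (y - x) * ennreal r"
      using xy r by (simp add: ennreal_mult)
    also have "\<dots> \<le> (ennreal c * (\<integral>\<^sup>+s\<in>{\<psi> x<..<\<psi> y}. ennreal (\<omega> s) \<partial>lborel)) * ennreal r"
      using \<psi>xy by (intro mult_right_mono) auto
    also have "\<dots> = ennreal c * (\<integral>\<^sup>+s. ennreal (\<omega> s) * indicator {\<psi> x<..<\<psi> y} s * ennreal r \<partial>lborel)"
      by (subst nn_integral_multc) (auto simp: mult.assoc)
    also have "\<dots> \<le> ennreal c * ?J"
    proof (intro mult_left_mono nn_integral_mono_AE, use lowF in \<open>rule eventually_mono\<close>)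
      fix s assume s: "a < s \<and> s < b \<longrightarrow> F s \<le> k s \<and> k s < \<infinity>"
      show "ennreal (\<omega> s) * indicator {\<psi> x<..<\<psi> y} s * ennreal r \<le> g s * indicator {\<psi> x<..<\<psi> y} s"
      proof (cases "s \<in> {\<psi> x<..<\<psi> y}")
        case True
        then have sab: "a < s" "s < b" using px py by auto
        have "ennreal (f (\<psi> x)) = F (\<psi> x)" using Ff px by simp
        also have "\<dots> \<le> F s" using True by (intro F_mono) simp
        also have "\<dots> \<le> k s" using s sab by simp
        finally have "ennreal (\<omega> s * r) \<le> g s"
          unfolding r_def by (intro growth sab f0)
        then show ?thesis using True \<omega>[OF sab(1)] r by (simp add: ennreal_mult)
      qed simp
    qed simp
    finally have 1: "ennreal ((y - x) * r) \<le> ennreal c * ?J" .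
    have "ennreal (f (\<psi> x) + (y - x) * r) = F (\<psi> x) + ennreal ((y - x) * r)"
      using xy r f0 Ff px by (simp add: ennreal_plus)
    also have "\<dots> \<le> F (\<psi> x) + ennreal c * ?J"
      using 1 by (rule add_left_mono)
    also have "\<dots> = ennreal m + ennreal c * ((\<integral>\<^sup>+s. g s * indicator {a<..<\<psi> x} s \<partial>lborel)
        + ?J)"
      by (simp add: F_def distrib_left add.assoc)
    also have "\<dots> = ennreal m + ennreal c * (\<integral>\<^sup>+s. g s * indicator {a<..<\<psi> x} s
        + g s * indicator {\<psi> x<..<\<psi> y} s \<partial>lborel)"
      by (subst nn_integral_add) auto
    also have "\<dots> \<le> F (\<psi> y)"
      unfolding F_def using px
      by (intro add_left_mono mult_left_mono nn_integral_mono) (auto split: split_indicator)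
    also have "\<dots> = ennreal (f (\<psi> y))" using Ff py by simp
    finally show "f (\<psi> x) + (y - x) * f (\<psi> x) powr p \<le> f (\<psi> y)"
      using f0 by (simp add: r_def)
  qed
qed

text \<open>The tangent to x^p at 1 lies below the graph; this is Young's inequality for x^p and 1
  with weights 1/p and 1 - 1/p.\<close>

lemma powr_tangent:
  fixes x p :: real
  assumes p: "1 < p" and x: "0 \<le> x"
  shows "p * x \<le> x powr p + (p - 1)"
proof (cases "x = 0")
  case False
  then have "x > 0" using x by simp
  have "(x powr p) powr (1 / p) * 1 powr (1 - 1 / p) \<le> 1 / p * (x powr p) + (1 - 1 / p) * 1"
    by (rule Youngs_inequality_0) (use p \<open>x > 0\<close> in auto)
  then have "x \<le> 1 / p * (x powr p) + (1 - 1 / p)"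
    using p \<open>x > 0\<close> by (simp add: powr_powr)
  then have "p * x \<le> p * (1 / p * (x powr p) + (1 - 1 / p))"
    using p by (intro mult_left_mono) auto
  also have "\<dots> = x powr p + (p - 1)" using p by (simp add: field_simps)
  finally show ?thesis .
qed (use p in simp)

text \<open>Jensen's inequality for values in [0, \<infinity>], with a lower bound m in place of the
  integral itself. Integrating the tangent line of the power function over \<open>A\<close> avoids
  dividing by a possibly infinite mean.\<close>

lemma jensen_powr:
  fixes w :: "'a \<Rightarrow> ennreal"
  assumes p: "1 < p" and A [measurable]: "A \<in> sets M" and [measurable]: "w \<in> borel_measurable M"
    and b: "emeasure M A = ennreal b" "0 < b" and m: "0 \<le> m" "ennreal m \<le> (\<integral>\<^sup>+y\<in>A. w y \<partial>M)"
  shows "ennreal (b powr (1 - p) * m powr p) \<le> (\<integral>\<^sup>+y\<in>A. ennreal_powr (w y) p \<partial>M)"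
proof (cases "m = 0")
  case False
  with m have "m > 0" by simp
  \<comment> \<open>The point of tangency is the mean: there p l^(p-1) m equals p l^p b, and
    subtracting (p-1) l^p b leaves l^p b, the claimed bound.\<close>
  define l where "l = m / b"
  have l: "l > 0" using \<open>m > 0\<close> b by (simp add: l_def)
  have pt: "ennreal (p * l powr (p - 1)) * w y \<le> ennreal_powr (w y) p + ennreal ((p - 1) * l powr p)" for y
  proof (cases "w y")
    case (real a)
    have "p * (a / l) \<le> (a / l) powr p + (p - 1)"
      using real l by (intro powr_tangent p) simp
    then have "l powr p * (p * (a / l)) \<le> l powr p * ((a / l) powr p + (p - 1))"
      by (intro mult_left_mono) auto
    also have "l powr p * (p * (a / l)) = p * l powr (p - 1) * a"
      using l by (simp add: powr_diff)
    also have "l powr p * ((a / l) powr p + (p - 1)) = a powr p + (p - 1) * l powr p"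
      using l real by (simp add: powr_divide distrib_left)
    finally have "ennreal (p * l powr (p - 1) * a) \<le> ennreal (a powr p + (p - 1) * l powr p)"
      by (rule ennreal_leI)
    then show ?thesis
      using real l p by (simp add: ennreal_powr_def ennreal_mult ennreal_plus)
  qed (simp add: ennreal_powr_def)
  have "ennreal (p * l powr (p - 1)) * ennreal m \<le> ennreal (p * l powr (p - 1)) * (\<integral>\<^sup>+y\<in>A. w y \<partial>M)"
    using m by (intro mult_left_mono) auto
  also have "\<dots> = (\<integral>\<^sup>+y. ennreal (p * l powr (p - 1)) * (w y * indicator A y) \<partial>M)"
    by (rule nn_integral_cmult[symmetric]) measurable
  also have "\<dots> \<le> (\<integral>\<^sup>+y. ennreal_powr (w y) p * indicator A y + ennreal ((p - 1) * l powr p) * indicator A y \<partial>M)"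
    using pt by (intro nn_integral_mono) (auto split: split_indicator)
  also have "\<dots> = (\<integral>\<^sup>+y\<in>A. ennreal_powr (w y) p \<partial>M) + ennreal ((p - 1) * l powr p) * emeasure M A"
    by (subst nn_integral_add) (auto simp: nn_integral_cmult_indicator)
  finally have main: "ennreal (p * l powr (p - 1) * m) \<le> (\<integral>\<^sup>+y\<in>A. ennreal_powr (w y) p \<partial>M) + ennreal ((p - 1) * l powr p * b)"
    using p m b by (simp add: ennreal_mult)
  have e1: "p * l powr (p - 1) * m = p * (l powr p * b)"
    using l b \<open>m > 0\<close> by (simp add: powr_diff l_def)
  have e2: "b powr (1 - p) * m powr p = l powr p * b"
    using b \<open>m > 0\<close> by (simp add: l_def powr_divide powr_diff)
  show ?thesis
  proof (cases "\<integral>\<^sup>+y\<in>A. ennreal_powr (w y) p \<partial>M")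
    case (real J)
    then have "p * (l powr p * b) \<le> J + (p - 1) * l powr p * b"
      using main p b by (simp add: e1 ennreal_plus[symmetric] del: ennreal_plus)
    then have "l powr p * b \<le> J" by (simp add: algebra_simps)
    then show ?thesis using real by (simp add: e2)
  qed simp
qed simp

section \<open>Growth and bounds of the mass in a ball\<close>

definition ball_mass :: "('a::euclidean_space \<times> real \<Rightarrow> ennreal) \<Rightarrow> 'a \<Rightarrow> real \<Rightarrow> real \<Rightarrow> ennreal" where
  "ball_mass v x0 R t = (\<integral>\<^sup>+y\<in>ball x0 R. v (y, t) \<partial>lborel)"

lemma ball_mass_mono: "R \<le> R' \<Longrightarrow> ball_mass v x0 R t \<le> ball_mass v x0 R' t"
  unfolding ball_mass_def by (intro nn_integral_mono) (auto split: split_indicator)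

lemma ball_mass_growth:
  fixes v :: "'a::euclidean_space \<times> real \<Rightarrow> ennreal"
  assumes p: "1 < p" and v: "v \<in> borel_measurable borel" and R: "0 < R"
    and r: "0 \<le> r" "ennreal r \<le> ball_mass v x0 R t"
  shows "ennreal ((unit_ball_vol (DIM('a)) * R ^ DIM('a)) powr (1 - p) * r powr p)
    \<le> (\<integral>\<^sup>+y\<in>ball x0 R. ennreal_powr (v (y, t)) p \<partial>lborel)"
proof (rule jensen_powr[OF p _ _ _ _ r(1)])
  have [measurable]: "v \<in> borel_measurable (borel \<Otimes>\<^sub>M borel)" using v by (simp add: borel_prod)
  show "(\<lambda>y. v (y, t)) \<in> borel_measurable lborel" by measurable
  show "emeasure lborel (ball x0 R) = ennreal (unit_ball_vol (DIM('a)) * R ^ DIM('a))"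
    using R by (simp add: emeasure_ball)
  show "0 < unit_ball_vol (DIM('a)) * R ^ DIM('a)" using R by simp
qed (use r(2) in \<open>auto simp: ball_mass_def\<close>)


lemma blowup_invert:
  fixes B D m p :: real
  assumes "1 < p" "0 < B" "0 < D" "0 < m" "B \<le> m powr (1 - p) / D"
  shows "m \<le> (D * B) powr (- 1 / (p - 1))"
proof -
  have "D * B \<le> m powr (1 - p)" using assms by (simp add: field_simps)
  then have "(m powr (1 - p)) powr (- 1 / (p - 1)) \<le> (D * B) powr (- 1 / (p - 1))"
    using assms by (intro powr_mono2') auto
  also have "(m powr (1 - p)) powr (- 1 / (p - 1)) = m"
  proof -
    have "(1 - p) * (- 1 / (p - 1)) = 1" using assms(1) by (simp add: field_simps)
    then show ?thesis using assms(4) by (simp add: powr_powr)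
  qed
  finally show ?thesis .
qed

context
  fixes \<theta> p c T :: real and G :: "real ^ 'n \<Rightarrow> real \<Rightarrow> real" and v :: "(real ^ 'n) \<times> real \<Rightarrow> ennreal"
  assumes G: "fundamental_solution \<theta> G" and \<theta>: "0 < \<theta>" and p: "1 < p"
    and v [measurable]: "v \<in> borel_measurable borel"
    and sup: "AE \<tau> in lborel. AE t in lborel. 0 < \<tau> \<longrightarrow> \<tau> < t \<longrightarrow> t < T \<longrightarrow> supersolution_at G p v \<tau> t"
    and c: "0 < c" and cm: "\<forall>r R x0 y. 0 < r \<longrightarrow> r powr (1 / \<theta>) \<le> R \<longrightarrow> y \<in> ball x0 R \<longrightarrow>
      ennreal c \<le> (\<integral>\<^sup>+x\<in>ball x0 R. ennreal (G (x - y) r) \<partial>lborel)"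
begin

lemma ball_mass_finite:
  "AE \<tau> in lborel. 0 < \<tau> \<and> \<tau> < T \<longrightarrow> (\<forall>x0 R. ball_mass v x0 R \<tau> < \<infinity>)"
  using sup
proof (rule eventually_mono)
  fix \<tau> assume e: "AE t in lborel. 0 < \<tau> \<longrightarrow> \<tau> < t \<longrightarrow> t < T \<longrightarrow> supersolution_at G p v \<tau> t"
  show "0 < \<tau> \<and> \<tau> < T \<longrightarrow> (\<forall>x0 R. ball_mass v x0 R \<tau> < \<infinity>)"
  proof (intro impI allI)
    fix x0 :: "real ^ 'n" and R assume \<tau>: "0 < \<tau> \<and> \<tau> < T"
    then obtain t where "\<tau> < t" "t < T" "supersolution_at G p v \<tau> t"
      using AE_lborel_ex_between[OF e, of \<tau> T] by blast
    then show "ball_mass v x0 R \<tau> < \<infinity>"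
      unfolding ball_mass_def using supersolution_locally_finite[OF G \<theta> v] by blast
  qed
qed

text \<open>The solution is tested with the indicator of the ball. For every s from \<tau> up to t
  the elapsed time t - s is at most R^\<theta>, so the same fraction \<open>c\<close> of kernel mass
  stays in the ball for the initial term and for all source terms.\<close>

lemma ball_mass_inequality:
  assumes st: "supersolution_at G p v \<tau> t" and \<tau>: "\<tau> < t" and R: "(t - \<tau>) powr (1 / \<theta>) \<le> R"
  shows "ennreal c * ball_mass v x0 R \<tau>
    + ennreal c * (\<integral>\<^sup>+s\<in>{\<tau><..<t}. (\<integral>\<^sup>+y\<in>ball x0 R. ennreal_powr (v (y, s)) p \<partial>lborel) \<partial>lborel)
    \<le> ball_mass v x0 R t"
proof -
  let ?g = "\<lambda>s. \<integral>\<^sup>+y\<in>ball x0 R. ennreal_powr (v (y, s)) p \<partial>lborel"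
  have [measurable]: "v \<in> borel_measurable (borel \<Otimes>\<^sub>M borel)" using v by (simp add: borel_prod)
  have [measurable]: "ball x0 R \<in> sets borel" by simp
  let ?I = "indicator (ball x0 R) :: real ^ 'n \<Rightarrow> ennreal"
  have low: "ennreal c * ?I y \<le> (\<integral>\<^sup>+x. ?I x * ennreal (G (x - y) (t - s)) \<partial>lborel)"
    if s: "\<tau> \<le> s" "s < t" for s y
  proof (cases "y \<in> ball x0 R")
    case True
    have "(t - s) powr (1 / \<theta>) \<le> (t - \<tau>) powr (1 / \<theta>)"
      using s \<theta> by (intro powr_mono2) auto
    then have "ennreal c \<le> (\<integral>\<^sup>+x\<in>ball x0 R. ennreal (G (x - y) (t - s)) \<partial>lborel)"
      using s R True by (intro cm[rule_format]) auto
    then show ?thesis using True by (simp add: mult.commute)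
  qed simp
  have 1: "ennreal c * ball_mass v x0 R \<tau>
    \<le> (\<integral>\<^sup>+y. (\<integral>\<^sup>+x. ?I x * ennreal (G (x - y) (t - \<tau>)) \<partial>lborel) * v (y, \<tau>) \<partial>lborel)"
  proof -
    have "ennreal c * ball_mass v x0 R \<tau> = (\<integral>\<^sup>+y. ennreal c * ?I y * v (y, \<tau>) \<partial>lborel)"
      unfolding ball_mass_def by (subst nn_integral_cmult[symmetric]) (auto simp: mult_ac)
    also have "\<dots> \<le> (\<integral>\<^sup>+y. (\<integral>\<^sup>+x. ?I x * ennreal (G (x - y) (t - \<tau>)) \<partial>lborel) * v (y, \<tau>) \<partial>lborel)"
      using \<tau> by (intro nn_integral_mono mult_right_mono low) auto
    finally show ?thesis .
  qed
  have 2: "ennreal c * (\<integral>\<^sup>+s\<in>{\<tau><..<t}. ?g s \<partial>lborel)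
    \<le> (\<integral>\<^sup>+s\<in>{\<tau><..<t}. (\<integral>\<^sup>+y. (\<integral>\<^sup>+x. ?I x * ennreal (G (x - y) (t - s)) \<partial>lborel)
          * ennreal_powr (v (y, s)) p \<partial>lborel) \<partial>lborel)"
  proof -
    have "ennreal c * (\<integral>\<^sup>+s\<in>{\<tau><..<t}. ?g s \<partial>lborel)
      = (\<integral>\<^sup>+s. ennreal c * (?g s * indicator {\<tau><..<t} s) \<partial>lborel)"
      by (rule nn_integral_cmult[symmetric]) measurable
    also have "\<dots> = (\<integral>\<^sup>+s\<in>{\<tau><..<t}. (\<integral>\<^sup>+y. ennreal c * ?I y * ennreal_powr (v (y, s)) p \<partial>lborel) \<partial>lborel)"
      by (intro nn_integral_cong, subst mult.assoc[symmetric], subst nn_integral_cmult[symmetric])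
        (auto simp: mult_ac)
    also have "\<dots> \<le> (\<integral>\<^sup>+s\<in>{\<tau><..<t}. (\<integral>\<^sup>+y. (\<integral>\<^sup>+x. ?I x * ennreal (G (x - y) (t - s)) \<partial>lborel)
          * ennreal_powr (v (y, s)) p \<partial>lborel) \<partial>lborel)"
    proof (rule nn_integral_mono)
      fix s
      show "(\<integral>\<^sup>+y. ennreal c * ?I y * ennreal_powr (v (y, s)) p \<partial>lborel) * indicator {\<tau><..<t} s
        \<le> (\<integral>\<^sup>+y. (\<integral>\<^sup>+x. ?I x * ennreal (G (x - y) (t - s)) \<partial>lborel)
          * ennreal_powr (v (y, s)) p \<partial>lborel) * indicator {\<tau><..<t} s"
        by (cases "s \<in> {\<tau><..<t}") (auto intro!: nn_integral_mono mult_right_mono low)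
    qed
    finally show ?thesis .
  qed
  have "(\<integral>\<^sup>+x. ?I x * v (x, t) \<partial>lborel) = ball_mass v x0 R t"
    by (simp add: ball_mass_def mult.commute)
  then show ?thesis
    using add_mono[OF 1 2] supersolution_tested[OF G \<theta> v st \<tau>, of ?I] by simp
qed

text \<open>For the radius R = T'^(1/\<theta>) the mass inequality is valid on the whole of (\<tau>,
  T'), and Jensen's weight is the constant |B_R|^(1-p). A mass too large at time \<tau> would blow
  up before T'. Leaving T' \<le> T free is what later gives small balls.\<close>

lemma ball_mass_bound:
  assumes T': "0 < T'" "T' \<le> T"
  shows "AE \<tau> in lborel. 0 < \<tau> \<and> \<tau> < T' / 2 \<longrightarrow> (\<forall>x0. ball_mass v x0 (T' powr (1 / \<theta>)) \<tau>
    \<le> ennreal (unit_ball_vol (real CARD('n)) / c * ((1 - 2 powr (1 - p)) * c / 2) powr (- 1 / (p - 1))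
        * T' powr (real CARD('n) / \<theta> - 1 / (p - 1))))"
  using sup ball_mass_finite
proof eventually_elim
  case (elim \<tau>)
  show ?case
  proof (intro impI allI)
    fix x0 :: "real ^ 'n" assume \<tau>: "0 < \<tau> \<and> \<tau> < T' / 2"
    then have \<tau>T: "\<tau> < T'" using T' by simp
    have [measurable]: "v \<in> borel_measurable (borel \<Otimes>\<^sub>M borel)" using v by (simp add: borel_prod)
    define R where "R = T' powr (1 / \<theta>)"
    let ?g = "\<lambda>s. \<integral>\<^sup>+y\<in>ball x0 R. ennreal_powr (v (y, s)) p \<partial>lborel"
    have R: "R > 0" using T' by (simp add: R_def)
    have [measurable]: "ball x0 R \<in> sets borel" by simp
    define V where "V = unit_ball_vol (real CARD('n))"
    have V: "V > 0" by (simp add: V_def)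
    define b where "b = V * R ^ CARD('n)"
    have b: "b > 0" using V R by (simp add: b_def)
    define D where "D = 1 - (2::real) powr (1 - p)"
    have D: "D > 0" using p powr_less_mono[of "1 - p" 0 2] by (simp add: D_def)
    define \<kappa> where "\<kappa> = enn2real (ball_mass v x0 R \<tau>)"
    have \<kappa>: "ball_mass v x0 R \<tau> = ennreal \<kappa>" "0 \<le> \<kappa>"
      using elim(2) \<tau> T' by (auto simp: \<kappa>_def less_top)
    define C where "C = V / c * (D * c / 2) powr (- 1 / (p - 1)) * T' powr (real CARD('n) / \<theta> - 1 / (p - 1))"
    have "\<kappa> \<le> C"
    proof (cases "\<kappa> = 0")
      case True
      then show ?thesis using V c by (simp add: C_def)
    next
      case False
      then have "\<kappa> > 0" using \<kappa> by simp
      define \<omega> where "\<omega> = b powr (1 - p)"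
      have \<omega>: "\<omega> > 0" using b by (simp add: \<omega>_def)
      \<comment> \<open>The fraction c \<kappa> of the mass at time \<tau> is the starting value.
        The affine time change makes \<open>c * \<omega>\<close> accumulate exactly y - x, and B is
        the length that carries \<tau> to T'.\<close>
      have "c * \<omega> * (T' - \<tau>) \<le> (c * \<kappa>) powr (1 - p) / (1 - 2 powr (1 - p))"
      proof (rule blowup_estimate[where a = \<tau> and b = T' and c = c and k = "ball_mass v x0 R"
            and g = "?g" and \<omega> = "\<lambda>_. \<omega>"
            and \<psi> = "\<lambda>x. \<tau> + x / (c * \<omega>)"])
        show "AE t in lborel. \<tau> < t \<and> t < T' \<longrightarrow>
          ennreal (c * \<kappa>) + ennreal c * (\<integral>\<^sup>+s\<in>{\<tau><..<t}.
            ?g s \<partial>lborel) \<le> ball_mass v x0 R t \<and>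
          ball_mass v x0 R t < \<infinity>"
          using elim(1) ball_mass_finite
        proof eventually_elim
          case (elim t)
          show ?case
          proof (intro impI conjI)
            assume t: "\<tau> < t \<and> t < T'"
            then have "(t - \<tau>) powr (1 / \<theta>) \<le> R"
              unfolding R_def using \<tau> \<theta> by (intro powr_mono2) auto
            then show "ennreal (c * \<kappa>) + ennreal c * (\<integral>\<^sup>+s\<in>{\<tau><..<t}.
              ?g s \<partial>lborel) \<le> ball_mass v x0 R t"
              using ball_mass_inequality[of \<tau> t R x0] elim(1) t T' \<tau> c \<kappa> by (simp add: ennreal_mult)
          qed (use elim(2) \<tau> T' in auto)
        qed
        show "ennreal (\<omega> * r powr p) \<le> ?g s"
          if "0 \<le> r" "ennreal r \<le> ball_mass v x0 R s" for s r
          using ball_mass_growth[OF p v R that] by (simp add: \<omega>_def b_def V_def)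
        fix x y assume xy: "0 \<le> x" "x < y" "y < c * \<omega> * (T' - \<tau>)"
        have "x / (c * \<omega>) < y / (c * \<omega>)"
          using xy c \<omega> by (simp add: divide_strict_right_mono)
        moreover have "y / (c * \<omega>) < T' - \<tau>" "0 \<le> x / (c * \<omega>)"
          using xy c \<omega> by (auto simp: field_simps)
        moreover have "ennreal (y - x) \<le> ennreal c * (\<integral>\<^sup>+s\<in>{\<tau> + x / (c * \<omega>)<..<\<tau> + y / (c * \<omega>)}. ennreal \<omega> \<partial>lborel)"
        proof -
          have "(\<integral>\<^sup>+s\<in>{\<tau> + x / (c * \<omega>)<..<\<tau> + y / (c * \<omega>)}. ennreal \<omega> \<partial>lborel) = ennreal (\<omega> * (y / (c * \<omega>) - x / (c * \<omega>)))"
            using \<open>x / (c * \<omega>) < y / (c * \<omega>)\<close> \<omega> by (simp add: nn_integral_cmult_indicator ennreal_mult)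
          also have "\<omega> * (y / (c * \<omega>) - x / (c * \<omega>)) = (y - x) / c"
            using \<omega> c by (simp add: field_simps)
          finally show ?thesis using c xy by (simp add: ennreal_mult[symmetric])
        qed
        ultimately show "\<tau> \<le> \<tau> + x / (c * \<omega>) \<and> \<tau> + x / (c * \<omega>) < \<tau> + y / (c * \<omega>) \<and> \<tau> + y / (c * \<omega>) < T' \<and>
          ennreal (y - x) \<le> ennreal c * (\<integral>\<^sup>+s\<in>{\<tau> + x / (c * \<omega>)<..<\<tau> + y / (c * \<omega>)}. ennreal \<omega> \<partial>lborel)"
          by auto
      qed (use p c \<omega> \<open>\<kappa> > 0\<close> in auto)
      then have "c * \<kappa> \<le> (D * (c * \<omega> * (T' - \<tau>))) powr (- 1 / (p - 1))"
        using p c \<omega> \<tau>T D \<open>\<kappa> > 0\<close> by (intro blowup_invert) (auto simp: D_def)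
      \<comment> \<open>As \<tau> < T'/2, at least the time T'/2 remains for blow-up; this is the
        factor 1/2 in the constant.\<close>
      also have "\<dots> \<le> (D * c / 2 * \<omega> * T') powr (- 1 / (p - 1))"
        using p c \<omega> D T' \<tau> by (intro powr_mono2') (auto simp: field_simps)
      also have "\<dots> = (D * c / 2) powr (- 1 / (p - 1)) * \<omega> powr (- 1 / (p - 1)) * T' powr (- 1 / (p - 1))"
        using c \<omega> D T' powr_mult[of "D * c / 2 * \<omega>" T'] powr_mult[of "D * c / 2" \<omega>] by simp
      also have "\<omega> powr (- 1 / (p - 1)) = b"
      proof -
        have "(1 - p) * (- 1 / (p - 1)) = 1" using p by (simp add: field_simps)
        then show ?thesis using b by (simp add: \<omega>_def powr_powr)
      qed
      also have "b = V * T' powr (real CARD('n) / \<theta>)"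
        using R T' by (simp add: b_def powr_realpow[symmetric] R_def powr_powr)
      finally have "c * \<kappa> \<le> (D * c / 2) powr (- 1 / (p - 1)) * V * (T' powr (real CARD('n) / \<theta>) * T' powr (- 1 / (p - 1)))"
        by (simp add: mult_ac)
      also have "T' powr (real CARD('n) / \<theta>) * T' powr (- 1 / (p - 1)) = T' powr (real CARD('n) / \<theta> - 1 / (p - 1))"
        by (simp add: powr_add[symmetric])
      finally show ?thesis using c by (simp add: C_def field_simps)
    qed
    then show "ball_mass v x0 (T' powr (1 / \<theta>)) \<tau> \<le> ennreal (unit_ball_vol (real CARD('n)) / c
        * ((1 - 2 powr (1 - p)) * c / 2) powr (- 1 / (p - 1)) * T' powr (real CARD('n) / \<theta> - 1 / (p - 1)))"
      using \<kappa> unfolding R_def C_def V_def D_def by (simp add: ennreal_leI)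
  qed
qed

text \<open>The argument starts at a = \<sigma>^\<theta>, from which time on the ball of radius
  t^(1/\<theta>) contains the one of radius \<sigma>. The balls are nested, so the inequality at
  time t on its own large ball also controls the source on the smaller balls of all earlier times.
  The weight w/s has the integral w ln(T/a) over (a, T), which is the source of the
  logarithm.\<close>

lemma ball_mass_log_bound:
  assumes crit: "p = 1 + \<theta> / real CARD('n)" and \<sigma>: "0 < \<sigma>" "\<sigma> powr \<theta> < T"
  shows "AE \<tau> in lborel. 0 < \<tau> \<and> \<tau> < \<sigma> powr \<theta> \<longrightarrow> (\<forall>x0. ball_mass v x0 \<sigma> \<tau>
    \<le> ennreal (((1 - 2 powr (1 - p)) * c * unit_ball_vol (real CARD('n)) powr (1 - p)) powr (- 1 / (p - 1)) / c
        * ln (T / \<sigma> powr \<theta>) powr (- 1 / (p - 1))))"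
  using sup ball_mass_finite
proof eventually_elim
  case (elim \<tau>)
  show ?case
  proof (intro impI allI)
    fix x0 :: "real ^ 'n" assume \<tau>: "0 < \<tau> \<and> \<tau> < \<sigma> powr \<theta>"
    have [measurable]: "v \<in> borel_measurable (borel \<Otimes>\<^sub>M borel)" using v by (simp add: borel_prod)
    define a where "a = \<sigma> powr \<theta>"
    have a: "0 < a" "a < T" "a powr (1 / \<theta>) = \<sigma>" using \<sigma> \<theta> by (auto simp: a_def powr_powr)
    define V where "V = unit_ball_vol (real CARD('n))"
    have V: "V > 0" by (simp add: V_def)
    define D where "D = 1 - (2::real) powr (1 - p)"
    have D: "D > 0" using p powr_less_mono[of "1 - p" 0 2] by (simp add: D_def)
    define \<kappa> where "\<kappa> = enn2real (ball_mass v x0 \<sigma> \<tau>)"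
    have \<kappa>: "ball_mass v x0 \<sigma> \<tau> = ennreal \<kappa>" "0 \<le> \<kappa>"
      using elim(2) \<tau> \<sigma> by (auto simp: \<kappa>_def less_top)
    have lnT: "ln (T / a) > 0" using a by simp
    define w where "w = V powr (1 - p)"
    have w: "w > 0" using V by (simp add: w_def)
    \<comment> \<open>The moving ball is written through \<open>dist\<close> so that the integrand
      is visibly measurable in y and s jointly.\<close>
    define g where "g s = (\<integral>\<^sup>+y. ennreal_powr (v (y, s)) p * (if dist x0 y < s powr (1 / \<theta>) then 1 else 0) \<partial>lborel)" for s
    have g_eq: "g s = (\<integral>\<^sup>+y\<in>ball x0 (s powr (1 / \<theta>)). ennreal_powr (v (y, s)) p \<partial>lborel)" for s
      unfolding g_def by (intro nn_integral_cong) (auto simp: indicator_def)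
    have gm [measurable]: "g \<in> borel_measurable borel"
      unfolding g_def by measurable
    have "\<kappa> \<le> (D * c * w) powr (- 1 / (p - 1)) / c * ln (T / a) powr (- 1 / (p - 1))"
    proof (cases "\<kappa> = 0")
      case True
      then show ?thesis using c by simp
    next
      case False
      then have "\<kappa> > 0" using \<kappa> by simp
      have "c * w * ln (T / a) \<le> (c * \<kappa>) powr (1 - p) / (1 - 2 powr (1 - p))"
      \<comment> \<open>The time change solves c w ln(\<psi>(x)/a) = x, and it reaches T at x = c w
        ln(T/a).\<close>
      proof (rule blowup_estimate[where a = a and b = T and c = c and k = "\<lambda>t. ball_mass v x0 (t powr (1 / \<theta>)) t"
            and g = g and \<omega> = "\<lambda>s. w / s" and \<psi> = "\<lambda>x. a * exp (x / (c * w))", OF p _ gm])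
        show "AE t in lborel. a < t \<and> t < T \<longrightarrow>
          ennreal (c * \<kappa>) + ennreal c * (\<integral>\<^sup>+s\<in>{a<..<t}. g s \<partial>lborel) \<le> ball_mass v x0 (t powr (1 / \<theta>)) t \<and>
          ball_mass v x0 (t powr (1 / \<theta>)) t < \<infinity>"
          using elim(1) ball_mass_finite
        proof eventually_elim
          case (elim t)
          show ?case
          proof (intro impI conjI)
            assume t: "a < t \<and> t < T"
            define R where "R = t powr (1 / \<theta>)"
            have tR: "(t - \<tau>) powr (1 / \<theta>) \<le> R"
              unfolding R_def using \<tau> t \<theta> by (intro powr_mono2) (auto simp: a_def)
            have \<sigma>R: "\<sigma> \<le> R"
              unfolding R_def a(3)[symmetric] using t \<theta> a by (intro powr_mono2) auto
            have "ennreal (c * \<kappa>) = ennreal c * ball_mass v x0 \<sigma> \<tau>"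
              using c \<kappa> by (simp add: ennreal_mult)
            also have "\<dots> \<le> ennreal c * ball_mass v x0 R \<tau>"
              using \<sigma>R by (intro mult_left_mono ball_mass_mono) auto
            finally have 1: "ennreal (c * \<kappa>) \<le> ennreal c * ball_mass v x0 R \<tau>" .
            have 2: "(\<integral>\<^sup>+s\<in>{a<..<t}. g s \<partial>lborel)
              \<le> (\<integral>\<^sup>+s\<in>{\<tau><..<t}. (\<integral>\<^sup>+y\<in>ball x0 R. ennreal_powr (v (y, s)) p \<partial>lborel) \<partial>lborel)"
            proof (rule nn_integral_mono)
              fix s
              show "g s * indicator {a<..<t} s
                \<le> (\<integral>\<^sup>+y\<in>ball x0 R. ennreal_powr (v (y, s)) p \<partial>lborel) * indicator {\<tau><..<t} s"
              proof (cases "a < s \<and> s < t")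
                case True
                then have "s powr (1 / \<theta>) \<le> R"
                  unfolding R_def using a \<theta> by (intro powr_mono2) auto
                then have "g s \<le> (\<integral>\<^sup>+y\<in>ball x0 R. ennreal_powr (v (y, s)) p \<partial>lborel)"
                  unfolding g_eq by (intro nn_integral_mono) (auto split: split_indicator)
                then show ?thesis using True \<tau> by (simp add: a_def)
              qed auto
            qed
            show "ennreal (c * \<kappa>) + ennreal c * (\<integral>\<^sup>+s\<in>{a<..<t}. g s \<partial>lborel) \<le> ball_mass v x0 (t powr (1 / \<theta>)) t"
              using add_mono[OF 1 mult_left_mono[OF 2, of "ennreal c"]]
                ball_mass_inequality[of \<tau> t R x0] elim(1) t \<tau> tR
              by (auto simp: R_def a_def intro: order_trans)
          qed (use elim(2) a in auto)
        qed
        show "ennreal (w / s * r powr p) \<le> g s"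
          if s: "a < s" and r: "0 \<le> r" "ennreal r \<le> ball_mass v x0 (s powr (1 / \<theta>)) s" for s r
        proof -
          have s0: "0 < s" using s a by simp
          have "(V * (s powr (1 / \<theta>)) ^ CARD('n)) powr (1 - p) = w * s powr (real CARD('n) / \<theta> * (1 - p))"
            using s0 V by (simp add: w_def powr_mult powr_realpow[symmetric] powr_powr)
          \<comment> \<open>Criticality enters here: the volume of the ball of radius
            s^(1/\<theta>), raised to 1 - p, is exactly a multiple of 1/s.\<close>
          also have "real CARD('n) / \<theta> * (1 - p) = -1"
            using crit \<theta> by simp
          also have "w * s powr - 1 = w / s" using s0 by (simp add: powr_minus_divide)
          finally show ?thesis
            using ball_mass_growth[OF p v _ r] s0 by (simp add: g_eq V_def)
        qed
        show "(\<lambda>s. w / s) \<in> borel_measurable borel" by measurable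
        fix x y assume xy: "0 \<le> x" "x < y" "y < c * w * ln (T / a)"
        let ?s = "a * exp (x / (c * w))" and ?t = "a * exp (y / (c * w))"
        have lt: "x / (c * w) < y / (c * w)"
          using xy c w by (simp add: divide_strict_right_mono)
        then have st: "?s < ?t" using a by simp
        have "y / (c * w) < ln (T / a)" using xy c w by (simp add: field_simps)
        then have "exp (y / (c * w)) < T / a"
          using a by (metis divide_pos_pos exp_less_cancel_iff exp_ln less_trans)
        then have tT: "?t < T" using a by (simp add: field_simps)
        have "0 \<le> x / (c * w)" using xy c w by simp
        then have as: "a \<le> ?s" using a by simp
        have "(\<integral>\<^sup>+s\<in>{?s<..<?t}. ennreal (w / s) \<partial>lborel) = (\<integral>\<^sup>+s\<in>{?s..?t}. ennreal (w / s) \<partial>lborel)"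
        proof (rule nn_integral_cong_AE)
          show "AE s in lborel. ennreal (w / s) * indicator {?s<..<?t} s = ennreal (w / s) * indicator {?s..?t} s"
            using AE_lborel_singleton[of ?s] AE_lborel_singleton[of ?t]
            by eventually_elim (auto split: split_indicator)
        qed
        also have "\<dots> = ennreal (w * ln ?t - w * ln ?s)"
        proof (rule nn_integral_FTC_Icc)
          show "((\<lambda>s. w * ln s) has_real_derivative w / s) (at s)" if "s \<in> {?s..?t}" for s
            using less_le_trans[OF a(1) order_trans[OF as, of s]] that by (auto intro!: derivative_eq_intros)
          show "0 \<le> w / s" if "s \<in> {?s..?t}" for s
            using less_le_trans[OF a(1) order_trans[OF as, of s]] that w by simp
        qed (use st as a w in auto)
        also have "w * ln ?t - w * ln ?s = (y - x) / c"
          using a c w by (simp add: ln_mult field_simps)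
        finally have "ennreal c * (\<integral>\<^sup>+s\<in>{?s<..<?t}. ennreal (w / s) \<partial>lborel) = ennreal (y - x)"
          using c xy by (simp add: ennreal_mult[symmetric])
        then show "a \<le> ?s \<and> ?s < ?t \<and> ?t < T \<and> ennreal (y - x) \<le> ennreal c * (\<integral>\<^sup>+s\<in>{?s<..<?t}. ennreal (w / s) \<partial>lborel)"
          using as st tT by simp
      qed (use c w a \<open>\<kappa> > 0\<close> in auto)
      then have "c * \<kappa> \<le> (D * (c * w * ln (T / a))) powr (- 1 / (p - 1))"
        using p c w lnT D \<open>\<kappa> > 0\<close> by (intro blowup_invert) (auto simp: D_def)
      also have "\<dots> = (D * c * w) powr (- 1 / (p - 1)) * ln (T / a) powr (- 1 / (p - 1))"
        using c w D lnT powr_mult[of "D * c * w" "ln (T / a)"] by (simp add: mult_ac)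
      finally show ?thesis using c by (simp add: field_simps)
    qed
    then show "ball_mass v x0 \<sigma> \<tau>
      \<le> ennreal (((1 - 2 powr (1 - p)) * c * unit_ball_vol (real CARD('n)) powr (1 - p)) powr (- 1 / (p - 1)) / c
        * ln (T / \<sigma> powr \<theta>) powr (- 1 / (p - 1)))"
      using \<kappa> unfolding a_def w_def V_def D_def by (simp add: ennreal_leI)
  qed
qed

end

section \<open>The initial trace\<close>

text \<open>The exceptional set on the right may depend on \<epsilon>. Taking \<epsilon> = 1/(n+1),
  the countable union of these sets is one null set that serves for all.\<close>

lemma ess_lim_at_0_iff:
  "ess_lim_at_0 F L \<longleftrightarrow> (\<forall>\<epsilon>>0. \<exists>\<delta>>0. AE t in lborel. 0 < t \<and> t < \<delta> \<longrightarrow> \<bar>F t - L\<bar> < \<epsilon>)"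
proof
  assume "ess_lim_at_0 F L"
  then obtain Z where Z: "Z \<in> null_sets lebesgue" "(F \<longlongrightarrow> L) (at 0 within ({0<..} - Z))"
    unfolding ess_lim_at_0_def by blast
  have AEZ: "AE t in lborel. t \<notin> Z"
    using AE_not_in[OF Z(1)] by (simp add: AE_completion_iff)
  show "\<forall>\<epsilon>>0. \<exists>\<delta>>0. AE t in lborel. 0 < t \<and> t < \<delta> \<longrightarrow> \<bar>F t - L\<bar> < \<epsilon>"
  proof (intro allI impI)
    fix \<epsilon> :: real assume "0 < \<epsilon>"
    then have "\<forall>\<^sub>F t in at 0 within ({0<..} - Z). dist (F t) L < \<epsilon>" by (rule tendstoD[OF Z(2)])
    then obtain \<delta> where \<delta>: "\<delta> > 0" "\<forall>t\<in>{0<..} - Z. t \<noteq> 0 \<and> dist t 0 < \<delta> \<longrightarrow> dist (F t) L < \<epsilon>"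
      unfolding eventually_at by auto
    have "AE t in lborel. 0 < t \<and> t < \<delta> \<longrightarrow> \<bar>F t - L\<bar> < \<epsilon>"
      using AEZ by (rule eventually_mono) (use \<delta>(2) in \<open>auto simp: dist_real_def\<close>)
    with \<delta>(1) show "\<exists>\<delta>>0. AE t in lborel. 0 < t \<and> t < \<delta> \<longrightarrow> \<bar>F t - L\<bar> < \<epsilon>" by blast
  qed
next
  assume *: "\<forall>\<epsilon>>0. \<exists>\<delta>>0. AE t in lborel. 0 < t \<and> t < \<delta> \<longrightarrow> \<bar>F t - L\<bar> < \<epsilon>"
  have "\<exists>\<delta>. 0 < \<delta> \<and> (AE t in lborel. 0 < t \<and> t < \<delta> \<longrightarrow> \<bar>F t - L\<bar> < 1 / real (Suc n))" for n
    using *[rule_format, of "1 / real (Suc n)"] by auto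
  then obtain d where d: "\<And>n. 0 < d n" "\<And>n. AE t in lborel. 0 < t \<and> t < d n \<longrightarrow> \<bar>F t - L\<bar> < 1 / real (Suc n)"
    by metis
  have "AE t in lborel. \<forall>n. 0 < t \<and> t < d n \<longrightarrow> \<bar>F t - L\<bar> < 1 / real (Suc n)"
    using d(2) by (simp add: AE_all_countable)
  then obtain Z where Z: "Z \<in> null_sets lborel"
    "\<And>t n. t \<notin> Z \<Longrightarrow> 0 < t \<Longrightarrow> t < d n \<Longrightarrow> \<bar>F t - L\<bar> < 1 / real (Suc n)"
    unfolding eventually_ae_filter by auto
  have "(F \<longlongrightarrow> L) (at 0 within ({0<..} - Z))"
  proof (rule tendstoI)
    fix e :: real assume "0 < e"
    then obtain n where n: "1 / real (Suc n) < e" using nat_approx_posE by blast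
    show "\<forall>\<^sub>F t in at 0 within ({0<..} - Z). dist (F t) L < e"
      unfolding eventually_at
    proof (intro exI[of _ "d n"] conjI ballI impI)
      fix t assume "t \<in> {0<..} - Z" "t \<noteq> 0 \<and> dist t 0 < d n"
      then show "dist (F t) L < e" using Z(2)[of t n] n by (simp add: dist_real_def)
    qed (rule d)
  qed
  then show "ess_lim_at_0 F L"
    unfolding ess_lim_at_0_def using null_sets_completionI[OF Z(1)] by blast
qed

lemma ess_lim_at_0_le:
  assumes "ess_lim_at_0 F L" "0 < \<delta>" "AE t in lborel. 0 < t \<and> t < \<delta> \<longrightarrow> F t \<le> C"
  shows "L \<le> C"
proof (rule field_le_epsilon)
  fix \<epsilon> :: real assume "0 < \<epsilon>"
  then obtain d where d: "d > 0" "AE t in lborel. 0 < t \<and> t < d \<longrightarrow> \<bar>F t - L\<bar> < \<epsilon>"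
    using assms(1) unfolding ess_lim_at_0_iff by blast
  have "AE t in lborel. (0 < t \<and> t < d \<longrightarrow> \<bar>F t - L\<bar> < \<epsilon>) \<and> (0 < t \<and> t < \<delta> \<longrightarrow> F t \<le> C)"
    using d(2) assms(3) by eventually_elim blast
  from AE_lborel_ex_between[OF this, of 0 "min d \<delta>"] d(1) assms(2)
  obtain t where "0 < t" "t < min d \<delta>" "(0 < t \<and> t < d \<longrightarrow> \<bar>F t - L\<bar> < \<epsilon>) \<and> (0 < t \<and> t < \<delta> \<longrightarrow> F t \<le> C)"
    by auto
  then show "L \<le> C + \<epsilon>" by auto
qed

lemma ess_lim_at_0_cong:
  assumes "0 < \<delta>" "AE t in lborel. 0 < t \<and> t < \<delta> \<longrightarrow> F t = H t" and F: "ess_lim_at_0 F L"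
  shows "ess_lim_at_0 H L"
  unfolding ess_lim_at_0_iff
proof (intro allI impI)
  fix \<epsilon> :: real assume "0 < \<epsilon>"
  then obtain d where d: "d > 0" "AE t in lborel. 0 < t \<and> t < d \<longrightarrow> \<bar>F t - L\<bar> < \<epsilon>"
    using F unfolding ess_lim_at_0_iff by blast
  show "\<exists>\<delta>>0. AE t in lborel. 0 < t \<and> t < \<delta> \<longrightarrow> \<bar>H t - L\<bar> < \<epsilon>"
  proof (intro exI[of _ "min d \<delta>"] conjI)
    show "AE t in lborel. 0 < t \<and> t < min d \<delta> \<longrightarrow> \<bar>H t - L\<bar> < \<epsilon>"
      using d(2) assms(2) by eventually_elim auto
  qed (use d assms in auto)
qed

lemma ess_lim_at_0_add:
  assumes "ess_lim_at_0 F L" "ess_lim_at_0 H M"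
  shows "ess_lim_at_0 (\<lambda>t. F t + H t) (L + M)"
proof -
  obtain Z Y where Z: "Z \<in> null_sets lebesgue" "(F \<longlongrightarrow> L) (at 0 within ({0<..} - Z))"
    and Y: "Y \<in> null_sets lebesgue" "(H \<longlongrightarrow> M) (at 0 within ({0<..} - Y))"
    using assms unfolding ess_lim_at_0_def by blast
  show ?thesis
    unfolding ess_lim_at_0_def
  proof (intro bexI[of _ "Z \<union> Y"] tendsto_add)
    show "(F \<longlongrightarrow> L) (at 0 within ({0<..} - (Z \<union> Y)))"
      by (rule tendsto_within_subset[OF Z(2)]) auto
    show "(H \<longlongrightarrow> M) (at 0 within ({0<..} - (Z \<union> Y)))"
      by (rule tendsto_within_subset[OF Y(2)]) auto
  qed (use Z Y in auto)
qed

lemma ess_lim_at_0_cmult: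
  assumes "ess_lim_at_0 F L" shows "ess_lim_at_0 (\<lambda>t. c * F t) (c * L)"
  using assms unfolding ess_lim_at_0_def by (auto intro!: tendsto_intros)

text \<open>\<open>F - F\<close> has the essential limits L - M and M - L and is at most 0, so both
  differences are at most 0.\<close>

lemma ess_lim_at_0_unique:
  assumes "ess_lim_at_0 F L" "ess_lim_at_0 F M" shows "L = M"
proof -
  have "ess_lim_at_0 (\<lambda>t. F t + - 1 * F t) (L + - 1 * M)" "ess_lim_at_0 (\<lambda>t. F t + - 1 * F t) (M + - 1 * L)"
    using assms by (intro ess_lim_at_0_add ess_lim_at_0_cmult; simp)+
  from this[THEN ess_lim_at_0_le, of 1 0] show ?thesis by simp
qed

text \<open>The essential upper limit is a limit, because \<open>F\<close> is essentially almost increasing near \<open>0\<close>.\<close>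

lemma ess_lim_at_0_exists:
  fixes F :: "real \<Rightarrow> real"
  assumes nonneg: "\<And>t. 0 \<le> F t"
    and incr: "\<And>\<epsilon>. 0 < \<epsilon> \<Longrightarrow> \<exists>\<delta>>0. AE t in lborel. 0 < t \<and> t < \<delta> \<longrightarrow> (AE \<tau> in lborel. 0 < \<tau> \<and> \<tau> < t \<longrightarrow> F \<tau> \<le> F t + \<epsilon>)"
  shows "\<exists>L. ess_lim_at_0 F L"
proof -
  \<comment> \<open>The essential upper bounds of \<open>F\<close> near 0; their infimum is the
    essential upper limit.\<close>
  define S where "S = {a. \<exists>\<delta>>0. AE \<tau> in lborel. 0 < \<tau> \<and> \<tau> < \<delta> \<longrightarrow> F \<tau> \<le> a}"
  have S_pos: "0 \<le> a" if aS: "a \<in> S" for a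
  proof -
    obtain \<delta> where \<delta>: "\<delta> > 0" "AE \<tau> in lborel. 0 < \<tau> \<and> \<tau> < \<delta> \<longrightarrow> F \<tau> \<le> a"
      using aS by (auto simp: S_def)
    obtain \<tau> where "F \<tau> \<le> a" using AE_lborel_ex_between[OF \<delta>(2,1)] by auto
    then show ?thesis using nonneg[of \<tau>] by linarith
  qed
  then have bdd: "bdd_below S" by (auto simp: bdd_below_def)
  have inS: "F t + \<epsilon> \<in> S" if "0 < t" "AE \<tau> in lborel. 0 < \<tau> \<and> \<tau> < t \<longrightarrow> F \<tau> \<le> F t + \<epsilon>" for t \<epsilon>
    using that by (auto simp: S_def)
  obtain \<delta>1 where \<delta>1: "\<delta>1 > 0" "AE t in lborel. 0 < t \<and> t < \<delta>1 \<longrightarrow> (AE \<tau> in lborel. 0 < \<tau> \<and> \<tau> < t \<longrightarrow> F \<tau> \<le> F t + 1)"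
    using incr[of 1] by auto
  obtain t where "0 < t" "AE \<tau> in lborel. 0 < \<tau> \<and> \<tau> < t \<longrightarrow> F \<tau> \<le> F t + 1"
    using AE_lborel_ex_between[OF \<delta>1(2,1)] by auto
  then have "S \<noteq> {}" using inS by blast
  have "ess_lim_at_0 F (Inf S)"
    unfolding ess_lim_at_0_iff
  proof (intro allI impI)
    fix \<epsilon> :: real assume \<epsilon>: "0 < \<epsilon>"
    obtain \<delta> where \<delta>: "\<delta> > 0" "AE t in lborel. 0 < t \<and> t < \<delta> \<longrightarrow> (AE \<tau> in lborel. 0 < \<tau> \<and> \<tau> < t \<longrightarrow> F \<tau> \<le> F t + \<epsilon> / 2)"
      using incr[of "\<epsilon> / 2"] \<epsilon> by auto
    obtain a where "a \<in> S" "a < Inf S + \<epsilon>"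
      using cInf_lessD[OF \<open>S \<noteq> {}\<close>, of "Inf S + \<epsilon>"] \<epsilon> by auto
    then obtain d where d: "d > 0" "AE t in lborel. 0 < t \<and> t < d \<longrightarrow> F t \<le> a"
      by (auto simp: S_def)
    show "\<exists>\<delta>>0. AE t in lborel. 0 < t \<and> t < \<delta> \<longrightarrow> \<bar>F t - Inf S\<bar> < \<epsilon>"
    proof (intro exI[of _ "min d \<delta>"] conjI)
      show "AE t in lborel. 0 < t \<and> t < min d \<delta> \<longrightarrow> \<bar>F t - Inf S\<bar> < \<epsilon>"
        using d(2) \<delta>(2)
      proof eventually_elim
        case (elim t)
        show ?case
        proof
          assume t: "0 < t \<and> t < min d \<delta>"
          then have "Inf S \<le> F t + \<epsilon> / 2"
            using elim(2) by (intro cInf_lower[OF inS bdd]) auto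
          moreover have "F t < Inf S + \<epsilon>" using elim(1) t \<open>a < Inf S + \<epsilon>\<close> by auto
          ultimately show "\<bar>F t - Inf S\<bar> < \<epsilon>" using \<epsilon> by auto
        qed
      qed
    qed (use d \<delta> in auto)
  qed
  then show ?thesis by blast
qed

section \<open>Pairings of a solution with nonnegative test functions\<close>

definition pairing :: "('a::euclidean_space \<times> real \<Rightarrow> ennreal) \<Rightarrow> ('a \<Rightarrow> real) \<Rightarrow> real \<Rightarrow> ennreal" where
  "pairing v \<phi> t = (\<integral>\<^sup>+y. ennreal (\<phi> y) * v (y, t) \<partial>lborel)"

lemma pairing_le_ball_mass:
  fixes v :: "'a::euclidean_space \<times> real \<Rightarrow> ennreal"
  assumes v: "v \<in> borel_measurable borel" and le: "\<And>x. \<phi> x \<le> B" "0 \<le> B" and off: "\<And>x. x \<notin> ball x0 R \<Longrightarrow> \<phi> x = 0"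
  shows "pairing v \<phi> t \<le> ennreal B * ball_mass v x0 R t"
proof -
  have [measurable]: "v \<in> borel_measurable (borel \<Otimes>\<^sub>M borel)" using v by (simp add: borel_prod)
  have [measurable]: "ball x0 R \<in> sets borel" by simp
  have "pairing v \<phi> t \<le> (\<integral>\<^sup>+y. ennreal B * (v (y, t) * indicator (ball x0 R) y) \<partial>lborel)"
    unfolding pairing_def using le off
    by (intro nn_integral_mono) (auto split: split_indicator intro!: mult_right_mono ennreal_leI)
  also have "\<dots> = ennreal B * ball_mass v x0 R t"
    unfolding ball_mass_def by (rule nn_integral_cmult) measurable
  finally show ?thesis .
qed

lemma pairing_finite:
  fixes v :: "'a::euclidean_space \<times> real \<Rightarrow> ennreal"
  assumes v: "v \<in> borel_measurable borel" and \<phi>: "cc_nonneg \<phi>" and fin: "\<And>x0 R. ball_mass v x0 R t < \<infinity>"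
  shows "pairing v \<phi> t < \<infinity>"
proof -
  obtain K where K: "compact K" "\<And>x. x \<notin> K \<Longrightarrow> \<phi> x = 0" using \<phi> by (metis cc_nonneg_support)
  obtain R where R: "K \<subseteq> ball 0 R"
    using compact_imp_bounded[OF K(1)] bounded_subset_ballD by blast
  obtain B where B: "\<And>x. \<phi> x \<le> B" "0 < B" using \<phi> by (metis cc_nonneg_bounded)
  have "\<phi> x = 0" if "x \<notin> ball 0 R" for x using that K(2) R by blast
  then have "pairing v \<phi> t \<le> ennreal B * ball_mass v 0 R t"
    using B by (intro pairing_le_ball_mass[OF v]) (auto simp: less_imp_le)
  also have "\<dots> < \<infinity>" using fin by (simp add: ennreal_mult_less_top)
  finally show ?thesis .
qed

lemma pairing_add:
  fixes v :: "'a::euclidean_space \<times> real \<Rightarrow> ennreal"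
  assumes v: "v \<in> borel_measurable borel" and "cc_nonneg \<phi>" "cc_nonneg \<psi>"
  shows "pairing v (\<lambda>x. \<phi> x + \<psi> x) t = pairing v \<phi> t + pairing v \<psi> t"
proof -
  have [measurable]: "v \<in> borel_measurable (borel \<Otimes>\<^sub>M borel)" using v by (simp add: borel_prod)
  have [measurable]: "\<phi> \<in> borel_measurable borel" "\<psi> \<in> borel_measurable borel"
    using assms by (auto intro!: borel_measurable_continuous_onI cc_nonneg_continuous)
  show ?thesis
    unfolding pairing_def using assms(2,3)
    by (subst nn_integral_add[symmetric]) (auto simp: cc_nonneg_nonneg distrib_right)
qed

lemma pairing_scale:
  fixes v :: "'a::euclidean_space \<times> real \<Rightarrow> ennreal"
  assumes v: "v \<in> borel_measurable borel" and "cc_nonneg \<phi>" "0 < c"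
  shows "pairing v (\<lambda>x. c * \<phi> x) t = ennreal c * pairing v \<phi> t"
proof -
  have [measurable]: "v \<in> borel_measurable (borel \<Otimes>\<^sub>M borel)" using v by (simp add: borel_prod)
  have [measurable]: "\<phi> \<in> borel_measurable borel"
    using assms by (auto intro!: borel_measurable_continuous_onI cc_nonneg_continuous)
  show ?thesis
    unfolding pairing_def using assms(2,3)
    by (subst nn_integral_cmult[symmetric]) (auto simp: cc_nonneg_nonneg ennreal_mult mult.assoc)
qed

text \<open>\<open>enn2real\<close> sends \<infinity> to 0, which would lose mass. Finiteness of the
  pairing excludes this: it forces v to be finite at almost every point where \<phi> is
  positive.\<close>

lemma pairing_lebesgue:
  fixes v :: "'a::euclidean_space \<times> real \<Rightarrow> ennreal" and u :: "'a \<Rightarrow> real \<Rightarrow> ennreal"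
  assumes v: "v \<in> borel_measurable borel" and \<phi>: "cc_nonneg \<phi>" and fin: "\<And>x0 R. ball_mass v x0 R t < \<infinity>"
    and uv: "AE y in lborel. u y t = v (y, t)"
  shows "integrable lebesgue (\<lambda>y. enn2real (u y t) * \<phi> y)"
    and "(\<integral>y. enn2real (u y t) * \<phi> y \<partial>lebesgue) = enn2real (pairing v \<phi> t)"
proof -
  have [measurable]: "v \<in> borel_measurable (borel \<Otimes>\<^sub>M borel)" using v by (simp add: borel_prod)
  have [measurable]: "\<phi> \<in> borel_measurable borel"
    using \<phi> by (auto intro!: borel_measurable_continuous_onI cc_nonneg_continuous)
  have \<phi>0: "0 \<le> \<phi> y" for y using \<phi> by (rule cc_nonneg_nonneg)
  have "(\<lambda>y. enn2real (v (y, t)) * \<phi> y) \<in> borel_measurable lborel" by measurable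
  then have "(\<lambda>y. enn2real (v (y, t)) * \<phi> y) \<in> borel_measurable lebesgue"
    by (rule measurable_completion)
  moreover have ae: "AE y in lebesgue. enn2real (v (y, t)) * \<phi> y = enn2real (u y t) * \<phi> y"
    using uv by (intro AE_completion) (auto elim!: eventually_mono)
  ultimately have m: "(\<lambda>y. enn2real (u y t) * \<phi> y) \<in> borel_measurable lebesgue"
    by (rule borel_measurable_AE)
  have fin': "pairing v \<phi> t < \<infinity>" by (rule pairing_finite[OF v \<phi> fin])
  then have pinf: "AE y in lborel. ennreal (\<phi> y) * v (y, t) \<noteq> \<infinity>"
    unfolding pairing_def by (intro nn_integral_PInf_AE) auto
  have nn: "(\<integral>\<^sup>+y. ennreal (enn2real (u y t) * \<phi> y) \<partial>lebesgue) = pairing v \<phi> t"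
    unfolding pairing_def nn_integral_completion
  proof (rule nn_integral_cong_AE, use uv pinf in eventually_elim)
    case (elim y)
    show ?case
    proof (cases "\<phi> y = 0")
      case False
      then have "v (y, t) \<noteq> \<infinity>" using elim \<phi>0[of y] by (auto simp: ennreal_mult_eq_top_iff)
      then show ?thesis
        using elim(1) \<phi>0[of y] by (simp add: ennreal_mult less_top mult.commute)
    qed simp
  qed
  have nonneg: "AE y in lebesgue. 0 \<le> enn2real (u y t) * \<phi> y"
    using \<phi>0 by simp
  show "integrable lebesgue (\<lambda>y. enn2real (u y t) * \<phi> y)"
    using fin' by (intro integrableI_nn_integral_finite[OF m nonneg, of "enn2real (pairing v \<phi> t)"])
      (simp add: nn less_top)
  show "(\<integral>y. enn2real (u y t) * \<phi> y \<partial>lebesgue) = enn2real (pairing v \<phi> t)"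
    using integral_eq_nn_integral[OF m nonneg] by (simp add: nn)
qed

context
  fixes \<theta> p c T :: real and G :: "real ^ 'n \<Rightarrow> real \<Rightarrow> real" and v :: "(real ^ 'n) \<times> real \<Rightarrow> ennreal"
  assumes G: "fundamental_solution \<theta> G" and \<theta>: "0 < \<theta>" and p: "1 < p" and T: "0 < T"
    and v [measurable]: "v \<in> borel_measurable borel"
    and sup: "AE \<tau> in lborel. AE t in lborel. 0 < \<tau> \<longrightarrow> \<tau> < t \<longrightarrow> t < T \<longrightarrow> supersolution_at G p v \<tau> t"
    and sup': "AE t in lborel. AE \<tau> in lborel. 0 < \<tau> \<longrightarrow> \<tau> < t \<longrightarrow> t < T \<longrightarrow> supersolution_at G p v \<tau> t"
    and c: "0 < c" and cm: "\<forall>r R x0 y. 0 < r \<longrightarrow> r powr (1 / \<theta>) \<le> R \<longrightarrow> y \<in> ball x0 R \<longrightarrow>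
      ennreal c \<le> (\<integral>\<^sup>+x\<in>ball x0 R. ennreal (G (x - y) r) \<partial>lborel)"
begin

text \<open>For small r almost all kernel mass lies where \<phi> differs from
  \<open>\<phi> y\<close> by less than \<epsilon>/2. Since \<phi> \<ge> 0, the remaining mass can
  only add to the integral, so a lower bound uniform in y follows. Points with \<phi> y \<le>
  \<epsilon>/2 are covered by the additive error alone.\<close>

lemma kernel_smoothing_lower:
  assumes \<phi>: "cc_nonneg \<phi>" and \<epsilon>: "0 < \<epsilon>"
  shows "\<exists>r0>0. \<forall>r y. 0 < r \<and> r < r0 \<longrightarrow>
    ennreal (\<phi> y) \<le> (\<integral>\<^sup>+x. ennreal (\<phi> x) * ennreal (G (x - y) r) \<partial>lborel) + ennreal \<epsilon>"
proof -
  obtain K where K: "compact K" "\<And>x. x \<notin> K \<Longrightarrow> \<phi> x = 0" using \<phi> by (metis cc_nonneg_support)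
  obtain R where R: "K \<subseteq> ball 0 R"
    using compact_imp_bounded[OF K(1)] bounded_subset_ballD by blast
  obtain B where B: "\<And>x. \<phi> x \<le> B" "0 < B" using \<phi> by (metis cc_nonneg_bounded)
  have "uniformly_continuous_on (cball 0 (R + 1)) \<phi>"
    using cc_nonneg_continuous[OF \<phi>] by (intro compact_uniformly_continuous) (auto intro: continuous_on_subset)
  then obtain d where d: "d > 0" "\<And>x y. x \<in> cball 0 (R + 1) \<Longrightarrow> y \<in> cball 0 (R + 1) \<Longrightarrow> dist y x < d \<Longrightarrow> dist (\<phi> y) (\<phi> x) < \<epsilon> / 2"
    unfolding uniformly_continuous_on_def using \<epsilon> by (metis half_gt_zero)
  \<comment> \<open>The cap 1 keeps \<open>x\<close> in the ball of radius R + 1, where uniform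
    continuity is available.\<close>
  define \<eta> where "\<eta> = min d 1"
  have \<eta>: "\<eta> > 0" using d by (simp add: \<eta>_def)
  \<comment> \<open>Half of \<epsilon> is spent on the oscillation of \<phi>; the other half pays
    for the missing mass, which costs at most B times \<open>\<epsilon>2\<close>.\<close>
  define \<epsilon>2 where "\<epsilon>2 = min 1 (\<epsilon> / (2 * B))"
  have \<epsilon>2: "0 < \<epsilon>2" "\<epsilon>2 \<le> 1" "B * \<epsilon>2 \<le> \<epsilon> / 2"
    using \<epsilon> B(2) by (auto simp: \<epsilon>2_def min_def field_simps)
  obtain r0 where r0: "0 < r0"
    "\<And>r. 0 < r \<Longrightarrow> r < r0 \<Longrightarrow> ennreal (1 - \<epsilon>2) \<le> (\<integral>\<^sup>+z\<in>ball 0 \<eta>. ennreal (G z r) \<partial>lborel)"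
    using kernel_concentration[OF G \<theta> \<eta> \<epsilon>2(1)] by blast
  show ?thesis
  proof (intro exI[of _ r0] conjI r0 allI impI)
    fix r y assume r: "0 < r \<and> r < r0"
    have [measurable]: "(\<lambda>x. G x r) \<in> borel_measurable borel"
      using borel_measurable_kernel_slice[OF G \<theta>] r by blast
    have [measurable]: "ball 0 \<eta> \<in> sets (borel :: (real ^ 'n) measure)" by simp
    define a where "a = \<phi> y - \<epsilon> / 2"
    show "ennreal (\<phi> y) \<le> (\<integral>\<^sup>+x. ennreal (\<phi> x) * ennreal (G (x - y) r) \<partial>lborel) + ennreal \<epsilon>"
    proof (cases "a \<le> 0")
      case True
      then have "ennreal (\<phi> y) \<le> ennreal \<epsilon>" using \<epsilon> by (intro ennreal_leI) (simp add: a_def)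
      then show ?thesis by (rule add_increasing[rotated]) simp
    next
      case False
      then have a: "a > 0" by simp
      have "y \<in> K" using K(2)[of y] a \<epsilon> by (auto simp: a_def)
      then have y: "norm y < R" using R by auto
      have near: "a \<le> \<phi> x" if "x - y \<in> ball 0 \<eta>" for x
      proof -
        have xy: "dist x y < d" "dist x y < 1" using that by (auto simp: \<eta>_def dist_norm norm_minus_commute)
        have "norm x \<le> norm y + dist x y" by (metis dist_norm norm_triangle_sub)
        then have "dist (\<phi> x) (\<phi> y) < \<epsilon> / 2"
          using y xy by (intro d(2)) auto
        then show ?thesis by (simp add: a_def dist_real_def abs_if split: if_splits)
      qed
      have "ennreal (a * (1 - \<epsilon>2)) = ennreal a * ennreal (1 - \<epsilon>2)"
        using a \<epsilon>2 by (simp add: ennreal_mult)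
      also have "\<dots> \<le> ennreal a * (\<integral>\<^sup>+z\<in>ball 0 \<eta>. ennreal (G z r) \<partial>lborel)"
        using r0(2) r by (intro mult_left_mono) auto
      also have "\<dots> = (\<integral>\<^sup>+z. ennreal a * (ennreal (G z r) * indicator (ball 0 \<eta>) z) \<partial>lborel)"
        by (rule nn_integral_cmult[symmetric]) measurable
      also have "\<dots> = (\<integral>\<^sup>+x. ennreal a * (ennreal (G (- y + 1 *\<^sub>R x) r) * indicator (ball 0 \<eta>) (- y + 1 *\<^sub>R x)) \<partial>lborel)"
        by (subst nn_integral_lborel_affine[of 1 _ "- y"]) auto
      also have "\<dots> \<le> (\<integral>\<^sup>+x. ennreal (\<phi> x) * ennreal (G (x - y) r) \<partial>lborel)"
        using near by (intro nn_integral_mono) (auto split: split_indicator intro!: mult_right_mono ennreal_leI)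
      finally have 1: "ennreal (a * (1 - \<epsilon>2)) \<le> (\<integral>\<^sup>+x. ennreal (\<phi> x) * ennreal (G (x - y) r) \<partial>lborel)" .
      have "a * \<epsilon>2 \<le> B * \<epsilon>2" using B(1)[of y] \<epsilon> \<epsilon>2 by (intro mult_right_mono) (auto simp: a_def)
      moreover have "\<phi> y = a + \<epsilon> / 2" by (simp add: a_def)
      ultimately have "\<phi> y \<le> a * (1 - \<epsilon>2) + \<epsilon>" unfolding right_diff_distrib using \<epsilon>2(3) by linarith
      then have "ennreal (\<phi> y) \<le> ennreal (a * (1 - \<epsilon>2)) + ennreal \<epsilon>"
        using a \<epsilon>2 \<epsilon> by (simp add: ennreal_plus[symmetric] ennreal_leI del: ennreal_plus)
      also have "\<dots> \<le> (\<integral>\<^sup>+x. ennreal (\<phi> x) * ennreal (G (x - y) r) \<partial>lborel) + ennreal \<epsilon>"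
        using 1 by (rule add_right_mono)
      finally show ?thesis .
    qed
  qed
qed

text \<open>Mass at an early time cannot be large, because a fraction c of it is still in the ball
  at one fixed good time \<open>t0\<close>, where the mass is finite. The bound is uniform in
  \<tau>, as needed to absorb the smoothing error.\<close>

lemma ball_mass_locally_bounded:
  obtains t0 M where "0 < t0" "t0 < T" "0 < M" "T powr (1 / \<theta>) \<le> R \<Longrightarrow>
    AE \<tau> in lborel. 0 < \<tau> \<and> \<tau> < t0 \<longrightarrow> ball_mass v 0 R \<tau> \<le> ennreal M"
proof -
  have "AE t in lborel. (AE \<tau> in lborel. 0 < \<tau> \<longrightarrow> \<tau> < t \<longrightarrow> t < T \<longrightarrow> supersolution_at G p v \<tau> t)
      \<and> (0 < t \<and> t < T \<longrightarrow> ball_mass v 0 R t < \<infinity>)"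
    using sup' ball_mass_finite[OF G \<theta> p v sup c cm] by eventually_elim blast
  from AE_lborel_ex_between[OF this T] obtain t0 where t0: "0 < t0" "t0 < T"
    "AE \<tau> in lborel. 0 < \<tau> \<longrightarrow> \<tau> < t0 \<longrightarrow> supersolution_at G p v \<tau> t0" "ball_mass v 0 R t0 < \<infinity>"
    by auto
  define M0 where "M0 = enn2real (ball_mass v 0 R t0)"
  have M0: "ball_mass v 0 R t0 = ennreal M0" "0 \<le> M0" using t0(4) by (auto simp: M0_def less_top)
  show thesis
  proof (rule that[OF t0(1,2)])
    \<comment> \<open>The summand 1 makes the bound positive even for zero mass, so that it can be
      divided by.\<close>
    show "0 < M0 / c + 1" using M0 c by (simp add: add_nonneg_pos)
    assume TR: "T powr (1 / \<theta>) \<le> R"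
    show "AE \<tau> in lborel. 0 < \<tau> \<and> \<tau> < t0 \<longrightarrow> ball_mass v 0 R \<tau> \<le> ennreal (M0 / c + 1)"
      using t0(3)
    proof eventually_elim
      case (elim \<tau>)
      show ?case
      proof
        assume \<tau>: "0 < \<tau> \<and> \<tau> < t0"
        have "(t0 - \<tau>) powr (1 / \<theta>) \<le> T powr (1 / \<theta>)"
          using \<tau> t0 \<theta> by (intro powr_mono2) auto
        then have R: "(t0 - \<tau>) powr (1 / \<theta>) \<le> R" using TR by simp
        have "supersolution_at G p v \<tau> t0" "\<tau> < t0" using elim \<tau> by auto
        from ball_mass_inequality[OF G \<theta> p v sup c cm this R, of 0]
        have le: "ennreal c * ball_mass v 0 R \<tau> \<le> ennreal M0"
          unfolding M0(1) by (rule order_trans[rotated]) (rule add_increasing2, simp_all)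
        have "ball_mass v 0 R \<tau> = ennreal (1 / c) * (ennreal c * ball_mass v 0 R \<tau>)"
          using c by (simp add: mult.assoc[symmetric] ennreal_mult[symmetric])
        also have "\<dots> \<le> ennreal (1 / c) * ennreal M0" by (rule mult_left_mono[OF le]) simp
        also have "\<dots> = ennreal (M0 / c)" using c M0 by (simp add: ennreal_mult[symmetric])
        also have "\<dots> \<le> ennreal (M0 / c + 1)" by (intro ennreal_leI) simp
        finally show "ball_mass v 0 R \<tau> \<le> ennreal (M0 / c + 1)" .
      qed
    qed
  qed
qed

text \<open>Smoothing \<phi> costs an additive error, which is then multiplied by v and integrated.
  It is charged only inside a ball containing the support of \<phi>, for outside it \<phi> is 0, and
  there the mass is bounded uniformly in \<tau>.\<close>

lemma pairing_almost_increasing: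
  assumes \<phi>: "cc_nonneg \<phi>" and \<epsilon>: "0 < \<epsilon>"
  shows "\<exists>\<delta>>0. AE t in lborel. 0 < t \<and> t < \<delta> \<longrightarrow> (AE \<tau> in lborel. 0 < \<tau> \<and> \<tau> < t \<longrightarrow>
    enn2real (pairing v \<phi> \<tau>) \<le> enn2real (pairing v \<phi> t) + \<epsilon>)"
proof -
  have [measurable]: "v \<in> borel_measurable (borel \<Otimes>\<^sub>M borel)" using v by (simp add: borel_prod)
  have [measurable]: "\<phi> \<in> borel_measurable borel"
    using \<phi> by (auto intro!: borel_measurable_continuous_onI cc_nonneg_continuous)
  obtain K where K: "compact K" "\<And>x. x \<notin> K \<Longrightarrow> \<phi> x = 0" using \<phi> by (metis cc_nonneg_support)
  obtain R0 where R0: "K \<subseteq> ball 0 R0"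
    using compact_imp_bounded[OF K(1)] bounded_subset_ballD by blast
  define R where "R = max R0 (T powr (1 / \<theta>))"
  have [measurable]: "ball 0 R \<in> sets (borel :: (real ^ 'n) measure)" by simp
  have off: "\<phi> x = 0" if "x \<notin> ball 0 R" for x
  proof -
    have "x \<notin> ball 0 R0" using that by (simp add: R_def)
    then show ?thesis using R0 K(2) by blast
  qed
  obtain t0 M where t0: "0 < t0" "t0 < T" "0 < M"
    and M: "AE \<tau> in lborel. 0 < \<tau> \<and> \<tau> < t0 \<longrightarrow> ball_mass v 0 R \<tau> \<le> ennreal M"
    using ball_mass_locally_bounded[of R] by (auto simp: R_def)
  \<comment> \<open>The pointwise smoothing error, chosen so that its total over a mass of at most M
    is \<epsilon>.\<close>
  define e where "e = \<epsilon> / M"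
  have e: "0 < e" "e * M = \<epsilon>" using \<epsilon> t0 by (auto simp: e_def)
  obtain r0 where r0: "r0 > 0" "\<And>r y. 0 < r \<Longrightarrow> r < r0 \<Longrightarrow>
    ennreal (\<phi> y) \<le> (\<integral>\<^sup>+x. ennreal (\<phi> x) * ennreal (G (x - y) r) \<partial>lborel) + ennreal e"
    using kernel_smoothing_lower[OF \<phi> e(1)] by blast
  note fin = ball_mass_finite[OF G \<theta> p v sup c cm]
  show ?thesis
  proof (intro exI[of _ "min t0 r0"] conjI)
    show "AE t in lborel. 0 < t \<and> t < min t0 r0 \<longrightarrow> (AE \<tau> in lborel. 0 < \<tau> \<and> \<tau> < t \<longrightarrow>
      enn2real (pairing v \<phi> \<tau>) \<le> enn2real (pairing v \<phi> t) + \<epsilon>)"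
      using sup' fin
    proof eventually_elim
      case (elim t)
      show ?case
      proof
        assume t: "0 < t \<and> t < min t0 r0"
        have tT: "t < T" using t t0 by simp
        have fint: "pairing v \<phi> t < \<infinity>"
          using elim(2) t tT by (intro pairing_finite[OF v \<phi>]) auto
        show "AE \<tau> in lborel. 0 < \<tau> \<and> \<tau> < t \<longrightarrow> enn2real (pairing v \<phi> \<tau>) \<le> enn2real (pairing v \<phi> t) + \<epsilon>"
          using elim(1) M
        proof eventually_elim
          case (elim \<tau>)
          show ?case
          proof
            assume \<tau>: "0 < \<tau> \<and> \<tau> < t"
            have [measurable]: "(\<lambda>x. G x (t - \<tau>)) \<in> borel_measurable borel"
              using borel_measurable_kernel_slice[OF G \<theta>, of "t - \<tau>"] \<tau> by simp
            let ?S = "\<lambda>y. \<integral>\<^sup>+x. ennreal (\<phi> x) * ennreal (G (x - y) (t - \<tau>)) \<partial>lborel"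
            have "pairing v \<phi> \<tau> \<le> (\<integral>\<^sup>+y. ?S y * v (y, \<tau>) + ennreal e * (v (y, \<tau>) * indicator (ball 0 R) y) \<partial>lborel)"
              unfolding pairing_def
            proof (rule nn_integral_mono)
              fix y
              show "ennreal (\<phi> y) * v (y, \<tau>) \<le> ?S y * v (y, \<tau>) + ennreal e * (v (y, \<tau>) * indicator (ball 0 R) y)"
              proof (cases "y \<in> ball 0 R")
                case True
                have "ennreal (\<phi> y) * v (y, \<tau>) \<le> (?S y + ennreal e) * v (y, \<tau>)"
                  using t \<tau> by (intro mult_right_mono r0(2)) auto
                then show ?thesis using True by (simp add: distrib_right)
              qed (simp add: off)
            qed
            also have "\<dots> = (\<integral>\<^sup>+y. ?S y * v (y, \<tau>) \<partial>lborel) + ennreal e * ball_mass v 0 R \<tau>"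
              unfolding ball_mass_def by (subst nn_integral_add) (auto simp: nn_integral_cmult)
            also have "\<dots> \<le> pairing v \<phi> t + ennreal e * ennreal M"
            proof (intro add_mono mult_left_mono)
              have "supersolution_at G p v \<tau> t" using elim \<tau> tT by simp
              then have "(\<integral>\<^sup>+y. ?S y * v (y, \<tau>) \<partial>lborel)
                + (\<integral>\<^sup>+s\<in>{\<tau><..<t}. (\<integral>\<^sup>+y. (\<integral>\<^sup>+x. ennreal (\<phi> x) * ennreal (G (x - y) (t - s)) \<partial>lborel)
                  * ennreal_powr (v (y, s)) p \<partial>lborel) \<partial>lborel) \<le> pairing v \<phi> t"
                unfolding pairing_def using \<tau> by (intro supersolution_tested[OF G \<theta> v]) auto
              then show "(\<integral>\<^sup>+y. ?S y * v (y, \<tau>) \<partial>lborel) \<le> pairing v \<phi> t"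
                by (rule order_trans[rotated]) (rule add_increasing2, simp_all)
              show "ball_mass v 0 R \<tau> \<le> ennreal M" using elim(2) \<tau> t by simp
            qed simp
            also have "\<dots> = ennreal (enn2real (pairing v \<phi> t) + \<epsilon>)"
              using fint e t0 \<epsilon> by (simp add: ennreal_mult[symmetric] less_top)
            finally show "enn2real (pairing v \<phi> \<tau>) \<le> enn2real (pairing v \<phi> t) + \<epsilon>"
              using \<epsilon> by (intro enn2real_leI) auto
          qed
        qed
      qed
    qed
  qed (use t0 r0 in auto)
qed

lemma pairing_ess_lim: "cc_nonneg \<phi> \<Longrightarrow> \<exists>L. ess_lim_at_0 (\<lambda>t. enn2real (pairing v \<phi> t)) L"
  by (intro ess_lim_at_0_exists pairing_almost_increasing) auto

lemma initial_functional:
  obtains L where "positive_functional L"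
    "\<And>\<phi>. cc_nonneg \<phi> \<Longrightarrow> ess_lim_at_0 (\<lambda>t. enn2real (pairing v \<phi> t)) (L \<phi>)"
proof -
  define L where "L \<phi> = (SOME L. ess_lim_at_0 (\<lambda>t. enn2real (pairing v \<phi> t)) L)" for \<phi>
  have L: "ess_lim_at_0 (\<lambda>t. enn2real (pairing v \<phi> t)) (L \<phi>)" if "cc_nonneg \<phi>" for \<phi>
    unfolding L_def using pairing_ess_lim[OF that] by (rule someI_ex)
  have fin: "AE t in lborel. 0 < t \<and> t < T \<longrightarrow> pairing v \<phi> t < \<infinity>" if "cc_nonneg \<phi>" for \<phi>
    using ball_mass_finite[OF G \<theta> p v sup c cm] by eventually_elim (use pairing_finite[OF v that] in blast)
  have "positive_functional L"
  proof
    fix \<phi> :: "real ^ 'n \<Rightarrow> real" assume \<phi>: "cc_nonneg \<phi>"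
    have "ess_lim_at_0 (\<lambda>t. - 1 * enn2real (pairing v \<phi> t)) (- 1 * L \<phi>)"
      by (intro ess_lim_at_0_cmult L \<phi>)
    from ess_lim_at_0_le[OF this, of 1 0] show "0 \<le> L \<phi>" by simp
    fix k :: real assume k: "0 < k"
    show "L (\<lambda>x. k * \<phi> x) = k * L \<phi>"
    proof (rule ess_lim_at_0_unique[OF L])
      show "ess_lim_at_0 (\<lambda>t. enn2real (pairing v (\<lambda>x. k * \<phi> x) t)) (k * L \<phi>)"
        using ess_lim_at_0_cmult[OF L[OF \<phi>], of k] k \<phi>
        by (simp add: pairing_scale[OF v] enn2real_mult)
    qed (use \<phi> k in \<open>simp add: cc_nonneg_scale\<close>)
  next
    fix \<phi> \<psi> :: "real ^ 'n \<Rightarrow> real" assume \<phi>: "cc_nonneg \<phi>" and \<psi>: "cc_nonneg \<psi>"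
    show "L (\<lambda>x. \<phi> x + \<psi> x) = L \<phi> + L \<psi>"
    proof (rule ess_lim_at_0_unique[OF L])
      show "ess_lim_at_0 (\<lambda>t. enn2real (pairing v (\<lambda>x. \<phi> x + \<psi> x) t)) (L \<phi> + L \<psi>)"
      \<comment> \<open>\<open>enn2real\<close> is additive on finite values, so the identity of the
        pairings is available at almost every time.\<close>
      proof (rule ess_lim_at_0_cong[OF T])
        show "ess_lim_at_0 (\<lambda>t. enn2real (pairing v \<phi> t) + enn2real (pairing v \<psi> t)) (L \<phi> + L \<psi>)"
          by (intro ess_lim_at_0_add L \<phi> \<psi>)
        show "AE t in lborel. 0 < t \<and> t < T \<longrightarrow>
          enn2real (pairing v \<phi> t) + enn2real (pairing v \<psi> t) = enn2real (pairing v (\<lambda>x. \<phi> x + \<psi> x) t)"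
          using fin[OF \<phi>] fin[OF \<psi>]
          by eventually_elim (auto simp: pairing_add[OF v \<phi> \<psi>] enn2real_plus)
      qed
    qed (rule cc_nonneg_add[OF \<phi> \<psi>])
  qed
  then show thesis using L that by blast
qed

end

text \<open>The indicator of a ball is not a test function. Inner regularity replaces the ball by a
  compact subset \<open>K\<close>, whose farthest point from the centre lies strictly inside and
  leaves room for a continuous cutoff from 1 on \<open>K\<close> to 0 off the ball.\<close>

lemma measure_ball_le_of_ess_lim:
  fixes v :: "'a::euclidean_space \<times> real \<Rightarrow> ennreal" and \<mu> :: "'a measure"
  assumes v: "v \<in> borel_measurable borel" and \<mu>: "radon_measure \<mu>"
    and tr: "\<And>\<phi>. cc_nonneg \<phi> \<Longrightarrow> ess_lim_at_0 (\<lambda>t. enn2real (pairing v \<phi> t)) (\<integral>x. \<phi> x \<partial>\<mu>)"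
    and \<delta>: "0 < \<delta>" "AE t in lborel. 0 < t \<and> t < \<delta> \<longrightarrow> ball_mass v x0 \<sigma> t \<le> ennreal C" and C: "0 \<le> C"
  shows "emeasure \<mu> (ball x0 \<sigma>) \<le> ennreal C"
proof -
  have s: "sets \<mu> = sets borel" and fin: "\<And>K. compact K \<Longrightarrow> emeasure \<mu> K < \<infinity>"
    using \<mu> by (auto simp: radon_measure_def)
  have "emeasure \<mu> K \<le> ennreal C" if K: "compact K" "K \<subseteq> ball x0 \<sigma>" for K
  proof (cases "K = {}")
    case False
    have "continuous_on K (dist x0)" by (intro continuous_intros)
    from continuous_attains_sup[OF K(1) False this]
    obtain z where z: "z \<in> K" "\<And>y. y \<in> K \<Longrightarrow> dist x0 y \<le> dist x0 z" by blast
    define r where "r = dist x0 z"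
    have r: "r < \<sigma>" using z K by (auto simp: r_def)
    define \<phi> where "\<phi> x = max 0 (min 1 ((\<sigma> - dist x0 x) / (\<sigma> - r)))" for x
    have off: "\<phi> x = 0" if "x \<notin> ball x0 \<sigma>" for x
      using that r by (simp add: \<phi>_def field_simps)
    have \<phi>: "cc_nonneg \<phi>"
    proof (rule cc_nonnegI[of _ "cball x0 \<sigma>"])
      show "continuous_on UNIV \<phi>"
        unfolding \<phi>_def using r by (intro continuous_intros) auto
      show "\<phi> x = 0" if "x \<notin> cball x0 \<sigma>" for x
        using that by (intro off) simp
    qed (simp_all add: \<phi>_def)
    have one: "\<phi> x = 1" if "x \<in> K" for x
    proof -
      have "1 \<le> (\<sigma> - dist x0 x) / (\<sigma> - r)" using z(2)[OF that] r by (simp add: r_def)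
      then show ?thesis by (simp add: \<phi>_def)
    qed
    have le: "enn2real (pairing v \<phi> t) \<le> C" if "ball_mass v x0 \<sigma> t \<le> ennreal C" for t
    proof -
      have "pairing v \<phi> t \<le> ennreal 1 * ball_mass v x0 \<sigma> t"
        by (rule pairing_le_ball_mass[OF v]) (use off in \<open>auto simp: \<phi>_def\<close>)
      then have "pairing v \<phi> t \<le> ennreal C" using that by simp
      with C show ?thesis by (rule enn2real_leI)
    qed
    have "(\<integral>x. \<phi> x \<partial>\<mu>) \<le> C"
      using \<delta>(2) le by (intro ess_lim_at_0_le[OF tr[OF \<phi>] \<delta>(1)]) (auto elim!: eventually_mono)
    have "emeasure \<mu> K = (\<integral>\<^sup>+x. indicator K x \<partial>\<mu>)"
      using s K by (simp add: borel_compact)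
    also have "\<dots> \<le> (\<integral>\<^sup>+x. ennreal (\<phi> x) \<partial>\<mu>)"
      using one by (intro nn_integral_mono) (auto split: split_indicator)
    also have "\<dots> = ennreal (\<integral>x. \<phi> x \<partial>\<mu>)"
      by (rule nn_integral_eq_integral[OF integrable_cc_nonneg[OF s fin \<phi>]]) (auto simp: \<phi>_def)
    also have "\<dots> \<le> ennreal C" using \<open>(\<integral>x. \<phi> x \<partial>\<mu>) \<le> C\<close> by (rule ennreal_leI)
    finally show ?thesis .
  qed simp
  moreover have "emeasure \<mu> (ball x0 \<sigma>) = (SUP K\<in>{K. compact K \<and> K \<subseteq> ball x0 \<sigma>}. emeasure \<mu> K)"
    using \<mu> by (simp add: radon_measure_def)
  ultimately show ?thesis by (auto intro!: SUP_least)
qed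

section \<open>Initial traces expressed through limits of pairings\<close>

lemma cc_nonneg_test_function:
  fixes \<phi> :: "'a::euclidean_space \<Rightarrow> real"
  assumes "cc_nonneg \<phi>"
  shows "continuous_on UNIV \<phi> \<and> compact (closure {x. \<phi> x \<noteq> 0})"
proof -
  obtain K where K: "compact K" "\<And>x. x \<notin> K \<Longrightarrow> \<phi> x = 0" using assms by (metis cc_nonneg_support)
  then have "closure {x. \<phi> x \<noteq> 0} \<subseteq> K"
    by (intro closure_minimal) (auto simp: compact_imp_closed)
  then have "compact (closure {x. \<phi> x \<noteq> 0})"
    using K(1) by (metis closed_closure compact_Int_closed inf.absorb_iff2)
  then show ?thesis using cc_nonneg_continuous[OF assms] by simp
qed

lemma initial_trace_pairing:
  fixes v :: "(real ^ 'n) \<times> real \<Rightarrow> ennreal"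
  assumes T: "0 < T" and v: "v \<in> borel_measurable borel"
    and uv: "AE t in lborel. 0 < t \<and> t < T \<longrightarrow> (AE y in lborel. u y t = v (y, t))"
    and fin: "AE t in lborel. 0 < t \<and> t < T \<longrightarrow> (\<forall>x0 R. ball_mass v x0 R t < \<infinity>)"
    and \<mu>: "initial_trace T u \<mu>" and \<phi>: "cc_nonneg \<phi>"
  shows "ess_lim_at_0 (\<lambda>t. enn2real (pairing v \<phi> t)) (\<integral>x. \<phi> x \<partial>\<mu>)"
proof (rule ess_lim_at_0_cong[OF T])
  show "ess_lim_at_0 (\<lambda>t. \<integral>y. enn2real (u y t) * \<phi> y \<partial>lebesgue) (\<integral>x. \<phi> x \<partial>\<mu>)"
    using \<mu> cc_nonneg_test_function[OF \<phi>] unfolding initial_trace_def by blast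
  show "AE t in lborel. 0 < t \<and> t < T \<longrightarrow>
    (\<integral>y. enn2real (u y t) * \<phi> y \<partial>lebesgue) = enn2real (pairing v \<phi> t)"
    using uv fin by eventually_elim (auto intro: pairing_lebesgue(2)[OF v \<phi>])
qed

lemma initial_traceI:
  fixes v :: "(real ^ 'n) \<times> real \<Rightarrow> ennreal" and \<mu> :: "(real ^ 'n) measure"
  assumes T: "0 < T" and v: "v \<in> borel_measurable borel"
    and uv: "AE t in lborel. 0 < t \<and> t < T \<longrightarrow> (AE y in lborel. u y t = v (y, t))"
    and fin: "AE t in lborel. 0 < t \<and> t < T \<longrightarrow> (\<forall>x0 R. ball_mass v x0 R t < \<infinity>)"
    and \<mu>: "radon_measure \<mu>"
    and lim: "\<And>\<phi>. cc_nonneg \<phi> \<Longrightarrow> ess_lim_at_0 (\<lambda>t. enn2real (pairing v \<phi> t)) (\<integral>x. \<phi> x \<partial>\<mu>)"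
  shows "initial_trace T u \<mu>"
  unfolding initial_trace_def
proof (intro allI impI)
  fix \<phi> :: "real ^ 'n \<Rightarrow> real"
  assume a: "continuous_on UNIV \<phi> \<and> compact (closure {x. \<phi> x \<noteq> 0})"
  define P where "P x = max 0 (\<phi> x)" for x
  define Q where "Q x = max 0 (- \<phi> x)" for x
  have eq: "\<phi> x = P x - Q x" for x by (simp add: P_def Q_def)
  define K where "K = closure {x. \<phi> x \<noteq> 0}"
  have K: "compact K" using a by (simp add: K_def)
  have z: "\<phi> x = 0" if "x \<notin> K" for x
    using that closure_subset[of "{x. \<phi> x \<noteq> 0}"] unfolding K_def by blast
  have "continuous_on UNIV P" "continuous_on UNIV Q"
    unfolding P_def Q_def using a by (auto intro!: continuous_intros)
  then have P: "cc_nonneg P" and Q: "cc_nonneg Q"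
    by (auto intro!: cc_nonnegI[OF _ _ K] simp: P_def Q_def z)
  have \<mu>': "sets \<mu> = sets borel" "\<And>K. compact K \<Longrightarrow> emeasure \<mu> K < \<infinity>"
    using \<mu> by (auto simp: radon_measure_def)
  have intm: "integrable \<mu> P" "integrable \<mu> Q"
    using integrable_cc_nonneg[OF \<mu>'] P Q by auto
  have both: "AE t in lborel. 0 < t \<and> t < T \<longrightarrow> integrable lebesgue (\<lambda>y. enn2real (u y t) * \<phi> y) \<and>
    (\<integral>y. enn2real (u y t) * \<phi> y \<partial>lebesgue) = enn2real (pairing v P t) + - 1 * enn2real (pairing v Q t)"
    using uv fin
  proof eventually_elim
    case (elim t)
    show ?case
    proof
      assume t: "0 < t \<and> t < T"
      then have 1: "AE y in lborel. u y t = v (y, t)" and 2: "\<And>x0 R. ball_mass v x0 R t < \<infinity>"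
        using elim by auto
      have e: "enn2real (u y t) * \<phi> y = enn2real (u y t) * P y - enn2real (u y t) * Q y" for y
        by (simp add: eq right_diff_distrib)
      have pl: "integrable lebesgue (\<lambda>y. enn2real (u y t) * \<psi> y)"
        "(\<integral>y. enn2real (u y t) * \<psi> y \<partial>lebesgue) = enn2real (pairing v \<psi> t)" if "cc_nonneg \<psi>" for \<psi>
        using pairing_lebesgue[where u = u and t = t, OF v that 2 1] by auto
      show "integrable lebesgue (\<lambda>y. enn2real (u y t) * \<phi> y) \<and>
        (\<integral>y. enn2real (u y t) * \<phi> y \<partial>lebesgue) = enn2real (pairing v P t) + - 1 * enn2real (pairing v Q t)"
        unfolding e using pl[OF P] pl[OF Q] by simp
    qed
  qed
  show "(AE t in lebesgue. 0 < t \<and> t < T \<longrightarrow> integrable lebesgue (\<lambda>y. enn2real (u y t) * \<phi> y)) \<and>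
    ess_lim_at_0 (\<lambda>t. \<integral>y. enn2real (u y t) * \<phi> y \<partial>lebesgue) (\<integral>y. \<phi> y \<partial>\<mu>)"
  proof
    show "AE t in lebesgue. 0 < t \<and> t < T \<longrightarrow> integrable lebesgue (\<lambda>y. enn2real (u y t) * \<phi> y)"
      using both by (intro AE_completion) (auto elim: eventually_mono)
    show "ess_lim_at_0 (\<lambda>t. \<integral>y. enn2real (u y t) * \<phi> y \<partial>lebesgue) (\<integral>y. \<phi> y \<partial>\<mu>)"
    proof (rule ess_lim_at_0_cong[OF T])
      show "ess_lim_at_0 (\<lambda>t. enn2real (pairing v P t) + - 1 * enn2real (pairing v Q t)) (\<integral>y. \<phi> y \<partial>\<mu>)"
        unfolding eq using ess_lim_at_0_add[OF lim[OF P] ess_lim_at_0_cmult[OF lim[OF Q], of "- 1"]] intm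
        by simp
      show "AE t in lborel. 0 < t \<and> t < T \<longrightarrow>
        enn2real (pairing v P t) + - 1 * enn2real (pairing v Q t) = (\<integral>y. enn2real (u y t) * \<phi> y \<partial>lebesgue)"
        using both by (auto elim: eventually_mono)
    qed
  qed
qed

text \<open>With l = ln(e + X) one has l \<le> 2 + ln X, hence l is at most 3 times the larger of 1
  and ln X. The constant bound \<open>a\<close> serves where ln X \<le> 1, the logarithmic one
  beyond, and 3 to the power q is the price in both cases.\<close>

lemma log_bound_combine:
  fixes X q a b :: real
  assumes X: "1 < X" and q: "0 < q" and ab: "0 \<le> a" "0 \<le> b" and m: "m \<le> a" "m \<le> b * ln X powr (- q)"
  shows "m \<le> (a + b) * 3 powr q * ln (exp 1 + X) powr (- q)"
proof -
  define l where "l = ln (exp 1 + X)"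
  have "1 < exp 1 + X" using X exp_gt_zero[of "1::real"] by linarith
  then have l: "l > 0" by (simp add: l_def)
  have e2: "1 + exp 1 \<le> exp (2::real)"
  proof -
    have "2 \<le> exp (1::real)" using exp_ge_add_one_self[of 1] by simp
    then have "2 * exp (1::real) \<le> exp 1 * exp 1" by (rule mult_right_mono) simp
    with \<open>2 \<le> exp (1::real)\<close> have "1 + exp 1 \<le> exp 1 * exp (1::real)" by linarith
    then show ?thesis by (simp add: exp_add[symmetric])
  qed
  have "exp 1 + X \<le> exp 2 * X"
  proof -
    have "exp 1 + X \<le> exp 1 * X + X" using X by simp
    also have "\<dots> = (1 + exp 1) * X" by (simp add: algebra_simps)
    also have "\<dots> \<le> exp 2 * X" using e2 X by (intro mult_right_mono) auto
    finally show ?thesis .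
  qed
  then have "l \<le> ln (exp 2 * X)"
    unfolding l_def using X by (intro ln_mono) (auto intro: add_pos_pos)
  then have ll: "l \<le> 2 + ln X" using X by (simp add: ln_mult)
  have resc: "y powr (- q) \<le> 3 powr q * l powr (- q)" if "l \<le> 3 * y" "0 < y" for y
  proof -
    have "(3 * y) powr (- q) \<le> l powr (- q)" using that l q by (intro powr_mono2') auto
    then have "3 powr q * ((3 * y) powr (- q)) \<le> 3 powr q * l powr (- q)" by (intro mult_left_mono) auto
    then show ?thesis using that by (simp add: powr_mult powr_minus field_simps)
  qed
  have nn: "0 \<le> a * (3 powr q * l powr (- q))" "0 \<le> b * (3 powr q * l powr (- q))" using ab by auto
  show ?thesis
  proof (cases "ln X \<le> 1")
    case True
    then have "1 \<le> 3 powr q * l powr (- q)" using resc[of 1] ll by simp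
    then have "a * 1 \<le> a * (3 powr q * l powr (- q))" using ab by (intro mult_left_mono)
    then show ?thesis using m(1) nn unfolding l_def[symmetric] by (simp add: algebra_simps)
  next
    case False
    then have "ln X powr (- q) \<le> 3 powr q * l powr (- q)" using resc[of "ln X"] ll by simp
    then have "b * ln X powr (- q) \<le> b * (3 powr q * l powr (- q))" using ab by (intro mult_left_mono)
    then show ?thesis using m(2) nn unfolding l_def[symmetric] by (simp add: algebra_simps)
  qed
qed

theorem theorem1p1:
  fixes \<theta> p :: real
  assumes "0 < \<theta>" and "\<theta> \<le> 2" and "1 < p"
  defines "N \<equiv> real CARD('n::finite)"
  defines "p\<^sub>\<theta> \<equiv> 1 + \<theta> / N"
  shows "\<exists>\<gamma>\<^sub>1>0. \<forall>(G :: real ^ 'n \<Rightarrow> real \<Rightarrow> real) (T :: real) (u :: real ^ 'n \<Rightarrow> real \<Rightarrow> ennreal).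
    fundamental_solution \<theta> G \<longrightarrow> 0 < T \<longrightarrow> is_solution G p T u \<longrightarrow>
      (\<exists>!\<mu>. radon_measure \<mu> \<and> initial_trace T u \<mu>) \<and>
      (\<forall>\<mu>. radon_measure \<mu> \<and> initial_trace T u \<mu> \<longrightarrow>
         (p < p\<^sub>\<theta> \<longrightarrow>
            (SUP x. emeasure \<mu> (ball x (T powr (1 / \<theta>))))
              \<le> ennreal (\<gamma>\<^sub>1 * T powr (N / \<theta> - 1 / (p - 1)))) \<and>
         (p = p\<^sub>\<theta> \<longrightarrow> (\<forall>\<sigma>. 0 < \<sigma> \<and> \<sigma> < T powr (1 / \<theta>) \<longrightarrow>
            (SUP x. emeasure \<mu> (ball x \<sigma>))
              \<le> ennreal (\<gamma>\<^sub>1 * ln (exp 1 + T powr (1 / \<theta>) / \<sigma>) powr (- (N / \<theta>))))) \<and>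
         (p > p\<^sub>\<theta> \<longrightarrow> (\<forall>\<sigma>. 0 < \<sigma> \<and> \<sigma> < T powr (1 / \<theta>) \<longrightarrow>
            (SUP x. emeasure \<mu> (ball x \<sigma>))
              \<le> ennreal (\<gamma>\<^sub>1 * \<sigma> powr (N - \<theta> / (p - 1))))))"
proof -
  note \<theta> = assms(1) and p = assms(3)
  \<comment> \<open>\<open>c\<close> is fixed before \<open>G\<close>, \<open>T\<close> and
    \<open>u\<close>, so the constants built from it depend only on N, \<theta> and p.\<close>
  obtain c where c: "0 < c" and cmass:
    "\<And>(G :: real ^ 'n \<Rightarrow> real \<Rightarrow> real) r R x0 y. fundamental_solution \<theta> G \<Longrightarrow> 0 < r \<Longrightarrow> r powr (1 / \<theta>) \<le> R \<Longrightarrow>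
      y \<in> ball x0 R \<Longrightarrow> ennreal c \<le> (\<integral>\<^sup>+x\<in>ball x0 R. ennreal (G (x - y) r) \<partial>lborel)"
    using kernel_ball_mass[OF \<theta>, where 'n = 'n] by blast
  define D where "D = 1 - (2::real) powr (1 - p)"
  have D: "D > 0" using p powr_less_mono[of "1 - p" 0 2] by (simp add: D_def)
  define V where "V = unit_ball_vol N"
  have V: "V > 0" by (simp add: V_def N_def)
  have N: "N > 0" by (simp add: N_def)
  define C1 where "C1 = V / c * (D * c / 2) powr (- 1 / (p - 1))"
  define C2 where "C2 = (D * c * V powr (1 - p)) powr (- 1 / (p - 1)) / c"
  \<comment> \<open>\<open>C1\<close> serves the subcritical and supercritical cases. The other
    summand comes from merging the two critical bounds; its power of \<theta> arises from ln(T /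
    \<sigma>^\<theta>) = \<theta> ln(T^(1/\<theta>) / \<sigma>).\<close>
  define \<gamma> where "\<gamma> = C1 + (C1 + C2 * \<theta> powr (- (N / \<theta>))) * 3 powr (N / \<theta>)"
  have C1: "C1 > 0" using V c D by (simp add: C1_def)
  have C2: "C2 \<ge> 0" using c by (simp add: C2_def)
  have \<gamma>1: "C1 \<le> \<gamma>" and \<gamma>2: "(C1 + C2 * \<theta> powr (- (N / \<theta>))) * 3 powr (N / \<theta>) \<le> \<gamma>"
    using C1 C2 by (auto simp: \<gamma>_def)
  show ?thesis
  proof (intro exI[of _ \<gamma>] conjI allI impI)
    show "0 < \<gamma>" using C1 \<gamma>1 by simp
  next
    fix G :: "real ^ 'n \<Rightarrow> real \<Rightarrow> real" and T and u :: "real ^ 'n \<Rightarrow> real \<Rightarrow> ennreal"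
    assume G: "fundamental_solution \<theta> G" and T: "0 < T" and sol: "is_solution G p T u"
    obtain v where v: "v \<in> borel_measurable borel"
      and uv: "AE t in lborel. 0 < t \<and> t < T \<longrightarrow> (AE y in lborel. u y t = v (y, t))"
      and sup: "AE \<tau> in lborel. AE t in lborel. 0 < \<tau> \<longrightarrow> \<tau> < t \<longrightarrow> t < T \<longrightarrow> supersolution_at G p v \<tau> t"
      and sup': "AE t in lborel. AE \<tau> in lborel. 0 < \<tau> \<longrightarrow> \<tau> < t \<longrightarrow> t < T \<longrightarrow> supersolution_at G p v \<tau> t"
      using is_solution_borel_version[OF sol] by blast
    have cm: "\<forall>r R x0 y. 0 < r \<longrightarrow> r powr (1 / \<theta>) \<le> R \<longrightarrow> y \<in> ball x0 R \<longrightarrow>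
      ennreal c \<le> (\<integral>\<^sup>+x\<in>ball x0 R. ennreal (G (x - y) r) \<partial>lborel)"
      using cmass[OF G] by blast
    note fin = ball_mass_finite[OF G \<theta> p v sup c cm]
    note trace = initial_trace_pairing[OF T v uv fin]
    obtain L where L: "positive_functional L"
      "\<And>\<phi>. cc_nonneg \<phi> \<Longrightarrow> ess_lim_at_0 (\<lambda>t. enn2real (pairing v \<phi> t)) (L \<phi>)"
      using initial_functional[OF G \<theta> p T v sup sup' c cm] by blast
    interpret positive_functional L by (rule L(1))
    show "\<exists>!\<mu>. radon_measure \<mu> \<and> initial_trace T u \<mu>"
    proof (intro ex1I[of _ riesz_measure] conjI)
      show "radon_measure riesz_measure" by (rule riesz_representation(1))
      show "initial_trace T u riesz_measure"
        using L(2) riesz_representation(2)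
        by (intro initial_traceI[OF T v uv fin riesz_representation(1)]) metis
      fix \<mu> assume \<mu>: "radon_measure \<mu> \<and> initial_trace T u \<mu>"
      show "\<mu> = riesz_measure"
      proof (rule radon_measure_eqI)
        fix \<phi> :: "real ^ 'n \<Rightarrow> real" assume \<phi>: "cc_nonneg \<phi>"
        show "(\<integral>x. \<phi> x \<partial>\<mu>) = (\<integral>x. \<phi> x \<partial>riesz_measure)"
          using ess_lim_at_0_unique[OF trace[OF _ \<phi>] L(2)[OF \<phi>]] \<mu> riesz_representation(2)[OF \<phi>] by simp
      qed (use \<mu> riesz_representation(1) in auto)
    qed
    \<comment> \<open>T' = T will give the subcritical bound, and T' = \<sigma>^\<theta> turns the
      same estimate into one for balls of radius \<sigma>.\<close>
    have est: "emeasure \<mu> (ball x (T' powr (1 / \<theta>))) \<le> ennreal (C1 * T' powr (N / \<theta> - 1 / (p - 1)))"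
      if \<mu>: "radon_measure \<mu> \<and> initial_trace T u \<mu>" and T': "0 < T'" "T' \<le> T" for \<mu> T' x
    proof (rule measure_ball_le_of_ess_lim[OF v])
      show "AE t in lborel. 0 < t \<and> t < T' / 2 \<longrightarrow>
        ball_mass v x (T' powr (1 / \<theta>)) t \<le> ennreal (C1 * T' powr (N / \<theta> - 1 / (p - 1)))"
        using ball_mass_bound[OF G \<theta> p v sup c cm T']
        by (rule eventually_mono) (simp add: C1_def V_def D_def N_def)
    qed (use \<mu> trace T' C1 in auto)
    have log_est: "emeasure \<mu> (ball x \<sigma>) \<le> ennreal (C2 * ln (T / \<sigma> powr \<theta>) powr (- 1 / (p - 1)))"
      if \<mu>: "radon_measure \<mu> \<and> initial_trace T u \<mu>" and crit: "p = p\<^sub>\<theta>" and \<sigma>: "0 < \<sigma>" "\<sigma> powr \<theta> < T" for \<mu> \<sigma> x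
    proof (rule measure_ball_le_of_ess_lim[OF v])
      have "p = 1 + \<theta> / real CARD('n)" using crit by (simp add: p\<^sub>\<theta>_def N_def)
      from ball_mass_log_bound[OF G \<theta> p v sup c cm this \<sigma>]
      show "AE t in lborel. 0 < t \<and> t < \<sigma> powr \<theta> \<longrightarrow>
        ball_mass v x \<sigma> t \<le> ennreal (C2 * ln (T / \<sigma> powr \<theta>) powr (- 1 / (p - 1)))"
        by (rule eventually_mono) (simp add: C2_def V_def D_def N_def)
    qed (use \<mu> trace \<sigma> C2 in auto)
    have pow: "0 < \<sigma> powr \<theta> \<and> \<sigma> powr \<theta> < T \<and> (\<sigma> powr \<theta>) powr (1 / \<theta>) = \<sigma>"
      if \<sigma>: "0 < \<sigma> \<and> \<sigma> < T powr (1 / \<theta>)" for \<sigma>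
    proof -
      have "\<sigma> powr \<theta> < (T powr (1 / \<theta>)) powr \<theta>" using \<sigma> \<theta> by (intro powr_less_mono2) auto
      then show ?thesis using \<sigma> \<theta> T by (simp add: powr_powr)
    qed
    fix \<mu> assume \<mu>: "radon_measure \<mu> \<and> initial_trace T u \<mu>"
    show "(SUP x. emeasure \<mu> (ball x (T powr (1 / \<theta>)))) \<le> ennreal (\<gamma> * T powr (N / \<theta> - 1 / (p - 1)))"
    proof (rule SUP_least)
      fix x
      have "emeasure \<mu> (ball x (T powr (1 / \<theta>))) \<le> ennreal (C1 * T powr (N / \<theta> - 1 / (p - 1)))"
        using est[OF \<mu> T] by simp
      also have "\<dots> \<le> ennreal (\<gamma> * T powr (N / \<theta> - 1 / (p - 1)))"
        using \<gamma>1 by (intro ennreal_leI mult_right_mono) auto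
      finally show "emeasure \<mu> (ball x (T powr (1 / \<theta>))) \<le> ennreal (\<gamma> * T powr (N / \<theta> - 1 / (p - 1)))" .
    qed
    fix \<sigma> assume \<sigma>: "0 < \<sigma> \<and> \<sigma> < T powr (1 / \<theta>)"
    note pw = pow[OF \<sigma>]
    have est\<sigma>: "emeasure \<mu> (ball x \<sigma>) \<le> ennreal (C1 * \<sigma> powr (N - \<theta> / (p - 1)))" for x
    proof -
      have "(\<sigma> powr \<theta>) powr (N / \<theta> - 1 / (p - 1)) = \<sigma> powr (N - \<theta> / (p - 1))"
        using \<theta> by (simp add: powr_powr right_diff_distrib)
      then show ?thesis using est[OF \<mu>, of "\<sigma> powr \<theta>" x] pw by simp
    qed
    show "(SUP x. emeasure \<mu> (ball x \<sigma>)) \<le> ennreal (\<gamma> * \<sigma> powr (N - \<theta> / (p - 1)))"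
    proof (rule SUP_least)
      fix x
      have "ennreal (C1 * \<sigma> powr (N - \<theta> / (p - 1))) \<le> ennreal (\<gamma> * \<sigma> powr (N - \<theta> / (p - 1)))"
        using \<gamma>1 by (intro ennreal_leI mult_right_mono) auto
      with est\<sigma> show "emeasure \<mu> (ball x \<sigma>) \<le> ennreal (\<gamma> * \<sigma> powr (N - \<theta> / (p - 1)))"
        by (rule order_trans)
    qed
    show "(SUP x. emeasure \<mu> (ball x \<sigma>)) \<le> ennreal (\<gamma> * ln (exp 1 + T powr (1 / \<theta>) / \<sigma>) powr (- (N / \<theta>)))"
      if crit: "p = p\<^sub>\<theta>"
    proof (rule SUP_least)
      fix x
      define q where "q = N / \<theta>"
      have q: "q > 0" using N \<theta> by (simp add: q_def)
      have p1: "p - 1 = \<theta> / N" using crit by (simp add: p\<^sub>\<theta>_def)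
      have pq: "1 / (p - 1) = q" "- 1 / (p - 1) = - q" using N \<theta> by (simp_all add: p1 q_def)
      define X where "X = T powr (1 / \<theta>) / \<sigma>"
      have X: "X > 1" using \<sigma> by (simp add: X_def)
      have "T / \<sigma> powr \<theta> = X powr \<theta>"
        using T \<sigma> \<theta> by (simp add: X_def powr_divide powr_powr)
      then have lnX: "ln (T / \<sigma> powr \<theta>) = \<theta> * ln X" using X by (simp add: ln_powr)
      define m where "m = enn2real (emeasure \<mu> (ball x \<sigma>))"
      \<comment> \<open>In the critical case the exponent of \<sigma> vanishes. What remains is a
        constant bound, which covers \<sigma> close to T^(1/\<theta>), where the logarithm tends to
        0.\<close>
      have "N - \<theta> / (p - 1) = 0" using N \<theta> by (simp add: p1)
      then have b1: "emeasure \<mu> (ball x \<sigma>) \<le> ennreal C1" using est\<sigma>[of x] \<sigma> by simp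
      have b2: "emeasure \<mu> (ball x \<sigma>) \<le> ennreal (C2 * \<theta> powr (- q) * ln X powr (- q))"
        using log_est[OF \<mu> crit, of \<sigma> x] pw \<sigma> X \<theta> unfolding lnX pq by (simp add: powr_mult mult.assoc)
      have m: "emeasure \<mu> (ball x \<sigma>) = ennreal m"
        using le_less_trans[OF b1 ennreal_less_top] by (simp add: m_def)
      have "m \<le> C1" using enn2real_leI[OF _ b1] C1 by (simp add: m_def)
      moreover have "m \<le> C2 * \<theta> powr (- q) * ln X powr (- q)"
        using enn2real_leI[OF _ b2] C2 by (simp add: m_def)
      ultimately have "m \<le> (C1 + C2 * \<theta> powr (- q)) * 3 powr q * ln (exp 1 + X) powr (- q)"
        using C1 C2 by (intro log_bound_combine[OF X q]) auto
      also have "\<dots> \<le> \<gamma> * ln (exp 1 + X) powr (- q)"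
        using \<gamma>2 by (intro mult_right_mono) (auto simp: q_def)
      finally show "emeasure \<mu> (ball x \<sigma>) \<le> ennreal (\<gamma> * ln (exp 1 + T powr (1 / \<theta>) / \<sigma>) powr (- (N / \<theta>)))"
        unfolding m X_def q_def by (rule ennreal_leI)
    qed
  qed
qed

end
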